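(* For every fixed integer $s\geq 3$, there exists a threshold probability for the property $\mathcal{A}_s$. That is, there exists a sequence $r_s=r_s(n)\in(0,1)$ such that for every $p=p(n)\in[0,1]$: if $p(n)/r_s(n)\to 0$ as $n\to\infty$, then $\mathbb{P}[\mathbb{G}(n,p)\in\mathcal{A}_s]\to 0$; and if $p(n)/r_s(n)\to\infty$ as $n\to\infty$, then $\mathbb{P}[\mathbb{G}(n,p)\in\mathcal{A}_s]\to 1$.
   Context: All graphs are finite and simple. $K_s$ is the complete graph on $s$ vertices. Given a graph $F$, an $F$-bootstrap percolation process is a sequence of graphs $H_0\subset H_1\subset\cdots\subset H_m$ (on the same vertex set) such that, for $i=1,\ldots,m$, $H_i$ is obtained from $H_{i-1}$ by adding an edge that belongs to a copy of $F$ in $H_i$. Given graphs $G$ and $F$, a spanning subgraph $H$ of $G$ is a weakly $F$-saturated subgraph of $G$ if $H$ contains no subgraph isomorphic to $F$ and there is an $F$-bootstrap percolation process $H=H_0\subset H_1\subset\cdots\subset H_m=G$. The minimum number of edges in a weakly $F$-saturated subgraph of $G$ is denoted by $\mathrm{wsat}(G,F)$. $\mathbb{G}(n,p)$ is the Erdős–Rényi random graph on vertex set $\{1,\ldots,n\}$ in which each pair of distinct vertices is an edge with probability $p$ independently of all others. $\mathcal{A}_s$ is the property of an $n$-vertex graph $G$ that $\mathrm{wsat}(G,K_s)=\binom{s-2}{2}+(s-2)(n-s+2)$ (this property is not assumed to be monotone). *)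

theory Defs
  imports "HOL-Probability.Probability" "HOL-Library.Ramsey"
begin

type_synonym 'a graph = "'a set \<times> 'a set set"

abbreviation verts :: "'a graph \<Rightarrow> 'a set" where "verts \<equiv> fst"
abbreviation edges :: "'a graph \<Rightarrow> 'a set set" where "edges \<equiv> snd"

definition simple_graph :: "'a graph \<Rightarrow> bool" where
  "simple_graph G \<longleftrightarrow> finite (verts G) \<and> edges G \<subseteq> [verts G]\<^bsup>2\<^esup>"

definition complete_graph :: "nat \<Rightarrow> nat graph" where
  "complete_graph s = ({1..s}, [{1..s}]\<^bsup>2\<^esup>)"

definition subgraph :: "'a graph \<Rightarrow> 'a graph \<Rightarrow> bool" where
  "subgraph H G \<longleftrightarrow> simple_graph H \<and> simple_graph G \<and>
     verts H \<subseteq> verts G \<and> edges H \<subseteq> edges G"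

definition spanning_subgraph :: "'a graph \<Rightarrow> 'a graph \<Rightarrow> bool" where
  "spanning_subgraph H G \<longleftrightarrow> subgraph H G \<and> verts H = verts G"

definition graph_iso :: "'a graph \<Rightarrow> 'b graph \<Rightarrow> bool" where
  "graph_iso G H \<longleftrightarrow>
     (\<exists>f. bij_betw f (verts G) (verts H) \<and> edges H = (\<lambda>e. f ` e) ` edges G)"

text \<open>A copy of \<open>F\<close> in \<open>G\<close> is a not necessarily induced subgraph \<open>K\<close> of \<open>G\<close> isomorphic to \<open>F\<close>.\<close>

definition copy_in :: "'b graph \<Rightarrow> 'a graph \<Rightarrow> 'a graph \<Rightarrow> bool" where
  "copy_in F G K \<longleftrightarrow> subgraph K G \<and> graph_iso F K"

definition bootstrap_step :: "'b graph \<Rightarrow> 'a graph \<Rightarrow> 'a graph \<Rightarrow> bool" where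
  "bootstrap_step F H H' \<longleftrightarrow> verts H' = verts H \<and>
     (\<exists>e. e \<notin> edges H \<and> edges H' = insert e (edges H) \<and> (\<exists>K. copy_in F H' K \<and> e \<in> edges K))"

definition bootstrap_process :: "'b graph \<Rightarrow> 'a graph list \<Rightarrow> bool" where
  "bootstrap_process F Hs \<longleftrightarrow> Hs \<noteq> [] \<and> successively (bootstrap_step F) Hs"

definition weakly_saturated :: "'a graph \<Rightarrow> 'b graph \<Rightarrow> 'a graph \<Rightarrow> bool" where
  "weakly_saturated G F H \<longleftrightarrow> spanning_subgraph H G \<and> (\<nexists>K. copy_in F H K) \<and>
     (\<exists>Hs. bootstrap_process F Hs \<and> hd Hs = H \<and> last Hs = G)"

text \<open>
  If \<open>F\<close> has an edge, every simple graph \<open>G\<close> has a weakly \<open>F\<close>-saturated subgraph (repeatedly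
  delete an edge lying in a copy of \<open>F\<close>), so the minimum below is over a nonempty set.
\<close>

definition wsat :: "'a graph \<Rightarrow> 'b graph \<Rightarrow> nat" where
  "wsat G F = (LEAST k. \<exists>H. weakly_saturated G F H \<and> card (edges H) = k)"

text \<open>The property \<open>\<A>\<^sub>s\<close>. The right-hand side is an integer expression because \<open>n - s + 2\<close> may be
  negative for small \<open>n\<close>; \<open>s \<ge> 3\<close> makes the subtraction inside the binomial exact.\<close>

definition wsat_prop :: "nat \<Rightarrow> nat graph set" where
  "wsat_prop s = {G. int (wsat G (complete_graph s)) =
     int ((s - 2) choose 2) + (int s - 2) * (int (card (verts G)) - int s + 2)}"

definition erdos_renyi :: "nat \<Rightarrow> real \<Rightarrow> nat graph pmf" where
  "erdos_renyi n p =
     map_pmf (\<lambda>present. ({1..n}, {e \<in> [{1..n}]\<^bsup>2\<^esup>. present e}))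
       (Pi_pmf ([{1..n}]\<^bsup>2\<^esup>) False (\<lambda>_. bernoulli_pmf p))"

end

(* Write d = s - 2 and call a pair covered if adding it completes a copy of K_s. If every pair is
   covered by G, then G percolates to the complete graph, so wsat(G, K_s) is at least wsat(K_n, K_s),
   and any further edges can be activated at once. Hence the property B = "A_s holds and every pair is
   covered" is monotone, and r is chosen with P(G(n, r) in B) = 1/2. Taking unions of independent
   copies gives P(B) -> 1 above r. Below r it must be shown that P(G(n, p) in A_s) >= eps forces
   P(G(n, L p) in B) >= eps/2 for a constant L. Let u be the probability that a pair is uncovered.
   If u >= n^-c, then the number of uncovered edges is concentrated (a pair-by-pair second moment with
   conditional independence, where the conditional probabilities concentrate by the Efron-Stein
   inequality) and exceeds wsat(K_n, K_s), while all uncovered edges must be present from the start;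
   for p = O(1/n) almost all edges are uncovered and the number of edges has no large atoms.
   If u < n^-c, add to G in A_s constantly many fresh copies of G(n, p): with high probability every
   pair is covered by fresh edges which are themselves covered by G, so everything gets activated. *)
theory Submission
  imports Defs "HOL-Real_Asymp.Real_Asymp"
begin

subsection \<open>Random subsets of a finite set\<close>

text \<open>Threshold theorems for monotone properties do not apply directly: adding an edge can
  destroy A_s, because a new edge that stays uncovered has to join the generators. The robust
  variant removes this obstruction, and its median level serves as threshold without ever being
  located. The split at u = n^-c is forced by two union or variance bounds. Chebyshev's inequality
  needs the variance of a conditional uncovered probability to be negligible against u^2. Averaging
  over the edges at one vertex brings this variance down to order p, and p <= n^(-3c) then leaves a
  factor n^-c to spare. In the opposite range a failure probability of n^-c is too weak for a union
  bound over all pairs, so it is amplified over constantly many disjoint vertex blocks; Harris'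
  inequality shows that a block of linear size still has a polynomially small uncovered probability.
  A fresh edge may be used only after it has been activated from G, since only the generators of G
  are known to be few; this is why coverings by covered edges are needed.\<close>

definition bexp :: "real \<Rightarrow> 'a set \<Rightarrow> ('a set \<Rightarrow> real) \<Rightarrow> real" where
  "bexp p E f = (\<Sum>S\<in>Pow E. p ^ card S * (1 - p) ^ card (E - S) * f S)"

lemma bexp_empty [simp]: "bexp p {} f = f {}"
  by (simp add: bexp_def)

text \<open>Conditioning on whether \<open>e\<close> is present. Most inductions over the ground set
  below rest on this identity between polynomials in \<open>p\<close>.\<close>

lemma bexp_insert:
  assumes "finite E" "e \<notin> E"
  shows "bexp p (insert e E) f = p * bexp p E (\<lambda>S. f (insert e S)) + (1 - p) * bexp p E f"
proof -
  have inj: "inj_on (insert e) (Pow E)"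
    using assms by (auto simp: inj_on_def)
  have "bexp p (insert e E) f = 
      (\<Sum>S\<in>Pow E. p ^ card S * (1 - p) ^ card (insert e E - S) * f S) +
      (\<Sum>S\<in>insert e ` Pow E. p ^ card S * (1 - p) ^ card (insert e E - S) * f S)"
    unfolding bexp_def Pow_insert using assms
    by (intro sum.union_disjoint) auto
  also have "(\<Sum>S\<in>Pow E. p ^ card S * (1 - p) ^ card (insert e E - S) * f S) = (1 - p) * bexp p E f"
    unfolding bexp_def sum_distrib_left
  proof (rule sum.cong[OF refl])
    fix S assume "S \<in> Pow E"
    hence "insert e E - S = insert e (E - S)" "finite (E - S)" "e \<notin> E - S" using assms by auto
    thus "p ^ card S * (1 - p) ^ card (insert e E - S) * f S
        = (1 - p) * (p ^ card S * (1 - p) ^ card (E - S) * f S)" by simp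
  qed
  also have "(\<Sum>S\<in>insert e ` Pow E. p ^ card S * (1 - p) ^ card (insert e E - S) * f S)
      = p * bexp p E (\<lambda>S. f (insert e S))"
    unfolding bexp_def sum_distrib_left sum.reindex[OF inj]
  proof (rule sum.cong[OF refl])
    fix S assume "S \<in> Pow E"
    hence "insert e E - insert e S = E - S" "finite S" "e \<notin> S"
      using assms by (auto dest: finite_subset)
    thus "((\<lambda>S. p ^ card S * (1 - p) ^ card (insert e E - S) * f S) \<circ> insert e) S
        = p * (p ^ card S * (1 - p) ^ card (E - S) * f (insert e S))" by simp
  qed
  finally show ?thesis by simp
qed

lemma bexp_cong:
  assumes "E = E'" "\<And>S. S \<subseteq> E' \<Longrightarrow> f S = g S"
  shows "bexp p E f = bexp p E' g"
  using assms unfolding bexp_def by (intro sum.cong) auto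

lemma bexp_add: "bexp p E (\<lambda>S. f S + g S) = bexp p E f + bexp p E g"
  by (simp add: bexp_def distrib_left sum.distrib)

lemma bexp_diff: "bexp p E (\<lambda>S. f S - g S) = bexp p E f - bexp p E g"
  by (simp add: bexp_def right_diff_distrib sum_subtractf)

lemma bexp_cmult: "bexp p E (\<lambda>S. c * f S) = c * bexp p E f"
  by (simp add: bexp_def sum_distrib_left mult_ac)

lemma bexp_multc: "bexp p E (\<lambda>S. f S * c) = bexp p E f * c"
  using bexp_cmult[of p E c f] by (simp add: mult.commute)

lemma bexp_sum: "bexp p E (\<lambda>S. \<Sum>i\<in>I. f i S) = (\<Sum>i\<in>I. bexp p E (f i))"
  unfolding bexp_def sum_distrib_left by (rule sum.swap)

lemma bexp_const [simp]: "finite E \<Longrightarrow> bexp p E (\<lambda>_. c) = c"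
  by (induction E rule: finite_induct) (auto simp: bexp_insert algebra_simps)

lemma bexp_mono:
  assumes "0 \<le> p" "p \<le> 1" "\<And>S. S \<subseteq> E \<Longrightarrow> f S \<le> g S"
  shows "bexp p E f \<le> bexp p E g"
  unfolding bexp_def using assms by (intro sum_mono mult_left_mono) auto

lemma bexp_nonneg:
  assumes "0 \<le> p" "p \<le> 1" "\<And>S. S \<subseteq> E \<Longrightarrow> 0 \<le> f S"
  shows "0 \<le> bexp p E f"
  unfolding bexp_def using assms by (intro sum_nonneg) auto

lemma bexp_le_const:
  assumes "finite E" "0 \<le> p" "p \<le> 1" "\<And>S. S \<subseteq> E \<Longrightarrow> f S \<le> c"
  shows "bexp p E f \<le> c"
  using bexp_mono[OF assms(2,3), of E f "\<lambda>_. c"] assms by simp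

section \<open>Independence, conditioning and coupling of random subsets\<close>

lemma bexp_Un:
  assumes "finite A" "finite B" "A \<inter> B = {}"
  shows "bexp p (A \<union> B) f = bexp p A (\<lambda>S. bexp p B (\<lambda>T. f (S \<union> T)))"
  using assms(1,3)
proof (induction A arbitrary: f rule: finite_induct)
  case (insert x A)
  have "bexp p (insert x A \<union> B) f = bexp p (insert x (A \<union> B)) f" by simp
  also have "\<dots> = p * bexp p (A \<union> B) (\<lambda>S. f (insert x S)) + (1 - p) * bexp p (A \<union> B) f"
    using insert assms by (intro bexp_insert) auto
  also have "\<dots> = bexp p (insert x A) (\<lambda>S. bexp p B (\<lambda>T. f (S \<union> T)))"
    using insert by (simp add: bexp_insert)
  finally show ?case .
qed simp

text \<open>Elements outside \<open>A\<close> are integrated out. Events that read different sets of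
  pairs are brought to a common ground set in this way.\<close>

lemma bexp_restrict:
  assumes "finite E" "A \<subseteq> E" "\<And>S. S \<subseteq> E \<Longrightarrow> f S = f (S \<inter> A)"
  shows "bexp p E f = bexp p A f"
proof -
  have fin: "finite A" "finite (E - A)" using assms finite_subset by auto
  have "bexp p E f = bexp p (A \<union> (E - A)) f" using assms(2) by (simp add: Un_absorb1)
  also have "\<dots> = bexp p A (\<lambda>S. bexp p (E - A) (\<lambda>T. f (S \<union> T)))"
    using fin by (intro bexp_Un) auto
  also have "\<dots> = bexp p A (\<lambda>S. bexp p (E - A) (\<lambda>T. f S))"
  proof (intro bexp_cong refl)
    fix S T assume ST: "S \<subseteq> A" "T \<subseteq> E - A"
    have "f (S \<union> T) = f ((S \<union> T) \<inter> A)" using ST assms(2) by (intro assms(3)) auto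
    also have "(S \<union> T) \<inter> A = S" using ST by auto
    finally show "f (S \<union> T) = f S" .
  qed
  finally show ?thesis using fin by simp
qed

text \<open>Independence of functions reading disjoint blocks; the equation
  \<open>F i S = F i (S \<inter> B i)\<close> says that \<open>F i\<close> reads only
  \<open>B i\<close>.\<close>

lemma bexp_prod:
  assumes "finite I" "\<And>i. i \<in> I \<Longrightarrow> finite (B i)" "disjoint_family_on B I"
    and "\<And>i S. i \<in> I \<Longrightarrow> F i S = F i (S \<inter> B i)"
  shows "bexp p (\<Union>i\<in>I. B i) (\<lambda>S. \<Prod>i\<in>I. F i S) = (\<Prod>i\<in>I. bexp p (B i) (F i))"
  using assms
proof (induction I rule: finite_induct)
  case (insert j I)
  let ?U = "\<Union>i\<in>I. B i"
  have dis: "B j \<inter> B i = {}" if "i \<in> I" for i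
    using insert.hyps insert.prems(2) that unfolding disjoint_family_on_def by fastforce
  have F1: "F j (S \<union> T) = F j S" if "S \<subseteq> B j" "T \<subseteq> ?U" for S T
  proof -
    have "(S \<union> T) \<inter> B j = S \<inter> B j" using dis that by blast
    thus ?thesis using insert.prems(3)[of j "S \<union> T"] insert.prems(3)[of j S] by auto
  qed
  have F2: "F i (S \<union> T) = F i T" if "i \<in> I" "S \<subseteq> B j" "T \<subseteq> ?U" for i S T
  proof -
    have "(S \<union> T) \<inter> B i = T \<inter> B i" using dis that by blast
    thus ?thesis using insert.prems(3)[of i "S \<union> T"] insert.prems(3)[of i T] that by auto
  qed
  have "bexp p (\<Union>i\<in>insert j I. B i) (\<lambda>S. \<Prod>i\<in>insert j I. F i S) =
        bexp p (B j) (\<lambda>S. bexp p ?U (\<lambda>T. \<Prod>i\<in>insert j I. F i (S \<union> T)))"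
    using dis insert.hyps insert.prems(1) by (simp, intro bexp_Un) auto
  also have "\<dots> = bexp p (B j) (\<lambda>S. bexp p ?U (\<lambda>T. F j S * (\<Prod>i\<in>I. F i T)))"
    using insert.hyps F1 F2 by (intro bexp_cong refl) (auto intro!: prod.cong)
  also have "\<dots> = bexp p (B j) (F j) * bexp p ?U (\<lambda>T. \<Prod>i\<in>I. F i T)"
    by (simp add: bexp_cmult bexp_multc)
  also have "bexp p ?U (\<lambda>T. \<Prod>i\<in>I. F i T) = (\<Prod>i\<in>I. bexp p (B i) (F i))"
  proof (rule insert.IH)
    show "F i S = F i (S \<inter> B i)" if "i \<in> I" for i S
      using that by (intro insert.prems(3)) auto
  qed (use insert.prems(1,2) in \<open>auto simp: disjoint_family_on_def\<close>)
  finally show ?case using insert.hyps by simp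
qed simp

text \<open>Conditional independence: once the common part \<open>A\<close> is fixed, the factors
  read disjoint blocks. In the applications \<open>A\<close> consists of the pairs inside a shared
  vertex set.\<close>

lemma bexp_prod_common:
  assumes "finite I" "finite A" "\<And>i. i \<in> I \<Longrightarrow> finite (B i)"
    and "\<And>i. i \<in> I \<Longrightarrow> A \<inter> B i = {}" "disjoint_family_on B I"
    and "\<And>i S. i \<in> I \<Longrightarrow> F i S = F i (S \<inter> (A \<union> B i))"
  shows "bexp p (A \<union> (\<Union>i\<in>I. B i)) (\<lambda>S. \<Prod>i\<in>I. F i S)
       = bexp p A (\<lambda>Q. \<Prod>i\<in>I. bexp p (B i) (\<lambda>T. F i (Q \<union> T)))"
proof -
  have "bexp p (A \<union> (\<Union>i\<in>I. B i)) (\<lambda>S. \<Prod>i\<in>I. F i S)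
      = bexp p A (\<lambda>Q. bexp p (\<Union>i\<in>I. B i) (\<lambda>T. \<Prod>i\<in>I. F i (Q \<union> T)))"
    using assms(1-4) by (intro bexp_Un) auto
  also have "\<dots> = bexp p A (\<lambda>Q. \<Prod>i\<in>I. bexp p (B i) (\<lambda>T. F i (Q \<union> T)))"
  proof (rule bexp_cong[OF refl])
    fix Q assume Q: "Q \<subseteq> A"
    let ?U = "\<Union>i\<in>I. B i"
    have F: "F i (Q \<union> T) = F i (Q \<union> T \<inter> B i)" if "i \<in> I" "T \<subseteq> ?U" for i T
    proof -
      have "A \<inter> T = {}" using assms(4) that by blast
      hence "(Q \<union> T) \<inter> (A \<union> B i) = (Q \<union> T \<inter> B i) \<inter> (A \<union> B i)" by blast
      thus ?thesis using assms(6)[OF that(1)] by metis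
    qed
    have "bexp p ?U (\<lambda>T. \<Prod>i\<in>I. F i (Q \<union> T)) = bexp p ?U (\<lambda>T. \<Prod>i\<in>I. F i (Q \<union> T \<inter> B i))"
      using F by (intro bexp_cong refl prod.cong) auto
    also have "\<dots> = (\<Prod>i\<in>I. bexp p (B i) (\<lambda>T. F i (Q \<union> T \<inter> B i)))"
      using assms(1,3,5) by (intro bexp_prod) auto
    also have "\<dots> = (\<Prod>i\<in>I. bexp p (B i) (\<lambda>T. F i (Q \<union> T)))"
      by (intro prod.cong bexp_cong refl) (simp add: Int_absorb2)
    finally show "bexp p ?U (\<lambda>T. \<Prod>i\<in>I. F i (Q \<union> T))
        = (\<Prod>i\<in>I. bexp p (B i) (\<lambda>T. F i (Q \<union> T)))" .
  qed
  finally show ?thesis .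
qed

text \<open>An element is missed by both subsets with probability \<open>(1 - p) * (1 - q)\<close>,
  so the union of independent subsets at levels \<open>p\<close> and \<open>q\<close> is a random
  subset at level \<open>p + q - p * q\<close>.\<close>

lemma bexp_union_copies:
  assumes "finite E"
  shows "bexp p E (\<lambda>S. bexp q E (\<lambda>T. f (S \<union> T))) = bexp (p + q - p * q) E f"
  using assms
proof (induction E arbitrary: f rule: finite_induct)
  case (insert x E)
  define r a b where "r = p + q - p * q" 
    and "a = bexp p E (\<lambda>S. bexp q E (\<lambda>T. f (insert x (S \<union> T))))"
    and "b = bexp p E (\<lambda>S. bexp q E (\<lambda>T. f (S \<union> T)))"
  have "bexp p (insert x E) (\<lambda>S. bexp q (insert x E) (\<lambda>T. f (S \<union> T))) =
     p * (q * a + (1 - q) * a) + (1 - p) * (q * a + (1 - q) * b)"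
    unfolding a_def b_def using insert.hyps by (simp add: bexp_insert bexp_add bexp_cmult) (simp add: algebra_simps)
  also have "\<dots> = r * a + (1 - r) * b"
    by (simp add: r_def algebra_simps)
  also have "a = bexp r E (\<lambda>S. f (insert x S))"
    unfolding a_def r_def by (rule insert.IH)
  also have "b = bexp r E f"
    unfolding b_def r_def by (rule insert.IH)
  finally show ?case unfolding r_def using insert.hyps by (simp add: bexp_insert)
qed simp

text \<open>A random subset at level \<open>q\<close> is one at level \<open>p\<close> joined with
  an independent one at level \<open>r\<close>, where
  \<open>(1 - p) * (1 - r) = 1 - q\<close>.\<close>

lemma bexp_mono_prob:
  assumes "finite E" "0 \<le> p" "p \<le> q" "q \<le> 1"
    and "\<And>S T. S \<subseteq> T \<Longrightarrow> T \<subseteq> E \<Longrightarrow> f S \<le> f T"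
  shows "bexp p E f \<le> bexp q E f"
proof (cases "p = 1")
  case False
  define r where "r = (q - p) / (1 - p)"
  have r: "0 \<le> r" "r \<le> 1" "q = p + r - p * r"
  proof -
    have "p + r * (1 - p) = q" using False by (simp add: r_def)
    thus "q = p + r - p * r" by (simp add: algebra_simps)
  qed (use False assms(2-4) in \<open>auto simp: r_def field_simps\<close>)
  have "bexp p E f = bexp p E (\<lambda>S. bexp r E (\<lambda>T. f S))" using assms(1) by simp
  also have "\<dots> \<le> bexp p E (\<lambda>S. bexp r E (\<lambda>T. f (S \<union> T)))"
    using assms r by (intro bexp_mono assms(5)) auto
  also have "\<dots> = bexp q E f" using bexp_union_copies[OF assms(1)] r by simp
  finally show ?thesis .
qed (use assms in auto)

text \<open>The level \<open>1 - (1 - p) ^ k\<close> belongs to the union of \<open>k\<close>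
  independent copies, and a decreasing \<open>Q\<close> that holds for the union holds for every
  copy. This amplifies both coverage and robustness, whose negations are decreasing.\<close>

lemma bexp_decreasing_copies:
  assumes "finite E" "0 \<le> p" "p \<le> 1"
    and "\<And>S T. S \<subseteq> T \<Longrightarrow> T \<subseteq> E \<Longrightarrow> Q T \<Longrightarrow> Q S"
  shows "bexp (1 - (1 - p) ^ k) E (\<lambda>S. of_bool (Q S)) \<le> bexp p E (\<lambda>S. of_bool (Q S)) ^ k"
proof (induction k)
  case 0
  show ?case using assms(1) by (simp add: bexp_le_const)
next
  case (Suc k)
  define q where "q = 1 - (1 - p) ^ k"
  have q: "0 \<le> q" "q \<le> 1" using assms(2,3) by (auto simp: q_def power_le_one)
  have "1 - (1 - p) ^ Suc k = p + q - p * q" by (simp add: q_def algebra_simps)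
  hence "bexp (1 - (1 - p) ^ Suc k) E (\<lambda>S. of_bool (Q S))
      = bexp p E (\<lambda>S. bexp q E (\<lambda>T. of_bool (Q (S \<union> T))))"
    using bexp_union_copies[OF assms(1), of p q "\<lambda>S. of_bool (Q S)"] by simp
  also have "\<dots> \<le> bexp p E (\<lambda>S. bexp q E (\<lambda>T. of_bool (Q S) * of_bool (Q T)))"
  proof (intro bexp_mono assms(2,3) q)
    fix S T assume "S \<subseteq> E" "T \<subseteq> E"
    thus "of_bool (Q (S \<union> T)) \<le> (of_bool (Q S) * of_bool (Q T) :: real)"
      using assms(4)[of S "S \<union> T"] assms(4)[of T "S \<union> T"] by auto
  qed
  also have "\<dots> = bexp p E (\<lambda>S. of_bool (Q S)) * bexp q E (\<lambda>S. of_bool (Q S))"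
    by (simp add: bexp_cmult bexp_multc)
  also have "\<dots> \<le> bexp p E (\<lambda>S. of_bool (Q S)) * bexp p E (\<lambda>S. of_bool (Q S)) ^ k"
    using Suc assms(2,3) unfolding q_def by (intro mult_left_mono bexp_nonneg) auto
  finally show ?case by simp
qed

lemma bexp_image:
  assumes "inj_on g E"
  shows "bexp p (g ` E) f = bexp p E (\<lambda>S. f (g ` S))"
proof -
  have "bexp p (g ` E) f = (\<Sum>S\<in>(`) g ` Pow E. p ^ card S * (1 - p) ^ card (g ` E - S) * f S)"
    unfolding bexp_def by (subst image_Pow_surj[OF refl]) simp
  also have "\<dots> = (\<Sum>S\<in>Pow E. p ^ card (g ` S) * (1 - p) ^ card (g ` E - g ` S) * f (g ` S))"
    using inj_on_image_Pow[OF assms] by (subst sum.reindex) auto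
  also have "\<dots> = bexp p E (\<lambda>S. f (g ` S))"
    unfolding bexp_def
  proof (rule sum.cong[OF refl])
    fix S assume "S \<in> Pow E"
    hence "card (g ` S) = card S" "g ` E - g ` S = g ` (E - S)" "card (g ` (E - S)) = card (E - S)"
      using inj_on_image_set_diff[OF assms, of E S] card_image[OF inj_on_subset[OF assms], of S]
        card_image[OF inj_on_subset[OF assms], of "E - S"] by auto
    thus "p ^ card (g ` S) * (1 - p) ^ card (g ` E - g ` S) * f (g ` S)
        = p ^ card S * (1 - p) ^ card (E - S) * f (g ` S)" by simp
  qed
  finally show ?thesis .
qed

lemma bexp_continuous_on: "continuous_on X (\<lambda>p. bexp p E f)"
  unfolding bexp_def by (intro continuous_intros)

lemma bexp_zero: "finite E \<Longrightarrow> bexp 0 E f = f {}"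
  by (induction E rule: finite_induct) (auto simp: bexp_insert)

lemma bexp_one: "finite E \<Longrightarrow> bexp 1 E f = f E"
  by (induction E arbitrary: f rule: finite_induct) (auto simp: bexp_insert)

lemma bexp_all_present:
  assumes "finite E" "A \<subseteq> E"
  shows "bexp p E (\<lambda>S. of_bool (A \<subseteq> S)) = p ^ card A"
proof -
  have "finite A" using assms finite_subset by auto
  have "bexp p E (\<lambda>S. of_bool (A \<subseteq> S)) = bexp p A (\<lambda>S. of_bool (A \<subseteq> S))"
    using assms by (intro bexp_restrict) auto
  also have "\<dots> = p ^ card A"
    using \<open>finite A\<close>
  proof (induction A rule: finite_induct)
    case (insert x A)
    have "bexp p A (\<lambda>S. of_bool (insert x A \<subseteq> insert x S)) = bexp p A (\<lambda>S. of_bool (A \<subseteq> S))"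
      using insert by (intro bexp_cong refl) auto
    moreover have "bexp p A (\<lambda>S. of_bool (insert x A \<subseteq> S)) = bexp p A (\<lambda>S. 0)"
      using insert by (intro bexp_cong refl) auto
    ultimately show ?case using insert by (simp add: bexp_insert)
  qed simp
  finally show ?thesis .
qed

section \<open>Tail bounds, correlation and variance\<close>

lemma bexp_markov:
  assumes "finite E" "0 \<le> p" "p \<le> 1" "c > 0" "\<And>S. S \<subseteq> E \<Longrightarrow> 0 \<le> f S"
  shows "bexp p E (\<lambda>S. of_bool (f S \<ge> c)) \<le> bexp p E f / c"
proof -
  have "c * bexp p E (\<lambda>S. of_bool (f S \<ge> c)) \<le> bexp p E f"
    unfolding bexp_cmult[symmetric] using assms by (intro bexp_mono) auto
  thus ?thesis using assms(4) by (simp add: field_simps)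
qed

lemma bexp_variance:
  assumes "finite E"
  shows "bexp p E (\<lambda>S. (f S - bexp p E f)\<^sup>2) = bexp p E (\<lambda>S. (f S)\<^sup>2) - (bexp p E f)\<^sup>2"
proof -
  have "bexp p E (\<lambda>S. (f S - bexp p E f)\<^sup>2)
      = bexp p E (\<lambda>S. (f S)\<^sup>2 - (2 * bexp p E f) * f S + (bexp p E f)\<^sup>2)"
    by (intro bexp_cong refl) (simp add: power2_eq_square algebra_simps)
  thus ?thesis using assms
    by (simp add: bexp_add bexp_diff bexp_cmult power2_eq_square)
qed

lemma bexp_chebyshev:
  assumes "finite E" "0 \<le> p" "p \<le> 1" "c > 0"
  shows "bexp p E (\<lambda>S. of_bool (\<bar>f S - bexp p E f\<bar> \<ge> c))
     \<le> (bexp p E (\<lambda>S. (f S)\<^sup>2) - (bexp p E f)\<^sup>2) / c\<^sup>2"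
proof -
  have "bexp p E (\<lambda>S. of_bool (\<bar>f S - bexp p E f\<bar> \<ge> c))
      = bexp p E (\<lambda>S. of_bool ((f S - bexp p E f)\<^sup>2 \<ge> c\<^sup>2))"
  proof (intro bexp_cong refl arg_cong[where f = of_bool])
    fix S
    show "(\<bar>f S - bexp p E f\<bar> \<ge> c) = ((f S - bexp p E f)\<^sup>2 \<ge> c\<^sup>2)"
      using abs_le_square_iff[of c "f S - bexp p E f"] assms(4) by simp
  qed
  also have "\<dots> \<le> bexp p E (\<lambda>S. (f S - bexp p E f)\<^sup>2) / c\<^sup>2"
    using assms by (intro bexp_markov) auto
  finally show ?thesis using bexp_variance[OF assms(1)] by metis
qed

text \<open>Harris' inequality for decreasing functions. Conditioning on one element leaves a
  two-point Chebyshev sum inequality with slack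
  \<open>p * (1 - p) * ((f0 - f1) * (g0 - g1))\<close>.\<close>

lemma harris:
  assumes "finite E" "0 \<le> p" "p \<le> 1"
    and "\<And>S T. S \<subseteq> T \<Longrightarrow> T \<subseteq> E \<Longrightarrow> f T \<le> f S" "\<And>S T. S \<subseteq> T \<Longrightarrow> T \<subseteq> E \<Longrightarrow> g T \<le> g S"
  shows "bexp p E f * bexp p E g \<le> bexp p E (\<lambda>S. f S * (g S :: real))"
  using assms(1,4,5)
proof (induction E arbitrary: f g rule: finite_induct)
  case (insert x E)
  define f0 f1 g0 g1 where "f0 = bexp p E f" and "f1 = bexp p E (\<lambda>S. f (insert x S))"
    and "g0 = bexp p E g" and "g1 = bexp p E (\<lambda>S. g (insert x S))"
  have le: "f1 \<le> f0" "g1 \<le> g0" unfolding f0_def f1_def g0_def g1_def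
    using assms(2,3) by (intro bexp_mono insert.prems; auto)+
  have "f1 * g1 \<le> bexp p E (\<lambda>S. f (insert x S) * g (insert x S))"
    unfolding f1_def g1_def by (intro insert.IH insert.prems) auto
  hence a: "p * (f1 * g1) \<le> p * bexp p E (\<lambda>S. f (insert x S) * g (insert x S))"
    using assms(2) by (rule mult_left_mono)
  have "f0 * g0 \<le> bexp p E (\<lambda>S. f S * g S)"
    unfolding f0_def g0_def by (intro insert.IH insert.prems) auto
  hence b: "(1 - p) * (f0 * g0) \<le> (1 - p) * bexp p E (\<lambda>S. f S * g S)"
    using assms(3) by (intro mult_left_mono) auto
  have "0 \<le> p * (1 - p) * ((f0 - f1) * (g0 - g1))"
    using le assms(2,3) by (intro mult_nonneg_nonneg) auto
  also have "\<dots> = p * (f1 * g1) + (1 - p) * (f0 * g0)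
       - (p * f1 + (1 - p) * f0) * (p * g1 + (1 - p) * g0)"
    by (simp add: algebra_simps)
  finally show ?case using a b insert.hyps
    by (simp add: bexp_insert f0_def f1_def g0_def g1_def)
qed simp

lemma harris_prod:
  assumes "finite I" "finite E" "0 \<le> p" "p \<le> 1"
    and "\<And>i S T. i \<in> I \<Longrightarrow> S \<subseteq> T \<Longrightarrow> T \<subseteq> E \<Longrightarrow> f i T \<le> f i S" 
    and "\<And>i S. i \<in> I \<Longrightarrow> 0 \<le> f i S"
  shows "(\<Prod>i\<in>I. bexp p E (f i)) \<le> bexp p E (\<lambda>S. \<Prod>i\<in>I. f i S :: real)"
  using assms(1,5,6)
proof (induction I rule: finite_induct)
  case (insert j I)
  have "(\<Prod>i\<in>insert j I. bexp p E (f i)) = bexp p E (f j) * (\<Prod>i\<in>I. bexp p E (f i))"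
    using insert.hyps by simp
  also have "\<dots> \<le> bexp p E (f j) * bexp p E (\<lambda>S. \<Prod>i\<in>I. f i S)"
    using insert assms(3,4) by (intro mult_left_mono bexp_nonneg insert.IH) auto
  also have "\<dots> \<le> bexp p E (\<lambda>S. f j S * (\<Prod>i\<in>I. f i S))"
    using insert.prems assms(2-4) by (intro harris prod_mono) auto
  finally show ?case using insert.hyps by simp
qed (use assms in simp)

text \<open>Induction by conditioning on \<open>x\<close>: the variance splits into the averaged
  conditional variances and \<open>p * (1 - p)\<close> times the squared difference of the
  conditional means. Jensen's inequality bounds the last term by the contribution of
  \<open>x\<close>; the contributions of the other elements average exactly.\<close>

lemma efron_stein:
  assumes "finite E" "0 \<le> p" "p \<le> 1"
  shows "bexp p E (\<lambda>S. (f S)\<^sup>2) - (bexp p E f)\<^sup>2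
     \<le> p * (1 - p) * (\<Sum>e\<in>E. bexp p E (\<lambda>S. (f (insert e S) - f (S - {e}))\<^sup>2))"
  using assms(1)
proof (induction E arbitrary: f rule: finite_induct)
  case (insert x E)
  define f1 where "f1 = (\<lambda>S. f (insert x S))"
  define V where "V h = bexp p E (\<lambda>S. (h S)\<^sup>2) - (bexp p E h)\<^sup>2" for h :: "'a set \<Rightarrow> real"
  define D where "D h e = bexp p E (\<lambda>S. (h (insert e S) - h (S - {e}))\<^sup>2)" 
    for h :: "'a set \<Rightarrow> real" and e
  have x: "bexp p (insert x E) (\<lambda>S. (f (insert x S) - f (S - {x}))\<^sup>2) = bexp p E (\<lambda>S. (f1 S - f S)\<^sup>2)"
  proof -
    have "bexp p E (\<lambda>S. (f (insert x S) - f (S - {x}))\<^sup>2) = bexp p E (\<lambda>S. (f1 S - f S)\<^sup>2)"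
    proof (intro bexp_cong refl)
      fix S assume "S \<subseteq> E"
      hence "S - {x} = S" using insert.hyps by auto
      thus "(f (insert x S) - f (S - {x}))\<^sup>2 = (f1 S - f S)\<^sup>2" by (simp add: f1_def)
    qed
    thus ?thesis using insert.hyps by (simp add: bexp_insert algebra_simps)
  qed
  have "(\<Sum>e\<in>E. bexp p (insert x E) (\<lambda>S. (f (insert e S) - f (S - {e}))\<^sup>2))
      = (\<Sum>e\<in>E. p * D f1 e + (1 - p) * D f e)"
  proof (intro sum.cong refl)
    fix e assume "e \<in> E"
    hence "bexp p E (\<lambda>S. (f (insert e (insert x S)) - f (insert x S - {e}))\<^sup>2) = D f1 e"
      unfolding D_def f1_def using insert.hyps
      by (intro bexp_cong refl) (auto simp: insert_commute insert_Diff_if)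
    thus "bexp p (insert x E) (\<lambda>S. (f (insert e S) - f (S - {e}))\<^sup>2) = p * D f1 e + (1 - p) * D f e"
      using insert.hyps by (simp add: bexp_insert D_def)
  qed
  also have "\<dots> = p * (\<Sum>e\<in>E. D f1 e) + (1 - p) * (\<Sum>e\<in>E. D f e)"
    by (simp add: sum.distrib sum_distrib_left)
  finally have sumE: "(\<Sum>e\<in>E. bexp p (insert x E) (\<lambda>S. (f (insert e S) - f (S - {e}))\<^sup>2))
      = p * (\<Sum>e\<in>E. D f1 e) + (1 - p) * (\<Sum>e\<in>E. D f e)" .
  have rhs: "p * (1 - p) * (\<Sum>e\<in>insert x E. bexp p (insert x E) (\<lambda>S. (f (insert e S) - f (S - {e}))\<^sup>2))
     = p * (1 - p) * bexp p E (\<lambda>S. (f1 S - f S)\<^sup>2)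
       + p * (p * (1 - p) * (\<Sum>e\<in>E. D f1 e)) + (1 - p) * (p * (1 - p) * (\<Sum>e\<in>E. D f e))"
    unfolding sum.insert[OF insert.hyps] x sumE by (simp add: algebra_simps)
  have "p * V f1 \<le> p * (p * (1 - p) * (\<Sum>e\<in>E. D f1 e))"
    unfolding V_def D_def using assms(2) by (intro mult_left_mono insert.IH) auto
  moreover have "(1 - p) * V f \<le> (1 - p) * (p * (1 - p) * (\<Sum>e\<in>E. D f e))"
    unfolding V_def D_def using assms(3) by (intro mult_left_mono insert.IH) auto
  moreover have "(bexp p E f1 - bexp p E f)\<^sup>2 \<le> bexp p E (\<lambda>S. (f1 S - f S)\<^sup>2)"
  proof -
    have "0 \<le> bexp p E (\<lambda>S. ((f1 S - f S) - bexp p E (\<lambda>S. f1 S - f S))\<^sup>2)"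
      using assms by (intro bexp_nonneg) auto
    thus ?thesis using bexp_variance[OF insert.hyps(1), of p "\<lambda>S. f1 S - f S"]
      by (simp add: bexp_diff)
  qed
  hence "p * (1 - p) * (bexp p E f1 - bexp p E f)\<^sup>2 \<le> p * (1 - p) * bexp p E (\<lambda>S. (f1 S - f S)\<^sup>2)"
    using assms by (intro mult_left_mono) auto
  moreover have "bexp p (insert x E) (\<lambda>S. (f S)\<^sup>2) - (bexp p (insert x E) f)\<^sup>2 =
      p * V f1 + (1 - p) * V f + p * (1 - p) * (bexp p E f1 - bexp p E f)\<^sup>2"
  proof -
    have "bexp p (insert x E) f = p * bexp p E f1 + (1 - p) * bexp p E f"
      "bexp p (insert x E) (\<lambda>S. (f S)\<^sup>2) = p * bexp p E (\<lambda>S. (f1 S)\<^sup>2) + (1 - p) * bexp p E (\<lambda>S. (f S)\<^sup>2)"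
      unfolding f1_def using insert.hyps by (simp_all add: bexp_insert)
    moreover have "p * b1 + (1 - p) * b - (p * a1 + (1 - p) * a)\<^sup>2
        = p * (b1 - a1\<^sup>2) + (1 - p) * (b - a\<^sup>2) + p * (1 - p) * (a1 - a)\<^sup>2" for a a1 b b1 :: real
      by (simp add: power2_eq_square algebra_simps)
    ultimately show ?thesis unfolding V_def by presburger
  qed
  ultimately show ?case using rhs by linarith
qed simp

lemma bexp_card_eq:
  assumes "finite E"
  shows "bexp p E (\<lambda>S. of_bool (card S = k)) = real (card E choose k) * p ^ k * (1 - p) ^ (card E - k)"
proof -
  have "bexp p E (\<lambda>S. of_bool (card S = k)) = 
      (\<Sum>S\<in>{S. S \<subseteq> E \<and> card S = k}. p ^ card S * (1 - p) ^ card (E - S))"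
    unfolding bexp_def using assms by (intro sum.mono_neutral_cong_right) auto
  also have "\<dots> = (\<Sum>S\<in>{S. S \<subseteq> E \<and> card S = k}. p ^ k * (1 - p) ^ (card E - k))"
    using assms by (intro sum.cong refl) (auto simp: card_Diff_subset finite_subset)
  also have "\<dots> = real (card E choose k) * (p ^ k * (1 - p) ^ (card E - k))"
    using n_subsets[OF assms, of k] by simp
  finally show ?thesis by (simp add: mult_ac)
qed

subsection \<open>Weak saturation as a closure process\<close>

text \<open>\<open>covered d S R e\<close>: adding \<open>e\<close> to the edge set \<open>S\<close> creates a complete graph on \<open>d + 2\<close> vertices
  that contains \<open>e\<close> and whose other vertices lie in \<open>R\<close>. Whether \<open>e\<close> itself is in \<open>S\<close> is irrelevant.\<close>

definition covered :: "nat \<Rightarrow> 'a set set \<Rightarrow> 'a set \<Rightarrow> 'a set \<Rightarrow> bool" where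
  "covered d S R e \<longleftrightarrow> (\<exists>W\<subseteq>R. finite W \<and> card W = d \<and> W \<inter> e = {} \<and> [W \<union> e]\<^bsup>2\<^esup> - {e} \<subseteq> S)"

text \<open>Unlike a weakly saturated subgraph, the start \<open>H\<close> may contain cliques, so
  every intermediate edge set can itself serve as a start and processes can be concatenated.\<close>

inductive percolates :: "nat \<Rightarrow> 'a set set \<Rightarrow> 'a set set \<Rightarrow> bool" for d H where
  base: "percolates d H H"
| step: "percolates d H S \<Longrightarrow> e \<notin> S \<Longrightarrow> covered d S UNIV e \<Longrightarrow> percolates d H (insert e S)"

lemma covered_mono:
  assumes "covered d S R e" "S - {e} \<subseteq> S'" "R \<subseteq> R'"
  shows "covered d S' R' e"
proof -
  obtain W where "W \<subseteq> R" "finite W" "card W = d" "W \<inter> e = {}" "[W \<union> e]\<^bsup>2\<^esup> - {e} \<subseteq> S"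
    using assms(1) by (auto simp: covered_def)
  thus ?thesis using assms(2,3) unfolding covered_def by (intro exI[of _ W]) auto
qed

lemma percolates_subset: "percolates d H S \<Longrightarrow> H \<subseteq> S"
  by (induction rule: percolates.induct) auto

lemma percolates_trans:
  assumes "percolates d S T" "percolates d H S"
  shows "percolates d H T"
  using assms by (induction rule: percolates.induct) (auto intro: percolates.intros)

text \<open>Coverage is monotone, so edges covered by \<open>H\<close> can be added in any
  order.\<close>

lemma percolates_fill:
  assumes "H \<subseteq> G" "finite G" "\<And>e. e \<in> G - H \<Longrightarrow> covered d H UNIV e"
  shows "percolates d H G"
proof -
  have "percolates d H (H \<union> X)" if "finite X" "X \<subseteq> G - H" for X
    using that
  proof (induction X rule: finite_induct)
    case (insert e X)
    have "percolates d H (insert e (H \<union> X))"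
      using insert by (intro percolates.step covered_mono[OF assms(3)]) auto
    thus ?case by simp
  qed (simp add: percolates.base)
  from this[of "G - H"] show ?thesis using assms(1,2) by (simp add: Un_absorb1)
qed

text \<open>An edge is covered at the moment it is activated, and this persists up to
  \<open>G\<close>. Hence the number of edges uncovered in \<open>G\<close> is a lower bound for
  every generating set.\<close>

lemma uncovered_mem_generators:
  assumes "percolates d H G" "e \<in> G" "\<not> covered d G UNIV e"
  shows "e \<in> H"
  using assms
proof (induction rule: percolates.induct)
  case (step S f)
  thus ?case using covered_mono[of d S UNIV f "insert f S" UNIV] covered_mono[of d S UNIV e "insert f S" UNIV]
    by blast
qed

lemma nsets2_iff: "e \<in> [V]\<^bsup>2\<^esup> \<longleftrightarrow> (\<exists>u v. u \<in> V \<and> v \<in> V \<and> u \<noteq> v \<and> e = {u, v})"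
  by (auto simp: nsets_def card_2_iff)

lemma nsets2_mono: "V \<subseteq> V' \<Longrightarrow> [V]\<^bsup>2\<^esup> \<subseteq> [V']\<^bsup>2\<^esup>"
  by (auto simp: nsets_def)

lemma finite_nsets2 [simp]: "finite V \<Longrightarrow> finite ([V]\<^bsup>2\<^esup>)"
  by (simp add: finite_imp_finite_nsets)

lemma card_nsets2: "card ([V]\<^bsup>2\<^esup>) = card V choose 2" if "finite V"
  using n_subsets[OF that, of 2] that by (simp add: nsets_def conj_commute) (metis (no_types, lifting) Collect_cong finite_subset)

section \<open>Bootstrap processes as closure of edge sets\<close>

lemma copy_in_complete_iff:
  assumes "finite V" "S \<subseteq> [V]\<^bsup>2\<^esup>"
  shows "copy_in (complete_graph s) (V, S) K \<longleftrightarrow>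
     (\<exists>W\<subseteq>V. card W = s \<and> [W]\<^bsup>2\<^esup> \<subseteq> S \<and> K = (W, [W]\<^bsup>2\<^esup>))"
proof
  assume "copy_in (complete_graph s) (V, S) K"
  then obtain f where K: "verts K \<subseteq> V" "edges K \<subseteq> S" "bij_betw f {1..s} (verts K)"
    "edges K = (\<lambda>e. f ` e) ` [{1..s}]\<^bsup>2\<^esup>"
    by (auto simp: copy_in_def subgraph_def graph_iso_def complete_graph_def)
  have "edges K = [verts K]\<^bsup>2\<^esup>"
    using bij_betw_nsets[OF K(3), of 2] K(4) by (auto simp: bij_betw_def)
  moreover have "card (verts K) = s" using bij_betw_same_card[OF K(3)] by simp
  ultimately show "\<exists>W\<subseteq>V. card W = s \<and> [W]\<^bsup>2\<^esup> \<subseteq> S \<and> K = (W, [W]\<^bsup>2\<^esup>)"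
    using K by (intro exI[of _ "verts K"]) (auto simp: prod_eq_iff)
next
  assume "\<exists>W\<subseteq>V. card W = s \<and> [W]\<^bsup>2\<^esup> \<subseteq> S \<and> K = (W, [W]\<^bsup>2\<^esup>)"
  then obtain W where W: "W \<subseteq> V" "card W = s" "[W]\<^bsup>2\<^esup> \<subseteq> S" "K = (W, [W]\<^bsup>2\<^esup>)" by blast
  have "finite W" using W(1) assms(1) finite_subset by blast
  then obtain f where f: "bij_betw f {1..s} W"
    using W(2) finite_same_card_bij[of "{1..s}" W] by auto
  have "[W]\<^bsup>2\<^esup> = (\<lambda>e. f ` e) ` [{1..s}]\<^bsup>2\<^esup>"
    using bij_betw_nsets[OF f, of 2] by (auto simp: bij_betw_def)
  thus "copy_in (complete_graph s) (V, S) K"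
    using W f assms \<open>finite W\<close>
    by (auto simp: copy_in_def subgraph_def graph_iso_def complete_graph_def simple_graph_def)
qed

lemma covered_iff_clique:
  assumes "e \<in> [V]\<^bsup>2\<^esup>" "finite V" "S \<subseteq> [V]\<^bsup>2\<^esup>" "d \<ge> 1"
  shows "covered d S UNIV e \<longleftrightarrow>
    (\<exists>W\<subseteq>V. card W = d + 2 \<and> [W]\<^bsup>2\<^esup> \<subseteq> insert e S \<and> e \<in> [W]\<^bsup>2\<^esup>)"
proof
  have e: "finite e" "card e = 2" "e \<subseteq> V" using assms(1) by (auto simp: nsets_def)
  assume "covered d S UNIV e"
  then obtain W where W: "finite W" "card W = d" "W \<inter> e = {}" "[W \<union> e]\<^bsup>2\<^esup> - {e} \<subseteq> S"
    by (auto simp: covered_def)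
  \<comment> \<open>Each vertex of \<open>W\<close> is joined to an end of \<open>e\<close> by a
    pair other than \<open>e\<close>; this pair belongs to \<open>S\<close> and so lies inside
    \<open>V\<close>.\<close>
  have "W \<subseteq> V"
  proof
    fix x assume x: "x \<in> W"
    obtain u where u: "u \<in> e" using e(2) by (metis card.empty ex_in_conv zero_neq_numeral)
    have "x \<noteq> u" using x u W(3) by auto
    hence "{x, u} \<in> [W \<union> e]\<^bsup>2\<^esup>" using x u by (simp add: nsets_def)
    moreover have "{x, u} \<noteq> e" using x W(3) by auto
    ultimately have "{x, u} \<in> [W \<union> e]\<^bsup>2\<^esup> - {e}" by simp
    hence "{x, u} \<in> [V]\<^bsup>2\<^esup>" using W(4) assms(3) by blast
    thus "x \<in> V" by (auto simp: nsets_def)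
  qed
  hence "W \<union> e \<subseteq> V" using e(3) by blast
  moreover have "card (W \<union> e) = d + 2" using W(1-3) e(1,2) by (simp add: card_Un_disjoint)
  moreover have "[W \<union> e]\<^bsup>2\<^esup> \<subseteq> insert e S" using W(4) by blast
  moreover have "e \<in> [W \<union> e]\<^bsup>2\<^esup>" using e(1,2) by (simp add: nsets_def)
  ultimately show "\<exists>W\<subseteq>V. card W = d + 2 \<and> [W]\<^bsup>2\<^esup> \<subseteq> insert e S \<and> e \<in> [W]\<^bsup>2\<^esup>"
    by blast
next
  assume "\<exists>W\<subseteq>V. card W = d + 2 \<and> [W]\<^bsup>2\<^esup> \<subseteq> insert e S \<and> e \<in> [W]\<^bsup>2\<^esup>"
  then obtain W where W: "W \<subseteq> V" "card W = d + 2" "[W]\<^bsup>2\<^esup> \<subseteq> insert e S" "e \<in> [W]\<^bsup>2\<^esup>" by blast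
  have fin: "finite W" using W(1) assms(2) finite_subset by blast
  have e: "e \<subseteq> W" "finite e" "card e = 2" using W(4) by (auto simp: nsets_def)
  have "W - e \<union> e = W" using e(1) by blast
  moreover have "card (W - e) = d" using e W(2) by (simp add: card_Diff_subset)
  moreover have "[W]\<^bsup>2\<^esup> - {e} \<subseteq> S" using W(3) by blast
  ultimately show "covered d S UNIV e"
    unfolding covered_def using fin by (metis Diff_disjoint finite_Diff inf_commute subset_UNIV)
qed

lemma bootstrap_step_iff:
  assumes "finite V" "S' \<subseteq> [V]\<^bsup>2\<^esup>" "d \<ge> 1"
  shows "bootstrap_step (complete_graph (d + 2)) (V, S) (V, S') \<longleftrightarrow>
    (\<exists>e. e \<notin> S \<and> covered d S UNIV e \<and> S' = insert e S)"
proof -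
  have "(\<exists>K. copy_in (complete_graph (d + 2)) (V, S') K \<and> e \<in> edges K) \<longleftrightarrow> covered d S UNIV e"
    if "S' = insert e S" for e
  proof -
    have "S \<subseteq> [V]\<^bsup>2\<^esup>" "e \<in> [V]\<^bsup>2\<^esup>" using that assms(2) by auto
    have "(\<exists>K. copy_in (complete_graph (d + 2)) (V, S') K \<and> e \<in> edges K) \<longleftrightarrow>
        (\<exists>W\<subseteq>V. card W = d + 2 \<and> [W]\<^bsup>2\<^esup> \<subseteq> S' \<and> e \<in> [W]\<^bsup>2\<^esup>)"
      unfolding copy_in_complete_iff[OF assms(1,2)] by auto
    thus ?thesis
      using covered_iff_clique[OF \<open>e \<in> [V]\<^bsup>2\<^esup>\<close> assms(1) \<open>S \<subseteq> [V]\<^bsup>2\<^esup>\<close> assms(3)] that by simp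
  qed
  thus ?thesis by (auto simp: bootstrap_step_def)
qed

lemma bootstrap_process_imp_percolates:
  assumes "bootstrap_process (complete_graph (d + 2)) Hs" "finite V" "d \<ge> 1"
    "hd Hs = (V, H)" "last Hs = (V, G)" "G \<subseteq> [V]\<^bsup>2\<^esup>"
  shows "percolates d H G"
  using assms(1,4,5,6)
proof (induction Hs arbitrary: G rule: rev_induct)
  case (snoc x xs)
  show ?case
  proof (cases "xs = []")
    case True
    thus ?thesis using snoc by (simp add: percolates.base)
  next
    case False
    have x: "x = (V, G)" using snoc by simp
    have proc: "bootstrap_process (complete_graph (d + 2)) xs"
      and st: "bootstrap_step (complete_graph (d + 2)) (last xs) (V, G)"
      using snoc.prems(1) False x by (auto simp: bootstrap_process_def successively_append_iff)
    obtain S where S: "last xs = (V, S)" "S \<subseteq> G"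
      using st by (cases "last xs") (auto simp: bootstrap_step_def)
    obtain e where "e \<notin> S" "covered d S UNIV e" "G = insert e S"
      using st bootstrap_step_iff[OF assms(2) snoc.prems(4) assms(3)] S(1) by auto
    moreover have "percolates d H S"
      using snoc.IH[OF proc _ S(1)] snoc.prems False S(2) by auto
    ultimately show ?thesis by (auto intro: percolates.step)
  qed
qed (simp add: bootstrap_process_def)

lemma percolates_imp_bootstrap_process:
  assumes "percolates d H G" "finite V" "d \<ge> 1" "G \<subseteq> [V]\<^bsup>2\<^esup>"
  shows "\<exists>Hs. bootstrap_process (complete_graph (d + 2)) Hs \<and> hd Hs = (V, H) \<and> last Hs = (V, G)"
  using assms(1,4)
proof (induction rule: percolates.induct)
  case base
  thus ?case by (intro exI[of _ "[(V, H)]"]) (simp add: bootstrap_process_def)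
next
  case (step S e)
  then obtain Hs where Hs: "bootstrap_process (complete_graph (d + 2)) Hs" "hd Hs = (V, H)" "last Hs = (V, S)"
    by auto
  have "bootstrap_step (complete_graph (d + 2)) (V, S) (V, insert e S)"
    using bootstrap_step_iff[OF assms(2) step.prems assms(3)] step.hyps by blast
  thus ?case using Hs
    by (intro exI[of _ "Hs @ [(V, insert e S)]"]) (auto simp: bootstrap_process_def successively_append_iff)
qed

lemma weakly_saturated_iff:
  assumes "finite V" "G \<subseteq> [V]\<^bsup>2\<^esup>" "d \<ge> 1"
  shows "weakly_saturated (V, G) (complete_graph (d + 2)) X \<longleftrightarrow>
    (\<exists>H. X = (V, H) \<and> percolates d H G \<and> (\<nexists>K. copy_in (complete_graph (d + 2)) (V, H) K))"
proof
  assume *: "weakly_saturated (V, G) (complete_graph (d + 2)) X"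
  then obtain H where "X = (V, H)" 
    by (cases X) (auto simp: weakly_saturated_def spanning_subgraph_def)
  thus "\<exists>H. X = (V, H) \<and> percolates d H G \<and> (\<nexists>K. copy_in (complete_graph (d + 2)) (V, H) K)"
    using * bootstrap_process_imp_percolates[OF _ assms(1,3) _ _ assms(2)]
    by (auto simp: weakly_saturated_def)
next
  assume "\<exists>H. X = (V, H) \<and> percolates d H G \<and> (\<nexists>K. copy_in (complete_graph (d + 2)) (V, H) K)"
  thus "weakly_saturated (V, G) (complete_graph (d + 2)) X"
    using percolates_imp_bootstrap_process[OF _ assms(1,3,2)] percolates_subset assms(1,2)
    by (fastforce simp: weakly_saturated_def spanning_subgraph_def subgraph_def simple_graph_def)
qed

text \<open>Deleting an edge of a clique keeps a generating set generating, so clique-freeness can be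
  ignored when minimizing.\<close>

lemma clique_free_generators:
  assumes "finite V" "G \<subseteq> [V]\<^bsup>2\<^esup>" "d \<ge> 1" "percolates d H G"
  shows "\<exists>H'\<subseteq>H. percolates d H' G \<and> (\<nexists>K. copy_in (complete_graph (d + 2)) (V, H') K)"
  using assms(4)
proof (induction "card H" arbitrary: H rule: less_induct)
  case less
  have HG: "H \<subseteq> [V]\<^bsup>2\<^esup>" using percolates_subset[OF less.prems] assms(2) by auto
  have finH: "finite H" using HG assms(1) finite_subset finite_nsets2 by blast
  show ?case
  proof (cases "\<nexists>K. copy_in (complete_graph (d + 2)) (V, H) K")
    case True
    thus ?thesis using less.prems by auto
  next
    case False
    then obtain W where W: "W \<subseteq> V" "card W = d + 2" "[W]\<^bsup>2\<^esup> \<subseteq> H"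
      using copy_in_complete_iff[OF assms(1) HG] by auto
    have finW: "finite W" using W(1) assms(1) finite_subset by blast
    have "card ([W]\<^bsup>2\<^esup>) \<noteq> 0" using finW W(2) by (simp add: card_nsets2 zero_less_binomial)
    then obtain e where e: "e \<in> [W]\<^bsup>2\<^esup>" by (metis card.empty ex_in_conv)
    have "covered d (H - {e}) UNIV e"
      using W e HG finW by (subst covered_iff_clique[OF _ assms(1) _ assms(3)]) (auto intro!: exI[of _ W])
    hence "percolates d (H - {e}) (insert e (H - {e}))"
      by (intro percolates.step percolates.base) auto
    hence "percolates d (H - {e}) G"
      using e W(3) percolates_trans[OF less.prems] by (simp add: insert_absorb subset_iff)
    moreover have "card (H - {e}) < card H"
      using e W(3) finH by (intro psubset_card_mono) auto
    ultimately obtain H' where "H' \<subseteq> H - {e}" "percolates d H' G"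
        "\<nexists>K. copy_in (complete_graph (d + 2)) (V, H') K"
      using less.hyps by blast
    thus ?thesis by (intro exI[of _ H']) auto
  qed
qed

text \<open>Together with \<open>wsat_le\<close> this identifies wsat with the least size of a
  generating set, cliques allowed.\<close>

lemma wsat_attained:
  assumes "finite V" "G \<subseteq> [V]\<^bsup>2\<^esup>" "d \<ge> 1"
  obtains H where "percolates d H G" "card H = wsat (V, G) (complete_graph (d + 2))"
proof -
  obtain H' where "percolates d H' G" "\<nexists>K. copy_in (complete_graph (d + 2)) (V, H') K"
    using clique_free_generators[OF assms percolates.base] by blast
  hence ex: "\<exists>k X. weakly_saturated (V, G) (complete_graph (d + 2)) X \<and> card (edges X) = k"
    unfolding weakly_saturated_iff[OF assms] by auto
  obtain X where "weakly_saturated (V, G) (complete_graph (d + 2)) X"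
    "card (edges X) = wsat (V, G) (complete_graph (d + 2))"
    using LeastI_ex[OF ex] unfolding wsat_def by blast
  thus ?thesis using that unfolding weakly_saturated_iff[OF assms] by auto
qed

lemma wsat_le:
  assumes "finite V" "G \<subseteq> [V]\<^bsup>2\<^esup>" "d \<ge> 1" "percolates d H G"
  shows "wsat (V, G) (complete_graph (d + 2)) \<le> card H"
proof -
  obtain H' where H': "H' \<subseteq> H" "percolates d H' G" "\<nexists>K. copy_in (complete_graph (d + 2)) (V, H') K"
    using clique_free_generators[OF assms] by blast
  have "finite H" using percolates_subset[OF assms(4)] assms(1,2) finite_subset finite_nsets2 by metis
  moreover have "wsat (V, G) (complete_graph (d + 2)) \<le> card H'"
    unfolding wsat_def weakly_saturated_iff[OF assms(1-3)] using H' by (intro Least_le) auto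
  ultimately show ?thesis using H'(1) card_mono[of H H'] by linarith
qed

subsection \<open>The lower bound for complete graphs\<close>

text \<open>Gaussian elimination: an unknown with nonzero coefficient in equation \<open>j\<close>
  is eliminated from the other equations.\<close>

lemma homogeneous_system_nontrivial:
  fixes M :: "'j \<Rightarrow> 'i \<Rightarrow> real"
  assumes "finite J" "finite I" "card J < card I"
  shows "\<exists>c. (\<exists>i\<in>I. c i \<noteq> 0) \<and> (\<forall>j\<in>J. (\<Sum>i\<in>I. M j i * c i) = 0)"
  using assms
proof (induction J arbitrary: I M rule: finite_induct)
  case empty
  then obtain i where "i \<in> I" by fastforce
  thus ?case by (intro exI[of _ "\<lambda>_. 1"]) auto
next
  case (insert j J)
  show ?case
  proof (cases "\<forall>i\<in>I. M j i = 0")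
    case True
    obtain c where "\<exists>i\<in>I. c i \<noteq> 0" "\<forall>j\<in>J. (\<Sum>i\<in>I. M j i * c i) = 0"
      using insert.IH[of I M] insert.prems insert.hyps by auto
    thus ?thesis using True by (intro exI[of _ c]) auto
  next
    case False
    then obtain i0 where i0: "i0 \<in> I" "M j i0 \<noteq> 0" by auto
    let ?I = "I - {i0}"
    obtain c where c: "\<exists>i\<in>?I. c i \<noteq> 0"
      "\<forall>j'\<in>J. (\<Sum>i\<in>?I. (M j' i - M j' i0 / M j i0 * M j i) * c i) = 0"
    proof -
      have "finite ?I" "card J < card ?I" using insert.prems insert.hyps i0(1) by auto
      thus ?thesis using insert.IH[of ?I "\<lambda>j' i. M j' i - M j' i0 / M j i0 * M j i"] that by blast
    qed
    define z where "z = - (\<Sum>i\<in>?I. M j i * c i) / M j i0"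
    have sum: "(\<Sum>i\<in>I. M j' i * (c(i0 := z)) i) = M j' i0 * z + (\<Sum>i\<in>?I. M j' i * c i)" for j'
      using insert.prems i0 by (subst sum.remove[of I i0]) (auto intro!: sum.cong)
    have "(\<Sum>i\<in>I. M j' i * (c(i0 := z)) i) = 0" if "j' \<in> J" for j'
    proof -
      have "(\<Sum>i\<in>?I. (M j' i - M j' i0 / M j i0 * M j i) * c i)
         = (\<Sum>i\<in>?I. M j' i * c i) - M j' i0 / M j i0 * (\<Sum>i\<in>?I. M j i * c i)"
        by (simp add: algebra_simps sum_subtractf sum_distrib_left)
      thus ?thesis using c(2) that sum[of j'] by (simp add: z_def)
    qed
    moreover have "(\<Sum>i\<in>I. M j i * (c(i0 := z)) i) = 0"
      using sum[of j] i0(2) by (simp add: z_def)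
    moreover have "\<exists>i\<in>I. (c(i0 := z)) i \<noteq> 0" using c(1) by auto
    ultimately show ?thesis by (intro exI[of _ "c(i0 := z)"]) auto
  qed
qed

lemma poly_sum_monom_eq_0:
  fixes c :: "nat \<Rightarrow> real"
  assumes "finite X" "card X \<ge> d" "\<And>x. x \<in> X \<Longrightarrow> (\<Sum>l<d. c l * x ^ l) = 0" "l < d"
  shows "c l = 0"
proof -
  define q where "q = (\<Sum>l<d. monom (c l) l)"
  have q: "poly q x = (\<Sum>l<d. c l * x ^ l)" for x
    by (simp add: q_def poly_sum poly_monom)
  have coeff: "coeff q k = (if k < d then c k else 0)" for k
    by (simp add: q_def coeff_sum if_distrib cong: if_cong)
  have "q = 0"
  proof (rule ccontr)
    assume "q \<noteq> 0"
    have "degree q < d"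
    proof (cases "degree q = 0")
      case False
      hence "coeff q (degree q) \<noteq> 0" using \<open>q \<noteq> 0\<close> by simp
      thus ?thesis using coeff by (metis)
    qed (use assms(4) in simp)
    moreover have "card X \<le> card {x. poly q x = 0}"
      using assms(3) q poly_roots_finite[OF \<open>q \<noteq> 0\<close>] by (intro card_mono) auto
    moreover have "card {x. poly q x = 0} \<le> degree q"
      using \<open>q \<noteq> 0\<close> by (rule card_poly_roots_bound)
    ultimately show False using assms(2) by linarith
  qed
  thus ?thesis using coeff[of l] assms(4) by simp
qed

text \<open>Up to scale these are the coefficients of the divided difference of order
  \<open>d + 1\<close>. A dimension count yields weights that are not all zero; if the weight at
  \<open>y\<close> vanished, testing against the polynomial of degree \<open>d\<close> with roots
  \<open>X - {y, z}\<close> would force the weight at \<open>z\<close> to vanish as well.\<close>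

lemma nonvanishing_weights:
  fixes X :: "real set"
  assumes "finite X" "card X = d + 2"
  shows "\<exists>a. (\<forall>x\<in>X. a x \<noteq> 0) \<and> (\<forall>l\<le>d. (\<Sum>x\<in>X. a x * x ^ l) = 0)"
proof -
  obtain a where a: "\<exists>x\<in>X. a x \<noteq> 0" "\<forall>l\<in>{..d}. (\<Sum>x\<in>X. x ^ l * a x) = 0"
    using homogeneous_system_nontrivial[of "{..d}" X "\<lambda>l x. x ^ l"] assms by auto
  obtain z where z: "z \<in> X" "a z \<noteq> 0" using a(1) by auto
  have "a y \<noteq> 0" if y: "y \<in> X" for y
  proof
    assume ay: "a y = 0"
    hence "y \<noteq> z" using z by auto
    define q where "q = (\<Prod>x\<in>X - {y, z}. [:-x, 1:])"
    have deg: "degree q = d"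
      using assms y z \<open>y \<noteq> z\<close> by (simp add: q_def degree_prod_eq_sum_degree card_Diff_subset)
    have "(\<Sum>x\<in>X. a x * poly q x) = (\<Sum>l\<le>d. coeff q l * (\<Sum>x\<in>X. x ^ l * a x))"
      unfolding poly_altdef deg sum_distrib_left
      by (subst sum.swap) (simp add: mult_ac)
    also have "\<dots> = 0" using a(2) by simp
    finally have "(\<Sum>x\<in>X. a x * poly q x) = 0" .
    moreover have "(\<Sum>x\<in>X. a x * poly q x) = (\<Sum>x\<in>{z}. a x * poly q x)"
      using assms(1) z(1) ay
      by (intro sum.mono_neutral_right) (auto simp: q_def poly_prod)
    moreover have "poly q z \<noteq> 0" using assms(1) by (auto simp: q_def poly_prod)
    ultimately show False using z by simp
  qed
  thus ?thesis using a(2) by (intro exI[of _ a]) (auto simp: mult_ac)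
qed

text \<open>Weights \<open>a\<close> that annihilate all polynomials of degree at most \<open>d\<close> on \<open>X\<close> yield a linear relation
  between the labels \<open>g\<^sub>y(x) - g\<^sub>x(y)\<close>, in which \<open>uv\<close> has the coefficient \<open>a\<^sub>u a\<^sub>v (v - u) \<noteq> 0\<close>.\<close>

lemma symmetric_on_clique:
  fixes c :: "real \<Rightarrow> nat \<Rightarrow> real" and d :: nat
  defines "g \<equiv> \<lambda>y x. \<Sum>l<d. c y l * x ^ l"
  assumes "finite X" "card X = d + 2" "u \<in> X" "v \<in> X" "u \<noteq> v"
    and "\<And>x y. x \<in> X \<Longrightarrow> y \<in> X \<Longrightarrow> {x, y} \<noteq> {u, v} \<Longrightarrow> g y x = g x y"
  shows "g v u = g u v"
proof -
  obtain a where a: "\<forall>x\<in>X. a x \<noteq> 0" "\<forall>l\<le>d. (\<Sum>x\<in>X. a x * x ^ l) = 0"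
    using nonvanishing_weights[OF assms(2,3)] by blast
  have 1: "(\<Sum>x\<in>X. a x * g y x) = 0" for y
  proof -
    have "(\<Sum>x\<in>X. a x * g y x) = (\<Sum>l<d. c y l * (\<Sum>x\<in>X. a x * x ^ l))"
      unfolding g_def sum_distrib_left by (subst sum.swap) (simp add: mult_ac)
    thus ?thesis using a(2) by simp
  qed
  have 2: "(\<Sum>y\<in>X. a y * y * g x y) = 0" for x
  proof -
    have "(\<Sum>y\<in>X. a y * y * g x y) = (\<Sum>l<d. c x l * (\<Sum>y\<in>X. a y * y ^ Suc l))"
      unfolding g_def sum_distrib_left by (subst sum.swap) (simp add: mult_ac)
    also have "\<dots> = 0" using a(2) by (intro sum.neutral) (auto simp del: power_Suc)
    finally show ?thesis .
  qed
  \<comment> \<open>The double sum of \<open>\<psi>\<close> vanishes because the weights kill each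
    \<open>g y\<close>, and also the product of the variable with \<open>g x\<close>, which still
    has degree at most \<open>d\<close>. Only the pair \<open>uv\<close> can contribute, so its
    label must be zero.\<close>
  define \<psi> where "\<psi> x y = a x * (a y * y) * (g y x - g x y)" for x y
  have "(\<Sum>x\<in>X. \<Sum>y\<in>X. \<psi> x y) = (\<Sum>y\<in>X. a y * y * (\<Sum>x\<in>X. a x * g y x)) - (\<Sum>x\<in>X. a x * (\<Sum>y\<in>X. a y * y * g x y))"
  proof -
    have "(\<Sum>x\<in>X. \<Sum>y\<in>X. \<psi> x y) = (\<Sum>x\<in>X. \<Sum>y\<in>X. a x * (a y * y) * g y x) - (\<Sum>x\<in>X. \<Sum>y\<in>X. a x * (a y * y) * g x y)"
      by (simp add: \<psi>_def right_diff_distrib sum_subtractf)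
    also have "(\<Sum>x\<in>X. \<Sum>y\<in>X. a x * (a y * y) * g y x) = (\<Sum>y\<in>X. a y * y * (\<Sum>x\<in>X. a x * g y x))"
      by (subst sum.swap) (simp add: sum_distrib_left mult_ac)
    also have "(\<Sum>x\<in>X. \<Sum>y\<in>X. a x * (a y * y) * g x y) = (\<Sum>x\<in>X. a x * (\<Sum>y\<in>X. a y * y * g x y))"
      by (simp add: sum_distrib_left mult_ac)
    finally show ?thesis .
  qed
  hence "(\<Sum>(x, y)\<in>X \<times> X. \<psi> x y) = 0" using 1 2 by (simp add: sum.cartesian_product)
  moreover have "(\<Sum>(x, y)\<in>X \<times> X. \<psi> x y) = (\<Sum>(x, y)\<in>{(u, v), (v, u)}. \<psi> x y)"
  proof (rule sum.mono_neutral_right)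
    show "\<forall>i\<in>X \<times> X - {(u, v), (v, u)}. (case i of (x, y) \<Rightarrow> \<psi> x y) = 0"
    proof -
      have "\<psi> x y = 0" if "x \<in> X" "y \<in> X" "(x, y) \<notin> {(u, v), (v, u)}" for x y
      proof -
        have "{x, y} \<noteq> {u, v}" using that(3) by (auto simp: doubleton_eq_iff)
        thus ?thesis using assms(7)[of x y] that by (simp add: \<psi>_def)
      qed
      thus ?thesis by auto
    qed
  qed (use assms in auto)
  ultimately have "\<psi> u v + \<psi> v u = 0" using assms(6) by simp
  hence "a u * a v * (v - u) * (g v u - g u v) = 0" by (simp add: \<psi>_def algebra_simps)
  thus ?thesis using a(1) assms(4-6) by auto
qed

lemma choose_two_add_Suc: "(d choose 2) + (Suc d choose 2) = d * d"
  by (induction d) (auto simp: numeral_2_eq_2)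

text \<open>Label \<open>xy\<close> by \<open>g\<^sub>y(x) - g\<^sub>x(y)\<close>. The \<open>d n\<close> coefficients of the polynomials \<open>g\<^sub>x\<close>
  are restricted by one equation per generating edge and by the normalization \<open>g\<^sub>j(i) = 0\<close> for
  \<open>j \<le> i \<le> d\<close>; vanishing of all labels then forces all coefficients to vanish.\<close>

lemma percolates_complete_card_ge:
  assumes "d \<ge> 1" "d \<le> n" "H \<subseteq> [{1..n}]\<^bsup>2\<^esup>" "percolates d H ([{1..n}]\<^bsup>2\<^esup>)"
  shows "(d choose 2) + d * (n - d) \<le> card H"
proof (rule ccontr)
  assume "\<not> (d choose 2) + d * (n - d) \<le> card H"
  \<comment> \<open>Subtracting the \<open>Suc d choose 2\<close> normalizations from the
    \<open>d * n\<close> coefficients leaves exactly the claimed bound, by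
    \<open>(d choose 2) + (Suc d choose 2) = d * d\<close>.\<close>
  hence "card H + (Suc d choose 2) < d * d + d * (n - d)"
    using choose_two_add_Suc[of d] by linarith
  hence less: "card H + (Suc d choose 2) < n * d"
    using assms(2) by (simp add: distrib_left[symmetric] mult.commute)
  have finH: "finite H" using assms(3) finite_subset finite_nsets2 by blast
  define I where "I = real ` {1..n} \<times> {..<d}"
  \<comment> \<open>\<open>Inl e\<close> stands for the equation of a generating edge. A pair in
    \<open>{0..d}\<close> with ends \<open>j - 1 < i\<close> stands for the normalization of
    \<open>g j\<close> at \<open>i\<close>; the shift by one turns the constraint
    \<open>1 \<le> j \<le> i \<le> d\<close> into two-element sets.\<close>
  define J where "J = (Inl ` H :: (nat set + nat set) set) \<union> Inr ` [{0..d}]\<^bsup>2\<^esup>"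
  define M where "M = (\<lambda>j (y, l). case j of
      Inl e \<Rightarrow> (if y = real (Max e) then real (Min e) ^ l else 0) - (if y = real (Min e) then real (Max e) ^ l else 0)
    | Inr e \<Rightarrow> if y = real (Suc (Min e)) then real (Max e) ^ l else 0)"
  have "card J = card H + (Suc d choose 2)"
    unfolding J_def using finH
    by (subst card_Un_disjoint) (auto simp: card_image card_nsets2)
  moreover have "card I = n * d"
    unfolding I_def by (simp add: card_cartesian_product card_image inj_on_def)
  moreover have "finite J" "finite I" unfolding J_def I_def using finH by auto
  ultimately obtain c where c: "\<exists>i\<in>I. c i \<noteq> 0" "\<forall>j\<in>J. (\<Sum>i\<in>I. M j i * c i) = 0"
    using homogeneous_system_nontrivial[of J I M] less by auto
  define g where "g = (\<lambda>y x. \<Sum>l<d. curry c y l * x ^ l)"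
  have ev: "(\<Sum>(y, l)\<in>I. (if y = b then a ^ l else 0) * c (y, l)) = g b a" if "b \<in> real ` {1..n}" for a b
  proof -
    have "(\<Sum>(y, l)\<in>I. (if y = b then a ^ l else 0) * c (y, l)) 
       = (\<Sum>y\<in>real ` {1..n}. if y = b then g b a else 0)"
      unfolding I_def sum.cartesian_product[symmetric] g_def
      by (intro sum.cong) (auto simp: mult.commute)
    thus ?thesis using that by simp
  qed
  have edge: "g (real v) (real u) = g (real u) (real v)" if "{u, v} \<in> H" "u < v" for u v
  proof -
    have uv: "real u \<in> real ` {1..n}" "real v \<in> real ` {1..n}" using that assms(3) by (auto simp: nsets_def)
    have mm: "Min {u, v} = u" "Max {u, v} = v" using that(2) by auto
    have "(\<Sum>i\<in>I. M (Inl {u, v}) i * c i) = (\<Sum>(y, l)\<in>I. (if y = real v then real u ^ l else 0) * c (y, l))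
        - (\<Sum>(y, l)\<in>I. (if y = real u then real v ^ l else 0) * c (y, l))"
      unfolding sum_subtractf[symmetric]
    proof (intro sum.cong refl)
      fix i show "M (Inl {u, v}) i * c i = (case i of (y, l) \<Rightarrow> (if y = real v then real u ^ l else 0) * c (y, l))
          - (case i of (y, l) \<Rightarrow> (if y = real u then real v ^ l else 0) * c (y, l))"
        by (cases i) (simp only: M_def prod.case sum.case left_diff_distrib mm)
    qed
    also have "\<dots> = g (real v) (real u) - g (real u) (real v)" using ev uv by simp
    finally show ?thesis using c(2) that(1) by (auto simp: J_def)
  qed
  have gauge: "g (real j) (real i) = 0" if "1 \<le> j" "j \<le> i" "i \<le> d" for i j
  proof -
    have mm: "Min {j - 1, i} = j - 1" "Max {j - 1, i} = i" using that by auto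
    have "(\<Sum>i'\<in>I. M (Inr {j - 1, i}) i' * c i') = (\<Sum>(y, l)\<in>I. (if y = real j then real i ^ l else 0) * c (y, l))"
    proof (intro sum.cong refl)
      have "Suc (j - 1) = j" using that(1) by simp
      fix k show "M (Inr {j - 1, i}) k * c k = (case k of (y, l) \<Rightarrow> (if y = real j then real i ^ l else 0) * c (y, l))"
        by (cases k) (simp only: M_def prod.case sum.case mm \<open>Suc (j - 1) = j\<close>)
    qed
    also have "\<dots> = g (real j) (real i)" using that assms(2) by (intro ev) auto
    moreover have "Inr {j - 1, i} \<in> J"
    proof -
      have "{j - 1, i} \<in> [{0..d}]\<^bsup>2\<^esup>" using that by (simp add: nsets_def)
      thus ?thesis by (simp add: J_def)
    qed
    ultimately show ?thesis using c(2) by auto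
  qed
  define symm where "symm e = (\<forall>u\<in>e. \<forall>v\<in>e. g (real v) (real u) = g (real u) (real v))" for e :: "nat set"
  have symm_pair: "symm {u, v} \<longleftrightarrow> g (real v) (real u) = g (real u) (real v)" for u v
    by (auto simp: symm_def)
  have H: "symm e" if e: "e \<in> H" for e
  proof -
    have "e \<in> [{1..n}]\<^bsup>2\<^esup>" using e assms(3) by blast
    then obtain u v where uv: "e = {u, v}" "u \<noteq> v" unfolding nsets2_iff by blast
    thus ?thesis using edge[of u v] edge[of v u] e
      by (cases "u < v") (simp_all add: symm_pair insert_commute)
  qed
  have all: "symm e" if "percolates d H S" "S \<subseteq> [{1..n}]\<^bsup>2\<^esup>" "e \<in> S" for S e
    using that
  proof (induction arbitrary: e rule: percolates.induct)
    case base
    thus ?case using H by simp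
  next
    case (step S f)
    show ?case
    proof (cases "e \<in> S")
      case True
      thus ?thesis using step by auto
    next
      case False
      hence ef: "e = f" using step.prems by auto
      have "f \<in> [{1..n}]\<^bsup>2\<^esup>" using step.prems by blast
      then obtain u v where uv: "f = {u, v}" "u \<noteq> v" unfolding nsets2_iff by blast
      obtain W where W: "finite W" "card W = d" "W \<inter> f = {}" "[W \<union> f]\<^bsup>2\<^esup> - {f} \<subseteq> S"
        using step.hyps(3) by (auto simp: covered_def)
      have "g (real v) (real u) = g (real u) (real v)"
        unfolding g_def
      proof (rule symmetric_on_clique[of "real ` (W \<union> f)"])
        show "card (real ` (W \<union> f)) = d + 2"
          using W uv by (subst card_image) (auto simp: inj_on_def card_Un_disjoint)
        fix x y assume xy: "x \<in> real ` (W \<union> f)" "y \<in> real ` (W \<union> f)" "{x, y} \<noteq> {real u, real v}"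
        then obtain x' y' where xy': "x = real x'" "y = real y'" "x' \<in> W \<union> f" "y' \<in> W \<union> f" by auto
        show "(\<Sum>l<d. curry c y l * x ^ l) = (\<Sum>l<d. curry c x l * y ^ l)"
        proof (cases "x' = y'")
          case False
          have "{x', y'} \<noteq> f" using xy(3) xy' uv by (auto simp: doubleton_eq_iff)
          moreover have "{x', y'} \<in> [W \<union> f]\<^bsup>2\<^esup>" using xy' False by (auto simp: nsets_def)
          ultimately have "{x', y'} \<in> S" using W(4) by blast
          hence "symm {x', y'}" using step.IH step.prems(1) by blast
          thus ?thesis using xy' by (simp add: symm_pair g_def)
        qed (use xy' in simp)
      qed (use W uv in auto)
      thus ?thesis using ef uv by (simp add: symm_pair)
    qed
  qed
  have sym: "g (real v) (real u) = g (real u) (real v)" if "u \<in> {1..n}" "v \<in> {1..n}" for u v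
  proof (cases "u = v")
    case False
    hence "{u, v} \<in> [{1..n}]\<^bsup>2\<^esup>" using that by (auto simp: nsets_def)
    hence "symm {u, v}" using all[OF assms(4)] by blast
    thus ?thesis by (simp add: symm_pair)
  qed simp
  have c0: "c (real j, l) = 0" if "j \<in> {1..n}" "l < d" "\<And>i. i \<in> {1..d} \<Longrightarrow> g (real j) (real i) = 0" for j l
  proof -
    have "curry c (real j) l = 0"
      using that(2,3)
      by (intro poly_sum_monom_eq_0[of "real ` {1..d}" d "curry c (real j)"]) (auto simp: card_image g_def)
    thus ?thesis by simp
  qed
  \<comment> \<open>For \<open>i < j\<close> symmetry reduces the value of \<open>g j\<close> at
    \<open>i\<close> to the normalized value of \<open>g i\<close> at \<open>j\<close>. Thus
    \<open>g j\<close> has degree below \<open>d\<close> and the \<open>d\<close> roots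
    \<open>1..d\<close>.\<close>
  have small: "c (real j, l) = 0" if j: "j \<in> {1..d}" "l < d" for j l
  proof (rule c0)
    fix i assume i: "i \<in> {1..d}"
    show "g (real j) (real i) = 0"
    proof (cases "j \<le> i")
      case False
      hence "g (real i) (real j) = 0" using gauge[of i j] i j by auto
      thus ?thesis using sym[of i j] i j assms(2) by simp
    qed (use gauge i j in auto)
  qed (use j assms(2) in auto)
  \<comment> \<open>For arbitrary \<open>j\<close> the \<open>d\<close> roots come from symmetry
    with the polynomials just shown to vanish.\<close>
  have "c (real j, l) = 0" if j: "j \<in> {1..n}" "l < d" for j l
  proof (rule c0)
    fix i assume i: "i \<in> {1..d}"
    have "g (real i) (real j) = 0" using small[OF i] by (simp add: g_def)
    thus "g (real j) (real i) = 0" using sym[of i j] i j assms(2) by simp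
  qed (use j in auto)
  thus False using c(1) by (auto simp: I_def)
qed

text \<open>The generators are the complete graph on \<open>{1..d}\<close> together with all edges
  leaving it; any two further vertices have \<open>{1..d}\<close> as a common witness set.\<close>

lemma percolates_complete_generators:
  assumes "d \<le> n"
  shows "\<exists>H. percolates d H ([{1..n}]\<^bsup>2\<^esup>) \<and> card H = (d choose 2) + d * (n - d)"
proof -
  define B where "B = (\<lambda>(u, v). {u, v}) ` ({1..d} \<times> {d+1..n})"
  define H where "H = [{1..d}]\<^bsup>2\<^esup> \<union> B"
  have "inj_on (\<lambda>(u, v). {u, v}) ({1..d} \<times> {d+1..n})"
    by (auto simp: inj_on_def doubleton_eq_iff)
  hence "card B = d * (n - d)" unfolding B_def by (simp add: card_image)
  moreover have "[{1..d}]\<^bsup>2\<^esup> \<inter> B = {}" by (auto simp: B_def nsets_def)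
  ultimately have card: "card H = (d choose 2) + d * (n - d)"
    unfolding H_def by (subst card_Un_disjoint) (auto simp: B_def card_nsets2)
  have HE: "H \<subseteq> [{1..n}]\<^bsup>2\<^esup>"
    unfolding H_def B_def using assms by (auto simp: nsets_def)
  have "percolates d H ([{1..n}]\<^bsup>2\<^esup>)"
  proof (rule percolates_fill[OF HE])
    fix e assume e: "e \<in> [{1..n}]\<^bsup>2\<^esup> - H"
    then obtain u v where uv: "e = {u, v}" "u \<noteq> v" "u \<in> {1..n}" "v \<in> {1..n}" by (auto simp: nsets2_iff)
    have H2: "{x, y} \<in> H" if "x \<in> {1..d}" "y \<in> {1..n}" "x \<noteq> y" for x y
      using that by (cases "y \<le> d") (auto simp: H_def B_def nsets_def)
    have "u \<notin> {1..d}" "v \<notin> {1..d}" using H2[of u v] H2[of v u] e uv by (auto simp: insert_commute)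
    moreover have "[{1..d} \<union> e]\<^bsup>2\<^esup> - {e} \<subseteq> H"
    proof
      fix f assume f: "f \<in> [{1..d} \<union> e]\<^bsup>2\<^esup> - {e}"
      then obtain x y where xy: "f = {x, y}" "x \<noteq> y" "x \<in> {1..d} \<union> e" "y \<in> {1..d} \<union> e"
        by (auto simp: nsets2_iff)
      have "x \<in> {1..d} \<or> y \<in> {1..d}" using f xy uv by (auto simp: doubleton_eq_iff)
      thus "f \<in> H" using H2[of x y] H2[of y x] xy uv assms by (auto simp: insert_commute)
    qed
    ultimately show "covered d H UNIV e"
      unfolding covered_def using uv by (intro exI[of _ "{1..d}"]) auto
  qed simp
  thus ?thesis using card by blast
qed

lemma wsat_eq_if_all_covered:
  assumes "d \<ge> 1" "d \<le> n" "G \<subseteq> [{1..n}]\<^bsup>2\<^esup>" "percolates d H G" "card H = (d choose 2) + d * (n - d)"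
    and "\<And>e. e \<in> [{1..n}]\<^bsup>2\<^esup> \<Longrightarrow> covered d G UNIV e"
  shows "wsat ({1..n}, G) (complete_graph (d + 2)) = (d choose 2) + d * (n - d)"
proof (rule antisym)
  show "wsat ({1..n}, G) (complete_graph (d + 2)) \<le> (d choose 2) + d * (n - d)"
    using wsat_le[OF _ assms(3,1,4)] assms(5) by simp
  obtain H' where H': "percolates d H' G" "card H' = wsat ({1..n}, G) (complete_graph (d + 2))"
    using wsat_attained[OF _ assms(3,1)] by auto
  have "percolates d G ([{1..n}]\<^bsup>2\<^esup>)"
    using assms(3,6) by (intro percolates_fill) auto
  hence "percolates d H' ([{1..n}]\<^bsup>2\<^esup>)" using percolates_trans H'(1) by blast
  thus "(d choose 2) + d * (n - d) \<le> wsat ({1..n}, G) (complete_graph (d + 2))"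
    using percolates_complete_card_ge[OF assms(1,2)] percolates_subset[of d H'] H'(2) by metis
qed

subsection \<open>The probability that a pair is not covered\<close>

text \<open>The ground set contains every pair that a witness set inside \<open>R\<close> can use
  and omits \<open>e\<close>, whose presence does not affect coverage.\<close>

definition uncovered_prob :: "nat \<Rightarrow> real \<Rightarrow> 'a set \<Rightarrow> 'a set \<Rightarrow> real" where
  "uncovered_prob d p R e = bexp p ([R \<union> e]\<^bsup>2\<^esup> - {e}) (\<lambda>S. of_bool (\<not> covered d S R e))"

text \<open>Normal form: for \<open>R\<close> disjoint from the pair only the number
  \<open>m\<close> of available witnesses matters (\<open>uncovered_prob_eq\<close>), so the pair is
  fixed as \<open>{0, 1}\<close> and the witnesses are numbered from 2.\<close>

definition uncov :: "nat \<Rightarrow> real \<Rightarrow> nat \<Rightarrow> real" where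
  "uncov d p m = uncovered_prob d p {2..<m+2} {0, 1}"

lemma uncovered_antimono:
  assumes "S \<subseteq> T"
  shows "of_bool (\<not> covered d T R e) \<le> (of_bool (\<not> covered d S R e) :: real)"
  using covered_mono[of d S R e T R] assms by auto

lemma covered_restrict:
  assumes "[R \<union> e]\<^bsup>2\<^esup> - {e} \<subseteq> A"
  shows "covered d (S \<inter> A) R e \<longleftrightarrow> covered d S R e"
proof
  assume "covered d S R e"
  then obtain W where W: "W \<subseteq> R" "finite W" "card W = d" "W \<inter> e = {}" "[W \<union> e]\<^bsup>2\<^esup> - {e} \<subseteq> S"
    by (auto simp: covered_def)
  have "[W \<union> e]\<^bsup>2\<^esup> \<subseteq> [R \<union> e]\<^bsup>2\<^esup>" using W(1) by (intro nsets2_mono) auto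
  hence "[W \<union> e]\<^bsup>2\<^esup> - {e} \<subseteq> S \<inter> A" using W(5) assms by blast
  thus "covered d (S \<inter> A) R e" using W unfolding covered_def by blast
qed (auto intro: covered_mono)

lemma bexp_uncovered:
  assumes "finite E" "[R \<union> e]\<^bsup>2\<^esup> - {e} \<subseteq> E"
  shows "bexp p E (\<lambda>S. of_bool (\<not> covered d S R e)) = uncovered_prob d p R e"
  unfolding uncovered_prob_def
  using assms covered_restrict[of R e "[R \<union> e]\<^bsup>2\<^esup> - {e}" d] by (intro bexp_restrict) auto

lemma covered_image:
  assumes "inj_on g (R \<union> e)" "S \<subseteq> [R \<union> e]\<^bsup>2\<^esup>"
  shows "covered d ((`) g ` S) (g ` R) (g ` e) \<longleftrightarrow> covered d S R e"
proof -
  have inj: "inj_on ((`) g) ([R \<union> e]\<^bsup>2\<^esup> \<union> {e})"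
    by (rule inj_on_subset[OF inj_on_image_Pow[OF assms(1)]]) (auto simp: nsets_def)
  have eq: "card (g ` W) = card W \<and> (g ` W \<inter> g ` e = {} \<longleftrightarrow> W \<inter> e = {}) \<and>
      ([g ` W \<union> g ` e]\<^bsup>2\<^esup> - {g ` e} \<subseteq> (`) g ` S \<longleftrightarrow> [W \<union> e]\<^bsup>2\<^esup> - {e} \<subseteq> S)" if "W \<subseteq> R" for W
  proof -
    have W: "W \<union> e \<subseteq> R \<union> e" using that by auto
    have sub: "[W \<union> e]\<^bsup>2\<^esup> \<subseteq> [R \<union> e]\<^bsup>2\<^esup>" using W by (rule nsets2_mono)
    have "[g ` W \<union> g ` e]\<^bsup>2\<^esup> = (`) g ` [W \<union> e]\<^bsup>2\<^esup>"
      using bij_betw_nsets[of g "W \<union> e" "g ` (W \<union> e)" 2] inj_on_subset[OF assms(1) W]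
      by (auto simp: bij_betw_def image_Un)
    moreover have "(`) g ` [W \<union> e]\<^bsup>2\<^esup> - {g ` e} = (`) g ` ([W \<union> e]\<^bsup>2\<^esup> - {e})"
      using inj_on_image_set_diff[OF inj, of "[W \<union> e]\<^bsup>2\<^esup>" "{e}"] sub by auto
    moreover have "(`) g ` ([W \<union> e]\<^bsup>2\<^esup> - {e}) \<subseteq> (`) g ` S \<longleftrightarrow> [W \<union> e]\<^bsup>2\<^esup> - {e} \<subseteq> S"
      using inj_on_image_subset_iff[OF inj, of "[W \<union> e]\<^bsup>2\<^esup> - {e}" S] sub assms(2) by auto
    moreover have "card (g ` W) = card W" "g ` W \<inter> g ` e = {} \<longleftrightarrow> W \<inter> e = {}"
      using inj_on_subset[OF assms(1), of W] W inj_on_image_Int[OF assms(1), of W e]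
      by (auto intro!: card_image)
    ultimately show ?thesis by metis
  qed
  have fin: "finite (g ` W) \<longleftrightarrow> finite W" if "W \<subseteq> R" for W
    using finite_image_iff[of g W] inj_on_subset[OF assms(1), of W] that by auto
  show ?thesis
  proof
    assume "covered d S R e"
    then obtain W where "W \<subseteq> R" "finite W" "card W = d" "W \<inter> e = {}" "[W \<union> e]\<^bsup>2\<^esup> - {e} \<subseteq> S"
      by (auto simp: covered_def)
    thus "covered d ((`) g ` S) (g ` R) (g ` e)"
      unfolding covered_def using eq[of W] by (intro exI[of _ "g ` W"]) auto
  next
    assume "covered d ((`) g ` S) (g ` R) (g ` e)"
    then obtain W' where W': "W' \<subseteq> g ` R" "finite W'" "card W' = d" "W' \<inter> g ` e = {}"
      "[W' \<union> g ` e]\<^bsup>2\<^esup> - {g ` e} \<subseteq> (`) g ` S"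
      by (auto simp: covered_def)
    obtain W where "W \<subseteq> R" "W' = g ` W" using W'(1) by (auto simp: subset_image_iff)
    thus "covered d S R e"
      unfolding covered_def using eq[of W] fin[of W] W' by (intro exI[of _ W]) auto
  qed
qed

lemma uncovered_prob_image:
  assumes "inj_on g (R \<union> e)"
  shows "uncovered_prob d p (g ` R) (g ` e) = uncovered_prob d p R e"
proof -
  have inj: "inj_on ((`) g) ([R \<union> e]\<^bsup>2\<^esup> \<union> {e})"
    by (rule inj_on_subset[OF inj_on_image_Pow[OF assms(1)]]) (auto simp: nsets_def)
  have "[g ` R \<union> g ` e]\<^bsup>2\<^esup> = (`) g ` [R \<union> e]\<^bsup>2\<^esup>"
    using bij_betw_nsets[of g "R \<union> e" "g ` (R \<union> e)" 2] assms
    by (auto simp: bij_betw_def image_Un)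
  hence "[g ` R \<union> g ` e]\<^bsup>2\<^esup> - {g ` e} = (`) g ` ([R \<union> e]\<^bsup>2\<^esup> - {e})"
    using inj_on_image_set_diff[OF inj, of "[R \<union> e]\<^bsup>2\<^esup>" "{e}"] by auto
  hence "uncovered_prob d p (g ` R) (g ` e) = 
      bexp p ([R \<union> e]\<^bsup>2\<^esup> - {e}) (\<lambda>S. of_bool (\<not> covered d ((`) g ` S) (g ` R) (g ` e)))"
    unfolding uncovered_prob_def using inj_on_subset[OF inj] by (simp add: bexp_image subset_iff)
  also have "\<dots> = uncovered_prob d p R e"
    unfolding uncovered_prob_def using covered_image[OF assms(1)] by (intro bexp_cong refl) auto
  finally show ?thesis .
qed

lemma uncovered_prob_eq:
  assumes "finite R" "card e = 2" "R \<inter> e = {}"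
  shows "uncovered_prob d p R e = uncov d p (card R)"
proof -
  obtain f where f: "bij_betw f {2..<card R+2} R"
    using assms(1) finite_same_card_bij[of "{2..<card R+2}" R] by auto
  obtain u v where e: "e = {u, v}" "u \<noteq> v" using assms(2) by (auto simp: card_2_iff)
  define g where "g = (\<lambda>i. if i = 0 then u else if i = 1 then v else f i)"
  have im: "g ` {2..<card R+2} = R" "g ` {0, 1} = e"
    using f e by (auto simp: g_def bij_betw_def image_def)
  have "inj_on g {2..<card R+2}"
    using f by (auto simp: g_def bij_betw_def inj_on_def)
  hence "inj_on g ({2..<card R+2} \<union> {0, 1})"
    using im assms(3) e(2) by (subst inj_on_Un) (auto simp: g_def inj_on_def)
  from uncovered_prob_image[OF this, of d p] show ?thesis unfolding im uncov_def .
qed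

lemma finite_card2: "card e = 2 \<Longrightarrow> finite e"
  by (metis card.infinite zero_neq_numeral)

lemma bexp_uncovered_eq:
  assumes "finite E" "[R \<union> e]\<^bsup>2\<^esup> - {e} \<subseteq> E" "finite R" "card e = 2" "R \<inter> e = {}"
  shows "bexp p E (\<lambda>S. of_bool (\<not> covered d S R e)) = uncov d p (card R)"
  using bexp_uncovered[OF assms(1,2)] uncovered_prob_eq[OF assms(3-5)] by simp

abbreviation uncov_pairs :: "nat \<Rightarrow> nat set set" where
  "uncov_pairs m \<equiv> [{2..<m+2} \<union> {0, 1}]\<^bsup>2\<^esup> - {{0, 1}}"

text \<open>Realizes \<open>uncov d p m\<close> on the pairs belonging to a larger count
  \<open>m'\<close>, so that different counts can be compared on one ground set.\<close>

lemma uncov_bexp: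
  assumes "m \<le> m'"
  shows "uncov d p m = bexp p (uncov_pairs m') (\<lambda>S. of_bool (\<not> covered d S {2..<m+2} {0, 1}))"
proof -
  have "[{2..<m+2} \<union> {0, 1}]\<^bsup>2\<^esup> \<subseteq> [{2..<m'+2} \<union> {0, 1}]\<^bsup>2\<^esup>"
    using assms by (intro nsets2_mono) auto
  hence "uncov_pairs m \<subseteq> uncov_pairs m'" by blast
  thus ?thesis by (subst bexp_uncovered) (auto simp: uncov_def)
qed

lemma uncov_nonneg: "0 \<le> p \<Longrightarrow> p \<le> 1 \<Longrightarrow> 0 \<le> uncov d p m"
  unfolding uncov_bexp[OF order.refl] by (intro bexp_nonneg) auto

lemma uncov_le_1: "0 \<le> p \<Longrightarrow> p \<le> 1 \<Longrightarrow> uncov d p m \<le> 1"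
  unfolding uncov_bexp[OF order.refl] by (intro bexp_le_const) auto

lemma uncov_antimono:
  assumes "m \<le> m'" "0 \<le> p" "p \<le> 1"
  shows "uncov d p m' \<le> uncov d p m"
  unfolding uncov_bexp[OF assms(1)] uncov_bexp[OF order.refl, of d p m']
proof (rule bexp_mono[OF assms(2,3)])
  fix S
  have "covered d S {2..<m+2} {0, 1} \<Longrightarrow> covered d S {2..<m'+2} {0, 1}"
    using assms(1) by (rule_tac covered_mono) auto
  thus "of_bool (\<not> covered d S {2..<m'+2} {0, 1}) \<le> (of_bool (\<not> covered d S {2..<m+2} {0, 1}) :: real)"
    by auto
qed

lemma uncov_copies_le:
  assumes "0 \<le> p" "p \<le> 1"
  shows "uncov d (1 - (1 - p) ^ k) m \<le> uncov d p m ^ k"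
  unfolding uncov_bexp[OF order.refl]
proof (rule bexp_decreasing_copies)
  fix S T :: "nat set set" assume "S \<subseteq> T" "\<not> covered d T {2..<m+2} {0, 1}"
  thus "\<not> covered d S {2..<m+2} {0, 1}" using covered_mono[of d S _ _ T] by blast
qed (use assms in auto)

lemma nsets_disjoint_pairs:
  assumes "R \<inter> R' = {}" "card e = 2"
  shows "([R \<union> e]\<^bsup>2\<^esup> - {e}) \<inter> ([R' \<union> e]\<^bsup>2\<^esup> - {e}) = {}"
proof -
  have "x = e" if "x \<in> [R \<union> e]\<^bsup>2\<^esup>" "x \<in> [R' \<union> e]\<^bsup>2\<^esup>" for x
  proof -
    have "x \<subseteq> e" "card x = 2" using that assms(1) by (auto simp: nsets_def)
    thus ?thesis using assms(2) finite_card2[OF assms(2)] card_subset_eq by metis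
  qed
  thus ?thesis by blast
qed

text \<open>Disjoint witness sets \<open>R i\<close> use disjoint sets of pairs, since the pair to
  be covered is the only one they would share and it is omitted. This gives \<open>k\<close>
  independent chances of being covered.\<close>

lemma uncov_blocks_le:
  assumes "0 \<le> p" "p \<le> 1"
  shows "uncov d p (k * d) \<le> (1 - p ^ (d + 2 choose 2)) ^ k"
proof -
  let ?e = "{0, 1::nat}"
  define R where "R i = {2 + i * d..<2 + i * d + d}" for i :: nat
  define B where "B i = [R i \<union> ?e]\<^bsup>2\<^esup> - {?e}" for i
  have Rdis: "R i \<inter> R j = {}" if "i \<noteq> j" for i j
  proof -
    have *: "R i \<inter> R j = {}" if "i < j" for i j
    proof -
      have "Suc i * d \<le> j * d" using that by (intro mult_right_mono) auto
      thus ?thesis by (auto simp: R_def)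
    qed
    show ?thesis using *[of i j] *[of j i] that by (cases "i < j") auto
  qed
  have Rsub: "R i \<subseteq> {2..<k*d+2}" if "i < k" for i
  proof -
    have "Suc i * d \<le> k * d" using that by (intro mult_right_mono) auto
    thus ?thesis by (auto simp: R_def)
  qed
  have Bsub: "B i \<subseteq> uncov_pairs (k * d)" if "i < k" for i
  proof -
    have "[R i \<union> ?e]\<^bsup>2\<^esup> \<subseteq> [{2..<k*d+2} \<union> ?e]\<^bsup>2\<^esup>" using Rsub[OF that] by (intro nsets2_mono) auto
    thus ?thesis unfolding B_def by blast
  qed
  define F where "F i S = (of_bool (\<not> (B i \<subseteq> S)) :: real)" for i S
  have "uncov d p (k * d) \<le> bexp p (uncov_pairs (k * d)) (\<lambda>S. \<Prod>i<k. F i S)"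
    unfolding uncov_bexp[OF order.refl, of d p "k * d"]
  proof (rule bexp_mono[OF assms])
    fix S
    show "of_bool (\<not> covered d S {2..<k*d+2} ?e) \<le> (\<Prod>i<k. F i S)"
    proof (cases "covered d S {2..<k*d+2} ?e")
      case False
      have "\<not> B i \<subseteq> S" if "i < k" for i
      proof
        assume "B i \<subseteq> S"
        hence "covered d S {2..<k*d+2} ?e"
          unfolding covered_def using Rsub[OF that]
          by (intro exI[of _ "R i"] conjI) (auto simp: R_def B_def)
        thus False using False by simp
      qed
      thus ?thesis by (simp add: F_def)
    qed (simp add: F_def prod_nonneg)
  qed
  also have "\<dots> = bexp p (\<Union>i\<in>{..<k}. B i) (\<lambda>S. \<Prod>i<k. F i S)"
    using Bsub by (intro bexp_restrict) (auto simp: F_def intro!: prod.cong)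
  also have "\<dots> = (\<Prod>i<k. bexp p (B i) (F i))"
  proof (rule bexp_prod)
    show "disjoint_family_on B {..<k}"
      unfolding disjoint_family_on_def B_def
      by (intro ballI impI nsets_disjoint_pairs Rdis) auto
  qed (auto simp: B_def F_def R_def)
  also have "\<dots> \<le> (\<Prod>i<k. 1 - p ^ (d + 2 choose 2))"
  proof (rule prod_mono)
    fix i assume "i \<in> {..<k}"
    have fin: "finite (B i)" by (simp add: B_def R_def)
    have "R i \<inter> ?e = {}" "finite (R i)" "card (R i) = d" by (auto simp: R_def)
    hence "card (R i \<union> ?e) = d + 2" by (subst card_Un_disjoint) auto
    hence "card ([R i \<union> ?e]\<^bsup>2\<^esup>) = (d + 2 choose 2)" using \<open>finite (R i)\<close> by (subst card_nsets2) auto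
    hence le: "card (B i) \<le> (d + 2 choose 2)" unfolding B_def using \<open>finite (R i)\<close> 
      by (metis Diff_subset card_mono finite.emptyI finite.insertI finite_UnI finite_nsets2)
    have "bexp p (B i) (F i) = bexp p (B i) (\<lambda>S. 1 - of_bool (B i \<subseteq> S))"
      by (intro bexp_cong refl) (auto simp: F_def)
    also have "\<dots> = 1 - p ^ card (B i)"
      using fin by (simp add: bexp_diff bexp_all_present)
    finally have eq: "bexp p (B i) (F i) = 1 - p ^ card (B i)" .
    have "p ^ card (B i) \<ge> p ^ (d + 2 choose 2)" "p ^ card (B i) \<le> 1"
      using le assms by (auto intro: power_decreasing power_le_one)
    thus "0 \<le> bexp p (B i) (F i) \<and> bexp p (B i) (F i) \<le> 1 - p ^ (d + 2 choose 2)"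
      unfolding eq by linarith
  qed
  finally show ?thesis by simp
qed

text \<open>With probability \<open>1 - p\<close> the pair joining the new vertex to the end
  \<open>0\<close> is absent, and then the new vertex cannot occur in a witness set.\<close>

lemma uncov_add_vertex:
  assumes "0 \<le> p" "p \<le> 1"
  shows "(1 - p) * uncov d p m \<le> uncov d p (Suc m)"
proof -
  let ?e = "{0, 1::nat}" and ?x = "{0, m + 2}"
  let ?E = "uncov_pairs (Suc m)"
  have "?x \<in> ?E" by (auto simp: nsets_def doubleton_eq_iff)
  hence x: "?E = insert ?x (?E - {?x})" by (rule insert_Diff[symmetric])
  have "?x \<notin> [{2..<m+2} \<union> ?e]\<^bsup>2\<^esup>" by (auto simp: nsets_def)
  moreover have "[{2..<m+2} \<union> ?e]\<^bsup>2\<^esup> \<subseteq> [{2..<Suc m+2} \<union> ?e]\<^bsup>2\<^esup>" by (intro nsets2_mono) auto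
  moreover have "x \<notin> A \<Longrightarrow> A \<subseteq> B \<Longrightarrow> A - C \<subseteq> B - C - {x}" for x :: "nat set" and A B C by blast
  ultimately have sub: "[{2..<m+2} \<union> ?e]\<^bsup>2\<^esup> - {?e} \<subseteq> ?E - {?x}" by presburger
  have "uncov d p m = bexp p (?E - {?x}) (\<lambda>S. of_bool (\<not> covered d S {2..<m+2} ?e))"
    using bexp_uncovered[OF _ sub] by (simp add: uncov_def)
  also have "\<dots> \<le> bexp p (?E - {?x}) (\<lambda>S. of_bool (\<not> covered d S {2..<Suc m+2} ?e))"
  proof (rule bexp_mono[OF assms])
    fix S assume S: "S \<subseteq> ?E - {?x}"
    have "covered d S {2..<m+2} ?e" if "covered d S {2..<Suc m+2} ?e"
    proof -
      obtain W where W: "W \<subseteq> {2..<Suc m+2}" "finite W" "card W = d" "W \<inter> ?e = {}" "[W \<union> ?e]\<^bsup>2\<^esup> - {?e} \<subseteq> S"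
        using \<open>covered d S {2..<Suc m+2} ?e\<close> by (auto simp: covered_def)
      have "m + 2 \<notin> W"
      proof
        assume "m + 2 \<in> W"
        hence "?x \<in> [W \<union> ?e]\<^bsup>2\<^esup> - {?e}" by (auto simp: nsets_def doubleton_eq_iff)
        hence "?x \<in> ?E - {?x}" using W(5) S by (meson subsetD)
        thus False by simp
      qed
      have "W \<subseteq> {2..<m+2}"
      proof
        fix y assume "y \<in> W"
        hence "y \<in> {2..<Suc m+2}" "y \<noteq> m + 2" using W(1) \<open>m + 2 \<notin> W\<close> by auto
        thus "y \<in> {2..<m+2}" by simp
      qed
      thus ?thesis using W unfolding covered_def by blast
    qed
    thus "of_bool (\<not> covered d S {2..<m+2} ?e) \<le> (of_bool (\<not> covered d S {2..<Suc m+2} ?e) :: real)"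
      by auto
  qed
  finally have "(1 - p) * uncov d p m \<le> (1 - p) * bexp p (?E - {?x}) (\<lambda>S. of_bool (\<not> covered d S {2..<Suc m+2} ?e))"
    using assms by (intro mult_left_mono) auto
  also have "\<dots> \<le> bexp p (insert ?x (?E - {?x})) (\<lambda>S. of_bool (\<not> covered d S {2..<Suc m+2} ?e))"
    using assms by (subst bexp_insert) (auto intro!: mult_nonneg_nonneg bexp_nonneg)
  also have "\<dots> = uncov d p (Suc m)"
    unfolding x[symmetric] uncov_bexp[OF order.refl, of d p "Suc m"] ..
  finally show ?thesis .
qed

text \<open>Union bound over the witness sets, each of which needs
  \<open>(d + 2 choose 2) - 1\<close> present pairs.\<close>

lemma covered_prob_le:
  assumes "0 \<le> p" "p \<le> 1" "d \<ge> 1"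
  shows "1 - uncov d p m \<le> real m ^ d * p ^ ((d + 2 choose 2) - 1)"
proof -
  let ?e = "{0, 1::nat}" and ?R = "{2..<m+2}" and ?E = "uncov_pairs m"
  define \<W> where "\<W> = {W. W \<subseteq> ?R \<and> card W = d}"
  have fin: "finite \<W>" unfolding \<W>_def by auto
  have "1 - uncov d p m = bexp p ?E (\<lambda>S. 1 - of_bool (\<not> covered d S ?R ?e))"
    unfolding uncov_bexp[OF order.refl, of d p m] by (simp add: bexp_diff)
  also have "\<dots> \<le> bexp p ?E (\<lambda>S. \<Sum>W\<in>\<W>. of_bool ([W \<union> ?e]\<^bsup>2\<^esup> - {?e} \<subseteq> S))"
  proof (rule bexp_mono[OF assms(1,2)])
    fix S
    show "1 - of_bool (\<not> covered d S ?R ?e) \<le> (\<Sum>W\<in>\<W>. of_bool ([W \<union> ?e]\<^bsup>2\<^esup> - {?e} \<subseteq> S) :: real)"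
    proof (cases "covered d S ?R ?e")
      case True
      then obtain W where W: "W \<in> \<W>" "[W \<union> ?e]\<^bsup>2\<^esup> - {?e} \<subseteq> S" by (auto simp: covered_def \<W>_def)
      have "(1::real) = of_bool ([W \<union> ?e]\<^bsup>2\<^esup> - {?e} \<subseteq> S)" using W(2) by simp
      also have "\<dots> \<le> (\<Sum>W\<in>\<W>. of_bool ([W \<union> ?e]\<^bsup>2\<^esup> - {?e} \<subseteq> S))"
        using W(1) fin by (intro member_le_sum) auto
      finally show ?thesis by simp
    qed (simp add: sum_nonneg)
  qed
  also have "\<dots> = (\<Sum>W\<in>\<W>. p ^ ((d + 2 choose 2) - 1))"
    unfolding bexp_sum
  proof (rule sum.cong[OF HOL.refl])
    fix W assume W: "W \<in> \<W>"
    have "finite W" using W by (auto simp: \<W>_def intro: finite_subset)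
    moreover have "W \<inter> ?e = {}" using W by (auto simp: \<W>_def)
    ultimately have "card (W \<union> ?e) = d + 2" using W by (subst card_Un_disjoint) (auto simp: \<W>_def)
    hence "card ([W \<union> ?e]\<^bsup>2\<^esup>) = (d + 2 choose 2)" using \<open>finite W\<close> by (subst card_nsets2) auto
    moreover have "?e \<in> [W \<union> ?e]\<^bsup>2\<^esup>" by (auto simp: nsets_def)
    ultimately have c: "card ([W \<union> ?e]\<^bsup>2\<^esup> - {?e}) = (d + 2 choose 2) - 1" by simp
    have "[W \<union> ?e]\<^bsup>2\<^esup> \<subseteq> [?R \<union> ?e]\<^bsup>2\<^esup>" using W by (intro nsets2_mono) (auto simp: \<W>_def)
    hence "[W \<union> ?e]\<^bsup>2\<^esup> - {?e} \<subseteq> ?E" by blast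
    thus "bexp p ?E (\<lambda>S. of_bool ([W \<union> ?e]\<^bsup>2\<^esup> - {?e} \<subseteq> S)) = p ^ ((d + 2 choose 2) - 1)"
      using bexp_all_present[of ?E "[W \<union> ?e]\<^bsup>2\<^esup> - {?e}" p] c by simp
  qed
  also have "\<dots> = real (m choose d) * p ^ ((d + 2 choose 2) - 1)"
    using n_subsets[of ?R d] by (simp add: \<W>_def)
  also have "\<dots> \<le> real m ^ d * p ^ ((d + 2 choose 2) - 1)"
  proof (intro mult_right_mono)
    show "real (m choose d) \<le> real m ^ d"
    proof (cases "d \<le> m")
      case True
      have "(m choose d) \<le> m ^ d" using True by (rule binomial_le_pow)
      thus ?thesis by (metis of_nat_le_iff of_nat_power)
    qed (simp add: binomial_eq_0)
  qed (use assms in auto)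
  finally show ?thesis .
qed

text \<open>Every \<open>d\<close>-set is contained in the union of \<open>d\<close> of the \<open>b\<close> blocks, so Harris' inequality
  compares the uncovered probabilities for \<open>N\<close> and for \<open>m\<close> vertices up to a constant power.\<close>

lemma uncov_power_le:
  assumes "0 \<le> p" "p \<le> 1" "N \<le> b * h" "d * h \<le> m" "h \<ge> 1"
  shows "uncov d p m ^ (2 ^ b) \<le> uncov d p N"
proof -
  let ?e = "{0, 1::nat}" and ?R = "{2..<N+2}" and ?E = "uncov_pairs N"
  define R where "R j = {x\<in>?R. (x - 2) div h = j}" for j
  \<comment> \<open>Index sets with fewer than \<open>d\<close> elements are included because
    several vertices of a witness set may lie in one block. At most \<open>2 ^ b\<close> factors
    arise, which explains the exponent.\<close>
  define \<J> where "\<J> = {J. J \<subseteq> {..<b} \<and> card J \<le> d}"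
  define F where "F J S = (of_bool (\<not> covered d S (\<Union>j\<in>J. R j) ?e) :: real)" for J S
  have fin: "finite \<J>" by (simp add: \<J>_def)
  have "card \<J> \<le> 2 ^ b"
    using card_mono[of "Pow {..<b}" \<J>] by (auto simp: \<J>_def card_Pow)
  have cardR: "card (R j) \<le> h" for j
  proof -
    have "R j \<subseteq> {2 + j * h..<2 + j * h + h}"
    proof
      fix x assume "x \<in> R j"
      hence x: "2 \<le> x" "(x - 2) div h = j" by (auto simp: R_def)
      have "j * h \<le> x - 2" using x(2) div_times_less_eq_dividend by blast
      moreover have "x - 2 < j * h + h" using x(2) assms(5) dividend_less_div_times[of h "x - 2"] by simp
      ultimately show "x \<in> {2 + j * h..<2 + j * h + h}" using x(1) by auto
    qed
    thus ?thesis using card_mono[of "{2 + j * h..<2 + j * h + h}" "R j"] by simp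
  qed
  have "uncov d p m ^ (2 ^ b) \<le> uncov d p m ^ card \<J>"
    using \<open>card \<J> \<le> 2 ^ b\<close> uncov_nonneg[OF assms(1,2)] uncov_le_1[OF assms(1,2)]
    by (intro power_decreasing) auto
  also have "\<dots> = (\<Prod>J\<in>\<J>. uncov d p m)" by simp
  also have "\<dots> \<le> (\<Prod>J\<in>\<J>. bexp p ?E (F J))"
  proof (intro prod_mono conjI uncov_nonneg assms)
    fix J assume J: "J \<in> \<J>"
    have finJ: "finite J" using J by (auto simp: \<J>_def intro: finite_subset)
    have sub: "(\<Union>j\<in>J. R j) \<subseteq> ?R" by (auto simp: R_def)
    hence "[(\<Union>j\<in>J. R j) \<union> ?e]\<^bsup>2\<^esup> \<subseteq> [?R \<union> ?e]\<^bsup>2\<^esup>" by (intro nsets2_mono) auto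
    hence "[(\<Union>j\<in>J. R j) \<union> ?e]\<^bsup>2\<^esup> - {?e} \<subseteq> ?E" by blast
    hence "bexp p ?E (F J) = uncov d p (card (\<Union>j\<in>J. R j))"
      unfolding F_def using sub finite_subset[OF sub] by (intro bexp_uncovered_eq) auto
    moreover have "card (\<Union>j\<in>J. R j) \<le> m"
    proof -
      have "card (\<Union>j\<in>J. R j) \<le> (\<Sum>j\<in>J. card (R j))" using finJ by (rule card_UN_le)
      also have "\<dots> \<le> card J * h" using cardR sum_bounded_above[of J "\<lambda>j. card (R j)" h] by simp
      also have "\<dots> \<le> d * h" using J by (auto simp: \<J>_def)
      finally show ?thesis using assms(4) by simp
    qed
    ultimately show "uncov d p m \<le> bexp p ?E (F J)" using uncov_antimono assms(1,2) by simp
  qed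
  also have "\<dots> \<le> bexp p ?E (\<lambda>S. \<Prod>J\<in>\<J>. F J S)"
    using fin assms(1,2) unfolding F_def by (intro harris_prod uncovered_antimono) auto
  also have "\<dots> \<le> uncov d p N"
    unfolding uncov_bexp[OF order.refl, of d p N]
  proof (rule bexp_mono[OF assms(1,2)])
    fix S
    show "(\<Prod>J\<in>\<J>. F J S) \<le> of_bool (\<not> covered d S ?R ?e)"
    proof (cases "covered d S ?R ?e")
      case True
      then obtain W where W: "W \<subseteq> ?R" "finite W" "card W = d" "W \<inter> ?e = {}" "[W \<union> ?e]\<^bsup>2\<^esup> - {?e} \<subseteq> S"
        by (auto simp: covered_def)
      define J where "J = (\<lambda>x. (x - 2) div h) ` W"
      have "J \<subseteq> {..<b}"
      proof
        fix j assume "j \<in> J"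
        then obtain x where x: "x \<in> W" "j = (x - 2) div h" by (auto simp: J_def)
        have "x - 2 < b * h" using x(1) W(1) assms(3) by fastforce
        thus "j \<in> {..<b}" using x(2) by (simp add: less_mult_imp_div_less)
      qed
      moreover have "card J \<le> d" unfolding J_def using W(2,3) card_image_le by blast
      ultimately have "J \<in> \<J>" by (simp add: \<J>_def)
      moreover have "W \<subseteq> (\<Union>j\<in>J. R j)"
      proof
        fix x assume x: "x \<in> W"
        hence "x \<in> R ((x - 2) div h)" using W(1) unfolding R_def by blast
        thus "x \<in> (\<Union>j\<in>J. R j)" using x unfolding J_def by blast
      qed
      hence "covered d S (\<Union>j\<in>J. R j) ?e" using W unfolding covered_def by blast
      hence "F J S = 0" by (simp add: F_def)
      ultimately have "(\<Prod>J\<in>\<J>. F J S) = 0" using fin by (intro prod_zero) auto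
      thus ?thesis by simp
    qed (simp add: F_def prod_le_1)
  qed
  finally show ?thesis .
qed

subsection \<open>Concentration of a conditional uncovered probability\<close>

text \<open>All edges at \<open>w\<close> are averaged out. An edge of \<open>A\<close> can then be pivotal only if the edge from one
  of its ends to \<open>w\<close> is present, which bounds its influence by \<open>p\<close>, while each configuration has
  boundedly many present pivotal edges. The Efron--Stein inequality does the rest.\<close>

lemma variance_cond_uncovered:
  fixes d :: nat
  assumes fin: "finite A" "finite B" "A \<inter> B = {}" and p: "0 \<le> p" "p \<le> 1"
    and R: "finite R" "R \<inter> q = {}" "card q = 2" "w \<in> q" "w \<notin> \<Union>A"
    and A: "\<And>e. e \<in> A \<Longrightarrow> card e = 2"
    and AB: "[R \<union> q]\<^bsup>2\<^esup> - {q} \<subseteq> A \<union> B"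
  defines "g \<equiv> \<lambda>Q. bexp p B (\<lambda>T. of_bool (\<not> covered d (Q \<union> T) R q))"
  shows "bexp p A (\<lambda>Q. (g Q)\<^sup>2) - (bexp p A g)\<^sup>2 \<le> real (d + 2 choose 2) * p"
    and "bexp p A g = uncov d p (card R)"
proof -
  have finq: "finite q" using R(3) by (rule finite_card2)
  have "bexp p A g = bexp p (A \<union> B) (\<lambda>S. of_bool (\<not> covered d S R q))"
    unfolding g_def bexp_Un[OF fin] ..
  also have "\<dots> = uncov d p (card R)"
    using fin AB R by (intro bexp_uncovered_eq) auto
  finally show "bexp p A g = uncov d p (card R)" .
  define piv where "piv e S \<longleftrightarrow> covered d (insert e S) R q \<and> \<not> covered d (S - {e}) R q" for e S
  define D where "D e Q = bexp p B (\<lambda>T. of_bool (piv e (Q \<union> T)))" for e Q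
  have pivD: "\<exists>W\<subseteq>R. finite W \<and> card W = d \<and> W \<inter> q = {} \<and> [W \<union> q]\<^bsup>2\<^esup> - {q} \<subseteq> insert e S \<and> e \<in> [W \<union> q]\<^bsup>2\<^esup>"
    if "piv e S" for e S
  proof -
    have "covered d (insert e S) R q" using that by (simp add: piv_def)
    then obtain W where W: "W \<subseteq> R" "finite W" "card W = d" "W \<inter> q = {}" "[W \<union> q]\<^bsup>2\<^esup> - {q} \<subseteq> insert e S"
      unfolding covered_def by blast
    have "e \<in> [W \<union> q]\<^bsup>2\<^esup>"
    proof (rule ccontr)
      assume "e \<notin> [W \<union> q]\<^bsup>2\<^esup>"
      hence "[W \<union> q]\<^bsup>2\<^esup> - {q} \<subseteq> S - {e}" using W(5) by blast
      hence "covered d (S - {e}) R q" using W unfolding covered_def by blast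
      thus False using that by (simp add: piv_def)
    qed
    thus ?thesis using W by (intro exI[of _ W] conjI)
  qed
  have gD: "g (insert e Q) - g (Q - {e}) = - D e Q" if "e \<in> A" "Q \<subseteq> A" for e Q
  proof -
    have "g (Q - {e}) - g (insert e Q) = D e Q"
      unfolding g_def D_def bexp_diff[symmetric]
    proof (rule bexp_cong[OF HOL.refl])
      fix T assume "T \<subseteq> B"
      hence 1: "Q - {e} \<union> T = (Q \<union> T) - {e}" "insert e Q \<union> T = insert e (Q \<union> T)" using that fin(3) by auto
      have "covered d (Q \<union> T - {e}) R q \<Longrightarrow> covered d (insert e (Q \<union> T)) R q"
        by (erule covered_mono) auto
      thus "of_bool (\<not> covered d (Q - {e} \<union> T) R q) - of_bool (\<not> covered d (insert e Q \<union> T) R q)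
          = (of_bool (piv e (Q \<union> T)) :: real)"
        unfolding 1 piv_def by auto
    qed
    thus ?thesis by simp
  qed
  have D0: "0 \<le> D e Q" for e Q unfolding D_def using p by (intro bexp_nonneg) auto
  have Dp: "D e Q \<le> p" if e: "e \<in> A" and Q: "Q \<subseteq> A" for e Q
  proof (cases "e \<inter> R = {}")
    case True
    \<comment> \<open>With no end in \<open>R\<close>, a pivotal \<open>e\<close> would have to lie
      inside \<open>q\<close> and avoid \<open>w\<close>, but then it has at most one
      vertex.\<close>
    have "\<not> piv e S" for S
    proof
      assume "piv e S"
      from pivD[OF this] obtain W where W: "W \<subseteq> R" "e \<in> [W \<union> q]\<^bsup>2\<^esup>"
        by (elim exE conjE)
      have "e \<subseteq> W \<union> q" using W(2) by (simp add: nsets_def)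
      moreover have "e \<inter> W = {}" using True W(1) by blast
      moreover have "w \<notin> e" using e R(5) by blast
      ultimately have "e \<subseteq> q - {w}" by blast
      hence "card e \<le> card (q - {w})" using finq by (intro card_mono) auto
      thus False using A[OF e] R(3,4) finq by simp
    qed
    thus ?thesis unfolding D_def using p fin by simp
  next
    case False
    then obtain x where x: "x \<in> e" "x \<in> R" by blast
    have xw: "{x, w} \<in> [R \<union> q]\<^bsup>2\<^esup> - {q}" "{x, w} \<notin> A"
    proof -
      have "x \<noteq> w" "x \<notin> q" using x R(2,4) by auto
      hence "{x, w} \<in> [R \<union> q]\<^bsup>2\<^esup>" "{x, w} \<noteq> q" using x R(4) by (auto simp: nsets_def)
      thus "{x, w} \<in> [R \<union> q]\<^bsup>2\<^esup> - {q}" by simp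
      show "{x, w} \<notin> A" using R(5) by auto
    qed
    hence xwB: "{x, w} \<in> B" using subsetD[OF AB] by (metis Un_iff)
    have "D e Q \<le> bexp p B (\<lambda>T. of_bool ({{x, w}} \<subseteq> T))"
      unfolding D_def
    proof (rule bexp_mono[OF p])
      fix T assume "T \<subseteq> B"
      have "{x, w} \<in> T" if "piv e (Q \<union> T)"
      proof -
        from pivD[OF that]
        obtain W where W: "W \<subseteq> R" "W \<inter> q = {}" "[W \<union> q]\<^bsup>2\<^esup> - {q} \<subseteq> insert e (Q \<union> T)" "e \<in> [W \<union> q]\<^bsup>2\<^esup>"
          by (elim exE conjE)
        have "e \<subseteq> W \<union> q" using W(4) by (simp add: nsets_def)
        hence "x \<in> W" using x R(2) by blast
        hence "x \<noteq> w" "x \<notin> q" using W(2) R(4) by auto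
        hence "{x, w} \<in> [W \<union> q]\<^bsup>2\<^esup>" "{x, w} \<noteq> q" using \<open>x \<in> W\<close> R(4) by (auto simp: nsets_def)
        hence "{x, w} \<in> insert e (Q \<union> T)" using subsetD[OF W(3)] by simp
        moreover have "{x, w} \<noteq> e" using R(5) e by auto
        moreover have "{x, w} \<notin> Q" using xw(2) Q by (meson subsetD)
        ultimately show ?thesis by simp
      qed
      thus "of_bool (piv e (Q \<union> T)) \<le> (of_bool ({{x, w}} \<subseteq> T) :: real)" by auto
    qed
    also have "\<dots> = p" using bexp_all_present[of B "{{x, w}}" p] fin xwB by simp
    finally show ?thesis .
  qed
  \<comment> \<open>\<open>D e\<close> does not depend on whether \<open>e\<close> is present, so
    weighting by presence costs exactly a factor \<open>p\<close>. This turns the sum of influences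
    into a count of present pivotal edges.\<close>
  have present: "p * bexp p A (D e) = bexp p A (\<lambda>Q. of_bool (e \<in> Q) * D e Q)" if e: "e \<in> A" for e
  proof -
    have Ae: "A = insert e (A - {e})" using e by auto
    have Deq: "D e (insert e Q) = D e Q" if "Q \<subseteq> A - {e}" for Q
    proof -
      have "piv e (insert e Q \<union> T) \<longleftrightarrow> piv e (Q \<union> T)" if "T \<subseteq> B" for T
      proof -
        have "insert e (insert e Q \<union> T) = insert e (Q \<union> T)" "insert e Q \<union> T - {e} = Q \<union> T - {e}" by auto
        thus ?thesis by (simp add: piv_def)
      qed
      thus ?thesis unfolding D_def by (intro bexp_cong) auto
    qed
    have "bexp p A (D e) = bexp p (A - {e}) (D e)"
    proof -
      have "bexp p A (D e) = p * bexp p (A - {e}) (\<lambda>Q. D e (insert e Q)) + (1 - p) * bexp p (A - {e}) (D e)"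
        using fin by (subst Ae, subst bexp_insert) auto
      also have "bexp p (A - {e}) (\<lambda>Q. D e (insert e Q)) = bexp p (A - {e}) (D e)"
        using Deq by (intro bexp_cong) auto
      finally show ?thesis by (simp add: algebra_simps)
    qed
    moreover have "bexp p A (\<lambda>Q. of_bool (e \<in> Q) * D e Q) = p * bexp p (A - {e}) (D e)"
    proof -
      have "bexp p A (\<lambda>Q. of_bool (e \<in> Q) * D e Q) = p * bexp p (A - {e}) (\<lambda>Q. D e (insert e Q))
          + (1 - p) * bexp p (A - {e}) (\<lambda>Q. of_bool (e \<in> Q) * D e Q)"
        using fin by (subst Ae, subst bexp_insert) auto
      also have "bexp p (A - {e}) (\<lambda>Q. D e (insert e Q)) = bexp p (A - {e}) (D e)"
        using Deq by (intro bexp_cong) auto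
      also have "bexp p (A - {e}) (\<lambda>Q. of_bool (e \<in> Q) * D e Q) = bexp p (A - {e}) (\<lambda>Q. 0)"
        by (intro bexp_cong) auto
      finally show ?thesis using fin by simp
    qed
    ultimately show ?thesis by simp
  qed
  \<comment> \<open>Removing a present pivotal edge destroys every covering clique, so all such
    edges lie in any one of them.\<close>
  have count: "(\<Sum>e\<in>A. of_bool (e \<in> Q) * of_bool (piv e (Q \<union> T))) \<le> real (d + 2 choose 2)" for Q T
  proof (cases "covered d (Q \<union> T) R q")
    case False
    have "\<not> (e \<in> Q \<and> piv e (Q \<union> T))" for e
      using False by (auto simp: piv_def insert_absorb)
    thus ?thesis by (subst sum.neutral) auto
  next
    case True
    then obtain W where W: "W \<subseteq> R" "finite W" "card W = d" "W \<inter> q = {}" "[W \<union> q]\<^bsup>2\<^esup> - {q} \<subseteq> Q \<union> T"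
      by (auto simp: covered_def)
    have "(\<Sum>e\<in>A. of_bool (e \<in> Q) * of_bool (piv e (Q \<union> T))) = (\<Sum>e\<in>{e\<in>A. e \<in> Q \<and> piv e (Q \<union> T)}. 1::real)"
      using fin by (intro sum.mono_neutral_cong_right) auto
    also have "\<dots> = card {e\<in>A. e \<in> Q \<and> piv e (Q \<union> T)}" by simp
    also have "\<dots> \<le> real (card ([W \<union> q]\<^bsup>2\<^esup>))"
    proof (intro of_nat_mono card_mono)
      show "{e\<in>A. e \<in> Q \<and> piv e (Q \<union> T)} \<subseteq> [W \<union> q]\<^bsup>2\<^esup>"
      proof (safe, rule ccontr)
        fix e assume e: "piv e (Q \<union> T)" "e \<notin> [W \<union> q]\<^bsup>2\<^esup>"
        hence "[W \<union> q]\<^bsup>2\<^esup> - {q} \<subseteq> Q \<union> T - {e}" using W(5) by blast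
        hence "covered d (Q \<union> T - {e}) R q" using W unfolding covered_def by blast
        thus False using e(1) by (simp add: piv_def)
      qed
    qed (use W finq in auto)
    also have "card ([W \<union> q]\<^bsup>2\<^esup>) = (d + 2 choose 2)"
      using W finq R(3) by (subst card_nsets2) (auto simp: card_Un_disjoint)
    finally show ?thesis .
  qed
  have "bexp p A (\<lambda>Q. (g Q)\<^sup>2) - (bexp p A g)\<^sup>2
      \<le> p * (1 - p) * (\<Sum>e\<in>A. bexp p A (\<lambda>Q. (g (insert e Q) - g (Q - {e}))\<^sup>2))"
    by (rule efron_stein) (use fin p in auto)
  also have "(\<Sum>e\<in>A. bexp p A (\<lambda>Q. (g (insert e Q) - g (Q - {e}))\<^sup>2)) \<le> (\<Sum>e\<in>A. p * bexp p A (D e))"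
  proof (rule sum_mono)
    fix e assume e: "e \<in> A"
    have "bexp p A (\<lambda>Q. (g (insert e Q) - g (Q - {e}))\<^sup>2) \<le> bexp p A (\<lambda>Q. p * D e Q)"
    proof (rule bexp_mono[OF p])
      fix Q assume Q: "Q \<subseteq> A"
      have "(g (insert e Q) - g (Q - {e}))\<^sup>2 = D e Q * D e Q"
        unfolding gD[OF e Q] by (simp add: power2_eq_square)
      also have "\<dots> \<le> p * D e Q" using Dp[OF e Q] D0 by (intro mult_right_mono) auto
      finally show "(g (insert e Q) - g (Q - {e}))\<^sup>2 \<le> p * D e Q" .
    qed
    thus "bexp p A (\<lambda>Q. (g (insert e Q) - g (Q - {e}))\<^sup>2) \<le> p * bexp p A (D e)" by (simp add: bexp_cmult)
  qed
  also have "(\<Sum>e\<in>A. p * bexp p A (D e)) = bexp p A (\<lambda>Q. \<Sum>e\<in>A. of_bool (e \<in> Q) * D e Q)"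
    unfolding bexp_sum using present by (intro sum.cong) auto
  also have "\<dots> = bexp p A (\<lambda>Q. bexp p B (\<lambda>T. \<Sum>e\<in>A. of_bool (e \<in> Q) * of_bool (piv e (Q \<union> T))))"
    unfolding D_def bexp_sum bexp_cmult ..
  also have "\<dots> \<le> real (d + 2 choose 2)"
    using count fin p by (intro bexp_le_const) auto
  finally have "bexp p A (\<lambda>Q. (g Q)\<^sup>2) - (bexp p A g)\<^sup>2 \<le> p * (1 - p) * real (d + 2 choose 2)"
    using p by (simp add: mult_left_mono)
  also have "\<dots> \<le> p * 1 * real (d + 2 choose 2)"
    using p by (intro mult_right_mono mult_left_mono) auto
  finally show "bexp p A (\<lambda>Q. (g Q)\<^sup>2) - (bexp p A g)\<^sup>2 \<le> real (d + 2 choose 2) * p"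
    by (simp add: mult_ac)
qed

subsection \<open>Many uncovered edges\<close>

text \<open>The natural-number form of the right-hand side of A_s; the subtraction is exact for
  \<open>d \<le> n\<close>, the range in which it is compared with \<open>wsat_prop\<close>.\<close>

definition wsat_target :: "nat \<Rightarrow> nat \<Rightarrow> nat" where
  "wsat_target d n = (d choose 2) + d * (n - d)"

definition stable_prob :: "nat \<Rightarrow> nat \<Rightarrow> real \<Rightarrow> real" where
  "stable_prob d n p = bexp p ([{1..n}]\<^bsup>2\<^esup>)
     (\<lambda>S. of_bool (wsat ({1..n}, S) (complete_graph (d + 2)) = wsat_target d n))"

lemma wsat_target_le: "d \<le> n \<Longrightarrow> wsat_target d n \<le> d * n"
proof -
  assume "d \<le> n"
  have "(d choose 2) \<le> d * d" using choose_two_add_Suc[of d] by linarith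
  hence "wsat_target d n \<le> d * (d + (n - d))" by (simp add: wsat_target_def distrib_left)
  thus ?thesis using \<open>d \<le> n\<close> by simp
qed

text \<open>Each witness vertex is joined to an end of \<open>e\<close> by a pair of
  \<open>S\<close> and hence lies in \<open>V\<close>. The unrestricted witness set is thereby
  replaced by one for which \<open>uncov\<close> gives the probability.\<close>

lemma covered_UNIV:
  assumes "S \<subseteq> [V]\<^bsup>2\<^esup>" "card e = 2"
  shows "covered d S UNIV e \<longleftrightarrow> covered d S (V - e) e"
proof
  assume "covered d S UNIV e"
  then obtain W where W: "finite W" "card W = d" "W \<inter> e = {}" "[W \<union> e]\<^bsup>2\<^esup> - {e} \<subseteq> S"
    unfolding covered_def by auto
  obtain u where u: "u \<in> e" using assms(2) by fastforce
  have "W \<subseteq> V - e"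
  proof
    fix x assume x: "x \<in> W"
    hence "x \<notin> e" using W(3) by blast
    moreover have "x \<noteq> u" using u calculation by auto
    ultimately have "{x, u} \<in> [W \<union> e]\<^bsup>2\<^esup>" "{x, u} \<noteq> e" using x u by (auto simp: nsets_def)
    hence "{x, u} \<in> [V]\<^bsup>2\<^esup>" using W(4) assms(1) by (meson DiffI singletonD subsetD)
    thus "x \<in> V - e" using \<open>x \<notin> e\<close> by (simp add: nsets_def)
  qed
  thus "covered d S (V - e) e" using W unfolding covered_def by (intro exI[of _ W] conjI)
qed (auto elim: covered_mono)

definition uncovered_edges :: "nat \<Rightarrow> 'a set \<Rightarrow> 'a set set \<Rightarrow> real" where
  "uncovered_edges d V S = (\<Sum>e\<in>[V]\<^bsup>2\<^esup>. of_bool (e \<in> S) * of_bool (\<not> covered d S (V - e) e))"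

lemma uncovered_edges_le_wsat:
  assumes "finite V" "S \<subseteq> [V]\<^bsup>2\<^esup>" "d \<ge> 1"
  shows "uncovered_edges d V S \<le> wsat (V, S) (complete_graph (d + 2))"
proof -
  obtain H where H: "percolates d H S" "card H = wsat (V, S) (complete_graph (d + 2))"
    using wsat_attained[OF assms] by blast
  have finH: "finite H"
    using percolates_subset[OF H(1)] assms(1,2) finite_subset finite_nsets2 by metis
  have "uncovered_edges d V S = (\<Sum>e\<in>{e \<in> [V]\<^bsup>2\<^esup>. e \<in> S \<and> \<not> covered d S (V - e) e}. 1)"
    unfolding uncovered_edges_def using assms(1) by (intro sum.mono_neutral_cong_right) auto
  also have "\<dots> = card {e \<in> [V]\<^bsup>2\<^esup>. e \<in> S \<and> \<not> covered d S (V - e) e}" by simp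
  also have "\<dots> \<le> real (card H)"
  proof (intro of_nat_mono card_mono finH)
    show "{e \<in> [V]\<^bsup>2\<^esup>. e \<in> S \<and> \<not> covered d S (V - e) e} \<subseteq> H"
      using uncovered_mem_generators[OF H(1)] covered_UNIV[OF assms(2)] by (auto simp: nsets_def)
  qed
  finally show ?thesis using H(2) by simp
qed

text \<open>Presence of \<open>e\<close> is independent of its coverage, for which the other
  \<open>card V - 2\<close> vertices are available.\<close>

lemma bexp_uncovered_edge:
  assumes "finite V" "e \<in> [V]\<^bsup>2\<^esup>"
  shows "bexp p ([V]\<^bsup>2\<^esup>) (\<lambda>S. of_bool (e \<in> S) * of_bool (\<not> covered d S (V - e) e)) = p * uncov d p (card V - 2)"
proof -
  let ?E = "[V]\<^bsup>2\<^esup>"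
  have E: "?E = insert e (?E - {e})" using assms(2) by (rule insert_Diff[symmetric])
  have e: "e \<subseteq> V" "card e = 2" "finite e" using assms(2) by (auto simp: nsets_def)
  have "bexp p ?E (\<lambda>S. of_bool (e \<in> S) * of_bool (\<not> covered d S (V - e) e)) =
      p * bexp p (?E - {e}) (\<lambda>S. of_bool (\<not> covered d (insert e S) (V - e) e))
      + (1 - p) * bexp p (?E - {e}) (\<lambda>S. of_bool (e \<in> S) * of_bool (\<not> covered d S (V - e) e))"
    using assms(1) by (subst E, subst bexp_insert) auto
  also have "bexp p (?E - {e}) (\<lambda>S. of_bool (e \<in> S) * of_bool (\<not> covered d S (V - e) e))
      = bexp p (?E - {e}) (\<lambda>S. 0)"
    by (intro bexp_cong) auto
  also have "bexp p (?E - {e}) (\<lambda>S. of_bool (\<not> covered d (insert e S) (V - e) e))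
      = bexp p (?E - {e}) (\<lambda>S. of_bool (\<not> covered d S (V - e) e))"
  proof (rule bexp_cong[OF HOL.refl])
    fix S
    have "covered d (insert e S) (V - e) e \<longleftrightarrow> covered d S (V - e) e"
      by (auto elim: covered_mono)
    thus "of_bool (\<not> covered d (insert e S) (V - e) e) = (of_bool (\<not> covered d S (V - e) e) :: real)" by simp
  qed
  also have "\<dots> = uncov d p (card (V - e))"
    using assms(1) e by (intro bexp_uncovered_eq) (auto simp: Un_absorb2)
  finally show ?thesis using assms(1) e by (simp add: card_Diff_subset)
qed

text \<open>Witnesses are restricted to \<open>W\<close>, the \<open>card V - 4\<close> vertices
  outside both edges. Given the pairs inside \<open>W\<close>, the two events read disjoint sets of
  pairs, so their joint probability is the expectation of a product of two conditional
  probabilities. The inequality of arithmetic and geometric means reduces it to second moments, and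
  these are controlled by the variance bound.\<close>

lemma bexp_two_disjoint_uncovered_edges:
  assumes V: "finite V" and ef: "e \<in> [V]\<^bsup>2\<^esup>" "f \<in> [V]\<^bsup>2\<^esup>" "e \<inter> f = {}" and p: "0 \<le> p" "p \<le> 1"
  shows "bexp p ([V]\<^bsup>2\<^esup>) (\<lambda>S. (of_bool (e \<in> S) * of_bool (\<not> covered d S (V - e) e)) *
      (of_bool (f \<in> S) * of_bool (\<not> covered d S (V - f) f)))
    \<le> p\<^sup>2 * ((uncov d p (card V - 4))\<^sup>2 + real (d + 2 choose 2) * p)"
proof -
  let ?E = "[V]\<^bsup>2\<^esup>"
  define W where "W = V - (e \<union> f)"
  have e: "e \<subseteq> V" "card e = 2" "finite e" and f: "f \<subseteq> V" "card f = 2" "finite f"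
    using ef by (auto simp: nsets_def)
  have finW: "finite W" and cardW: "card W = card V - 4"
    using V e f ef(3) by (auto simp: W_def card_Diff_subset card_Un_disjoint)
  have "e \<noteq> f" using ef(3) e(2) by auto
  define A where "A = [W]\<^bsup>2\<^esup>"
  define B where "B q = [W \<union> q]\<^bsup>2\<^esup> - {q} - [W]\<^bsup>2\<^esup>" for q
  define F where "F q S = (of_bool (\<not> covered d S W q) :: real)" for q S
  define G where "G = A \<union> (\<Union>q\<in>{e, f}. B q)"
  have Wq: "W \<inter> q = {}" if "q \<in> {e, f}" for q using that by (auto simp: W_def)
  have AB: "[W \<union> q]\<^bsup>2\<^esup> - {q} = A \<union> B q" if "q \<in> {e, f}" for q
  proof -
    have "[W]\<^bsup>2\<^esup> \<subseteq> [W \<union> q]\<^bsup>2\<^esup>" by (intro nsets2_mono) auto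
    moreover have "q \<notin> [W]\<^bsup>2\<^esup>"
    proof
      assume "q \<in> [W]\<^bsup>2\<^esup>"
      hence "q = {}" using Wq[OF that] by (auto simp: nsets_def)
      thus False using that e(2) f(2) by auto
    qed
    ultimately show ?thesis unfolding A_def B_def by blast
  qed
  have finG: "finite A" "finite (B e)" "finite (B f)" using finW e f by (auto simp: A_def B_def)
  have efG: "e \<notin> G" "f \<notin> G"
  proof -
    have "x \<notin> [W \<union> y]\<^bsup>2\<^esup>" if "{x, y} = {e, f}" for x y
    proof
      assume "x \<in> [W \<union> y]\<^bsup>2\<^esup>"
      hence "x \<subseteq> W \<union> y" "card x = 2" by (auto simp: nsets_def)
      moreover have "x \<inter> (W \<union> y) = {}" using that ef(3) by (auto simp: W_def doubleton_eq_iff)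
      ultimately show False by (metis Int_absorb2 card.empty zero_neq_numeral)
    qed
    hence *: "e \<notin> [W \<union> f]\<^bsup>2\<^esup>" "f \<notin> [W \<union> e]\<^bsup>2\<^esup>" by auto
    have "[W]\<^bsup>2\<^esup> \<subseteq> [W \<union> f]\<^bsup>2\<^esup>" "[W]\<^bsup>2\<^esup> \<subseteq> [W \<union> e]\<^bsup>2\<^esup>" by (intro nsets2_mono; auto)+
    thus "e \<notin> G" "f \<notin> G" using * by (auto simp: G_def A_def B_def)
  qed
  have sub: "{e, f} \<union> G \<subseteq> ?E"
  proof -
    have "[W \<union> e]\<^bsup>2\<^esup> \<subseteq> ?E" "[W \<union> f]\<^bsup>2\<^esup> \<subseteq> ?E" "[W]\<^bsup>2\<^esup> \<subseteq> ?E"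
      using e f by (intro nsets2_mono; auto simp: W_def)+
    thus ?thesis using ef by (auto simp: G_def A_def B_def)
  qed
  have FG: "F q (S \<inter> X) = F q S" if "q \<in> {e, f}" "A \<union> B q \<subseteq> X" for q S X
    using covered_restrict[of W q X d S] AB[OF that(1)] that(2) by (simp add: F_def)
  have "bexp p ?E (\<lambda>S. (of_bool (e \<in> S) * of_bool (\<not> covered d S (V - e) e)) *
      (of_bool (f \<in> S) * of_bool (\<not> covered d S (V - f) f)))
     \<le> bexp p ?E (\<lambda>S. of_bool ({e, f} \<subseteq> S) * (\<Prod>q\<in>{e, f}. F q S))"
  proof (rule bexp_mono[OF p])
    fix S
    have "covered d S W e \<Longrightarrow> covered d S (V - e) e" "covered d S W f \<Longrightarrow> covered d S (V - f) f"
      by (erule covered_mono; auto simp: W_def)+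
    thus "of_bool (e \<in> S) * of_bool (\<not> covered d S (V - e) e) *
      (of_bool (f \<in> S) * of_bool (\<not> covered d S (V - f) f)) \<le> of_bool ({e, f} \<subseteq> S) * (\<Prod>q\<in>{e, f}. F q S)"
      using \<open>e \<noteq> f\<close> by (auto simp: F_def)
  qed
  also have "\<dots> = bexp p ({e, f} \<union> G) (\<lambda>S. of_bool ({e, f} \<subseteq> S) * (\<Prod>q\<in>{e, f}. F q S))"
  proof (rule bexp_restrict[OF _ sub])
    fix S
    have "F q (S \<inter> ({e, f} \<union> G)) = F q S" if "q \<in> {e, f}" for q
      using that by (intro FG) (auto simp: G_def)
    thus "of_bool ({e, f} \<subseteq> S) * (\<Prod>q\<in>{e, f}. F q S)
        = of_bool ({e, f} \<subseteq> S \<inter> ({e, f} \<union> G)) * (\<Prod>q\<in>{e, f}. F q (S \<inter> ({e, f} \<union> G)))"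
      by simp
  qed (use V in simp)
  also have "\<dots> = bexp p {e, f} (\<lambda>S. bexp p G (\<lambda>T. of_bool ({e, f} \<subseteq> S) * (\<Prod>q\<in>{e, f}. F q T)))"
  proof (subst bexp_Un)
    show "bexp p {e, f} (\<lambda>S. bexp p G (\<lambda>T. of_bool ({e, f} \<subseteq> S \<union> T) * (\<Prod>q\<in>{e, f}. F q (S \<union> T)))) =
        bexp p {e, f} (\<lambda>S. bexp p G (\<lambda>T. of_bool ({e, f} \<subseteq> S) * (\<Prod>q\<in>{e, f}. F q T)))"
    proof (intro bexp_cong HOL.refl)
      fix S T assume ST: "S \<subseteq> {e, f}" "T \<subseteq> G"
      have "F q (S \<union> T) = F q T" if q: "q \<in> {e, f}" for q
      proof -
        have "(S \<union> T) \<inter> G = T" using ST efG by auto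
        moreover have "A \<union> B q \<subseteq> G" using q by (auto simp: G_def)
        ultimately show ?thesis using FG[OF q, of G "S \<union> T"] by metis
      qed
      moreover have "{e, f} \<subseteq> S \<union> T \<longleftrightarrow> {e, f} \<subseteq> S" using ST efG by auto
      ultimately show "of_bool ({e, f} \<subseteq> S \<union> T) * (\<Prod>q\<in>{e, f}. F q (S \<union> T))
          = of_bool ({e, f} \<subseteq> S) * (\<Prod>q\<in>{e, f}. F q T)" by simp
    qed
  qed (use finG efG in \<open>auto simp: G_def\<close>)
  also have "\<dots> = p\<^sup>2 * bexp p G (\<lambda>T. \<Prod>q\<in>{e, f}. F q T)"
    using bexp_all_present[of "{e, f}" "{e, f}" p] \<open>e \<noteq> f\<close> by (simp add: bexp_cmult bexp_multc power2_eq_square)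
  also have "bexp p G (\<lambda>T. \<Prod>q\<in>{e, f}. F q T) = bexp p A (\<lambda>Q. \<Prod>q\<in>{e, f}. bexp p (B q) (\<lambda>T. F q (Q \<union> T)))"
    unfolding G_def
  proof (rule bexp_prod_common)
    show "disjoint_family_on B {e, f}"
    proof -
      have "B e \<inter> B f = {}"
      proof -
        have "x \<in> [W]\<^bsup>2\<^esup>" if "x \<in> [W \<union> e]\<^bsup>2\<^esup>" "x \<in> [W \<union> f]\<^bsup>2\<^esup>" for x
          using that ef(3) by (auto simp: nsets_def)
        thus ?thesis by (auto simp: B_def)
      qed
      thus ?thesis by (auto simp: disjoint_family_on_def)
    qed
    show "F q S = F q (S \<inter> (A \<union> B q))" if "q \<in> {e, f}" for q S
      using FG[OF that, of "A \<union> B q" S] by simp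
  qed (use finG in \<open>auto simp: A_def B_def\<close>)
  also have "\<dots> \<le> (uncov d p (card V - 4))\<^sup>2 + real (d + 2 choose 2) * p"
  proof -
    define g where "g q Q = bexp p (B q) (\<lambda>T. F q (Q \<union> T))" for q Q
    have var: "bexp p A (\<lambda>Q. (g q Q)\<^sup>2) \<le> (uncov d p (card V - 4))\<^sup>2 + real (d + 2 choose 2) * p"
      if q: "q \<in> {e, f}" for q
    proof -
      obtain w where w: "w \<in> q" using q e(2) f(2) by fastforce
      have 1: "finite A" "finite (B q)" "A \<inter> B q = {}" using finG q by (auto simp: A_def B_def)
      have 2: "w \<notin> \<Union>A" using w Wq[OF q] by (auto simp: A_def nsets_def)
      have 3: "card q = 2" using q e f by auto
      have 4: "card e = 2" if "e \<in> A" for e using that by (auto simp: A_def nsets_def)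
      note var = variance_cond_uncovered[OF 1 p finW Wq[OF q] 3 w 2 4 equalityD1[OF AB[OF q]], of d]
      show ?thesis using var unfolding g_def F_def cardW by simp
    qed
    have "bexp p A (\<lambda>Q. \<Prod>q\<in>{e, f}. g q Q) \<le> bexp p A (\<lambda>Q. (1/2) * (g e Q)\<^sup>2 + (1/2) * (g f Q)\<^sup>2)"
    proof (rule bexp_mono[OF p])
      fix Q
      show "(\<Prod>q\<in>{e, f}. g q Q) \<le> (1/2) * (g e Q)\<^sup>2 + (1/2) * (g f Q)\<^sup>2"
        using \<open>e \<noteq> f\<close> sum_squares_bound[of "g e Q" "g f Q"] by simp
    qed
    also have "\<dots> = (1/2) * bexp p A (\<lambda>Q. (g e Q)\<^sup>2) + (1/2) * bexp p A (\<lambda>Q. (g f Q)\<^sup>2)"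
      unfolding bexp_add bexp_cmult ..
    finally show ?thesis using var[of e] var[of f] by (simp add: g_def)
  qed
  finally show ?thesis using p by (simp add: mult_left_mono)
qed

lemma uncovered_edges_mean:
  assumes "finite V"
  shows "bexp p ([V]\<^bsup>2\<^esup>) (uncovered_edges d V) = real (card V choose 2) * p * uncov d p (card V - 2)"
  unfolding uncovered_edges_def bexp_sum using bexp_uncovered_edge[OF assms] 
  by (simp add: card_nsets2[OF assms])

text \<open>Pairs of edges are sorted by intersection: an edge with itself contributes at most
  \<open>p\<close>, each of the at most \<open>2 * card V\<close> other edges meeting it at most
  \<open>p\<^sup>2\<close>, and a disjoint edge the bound of the preceding lemmas.\<close>

lemma uncovered_edges_second_moment:
  assumes V: "finite V" and p: "0 \<le> p" "p \<le> 1"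
  shows "bexp p ([V]\<^bsup>2\<^esup>) (\<lambda>S. (uncovered_edges d V S)\<^sup>2) \<le>
    real (card V choose 2) * (p + real (2 * card V) * p\<^sup>2 +
      real (card V choose 2) * (p\<^sup>2 * ((uncov d p (card V - 4))\<^sup>2 + real (d + 2 choose 2) * p)))"
proof -
  let ?E = "[V]\<^bsup>2\<^esup>"
  define I where "I e S = (of_bool (e \<in> S) * of_bool (\<not> covered d S (V - e) e) :: real)" for e S
  define b where "b = p\<^sup>2 * ((uncov d p (card V - 4))\<^sup>2 + real (d + 2 choose 2) * p)"
  have b0: "0 \<le> b" using p by (simp add: b_def)
  have finE: "finite ?E" using V by simp
  have "bexp p ?E (\<lambda>S. (uncovered_edges d V S)\<^sup>2) = (\<Sum>e\<in>?E. \<Sum>f\<in>?E. bexp p ?E (\<lambda>S. I e S * I f S))"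
    unfolding uncovered_edges_def power2_eq_square sum_product bexp_sum I_def ..
  also have "\<dots> \<le> (\<Sum>e\<in>?E. p + real (2 * card V) * p\<^sup>2 + real (card V choose 2) * b)"
  proof (rule sum_mono)
    fix e assume e: "e \<in> ?E"
    hence e': "e \<subseteq> V" "card e = 2" "finite e" by (auto simp: nsets_def)
    have all: "bexp p ?E (\<lambda>S. I e S * I f S) \<le> (if f = e then p else 0) + (if f \<inter> e \<noteq> {} \<and> f \<noteq> e then p\<^sup>2 else 0) + b"
      if f: "f \<in> ?E" for f
    proof -
      have le: "bexp p ?E (\<lambda>S. I e S * I f S) \<le> p ^ card {e, f}"
      proof -
        have "bexp p ?E (\<lambda>S. I e S * I f S) \<le> bexp p ?E (\<lambda>S. of_bool ({e, f} \<subseteq> S))"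
          by (intro bexp_mono p) (auto simp: I_def)
        thus ?thesis using bexp_all_present[OF finE, of "{e, f}" p] e f by simp
      qed
      consider "f = e" | "f \<noteq> e" "f \<inter> e \<noteq> {}" | "f \<inter> e = {}" by blast
      thus ?thesis
      proof cases
        case 3
        hence "e \<inter> f = {}" by blast
        from bexp_two_disjoint_uncovered_edges[OF V e f this p]
        have "bexp p ?E (\<lambda>S. I e S * I f S) \<le> b" by (simp add: I_def b_def)
        moreover have "f \<noteq> e" using 3 e'(2) by auto
        ultimately show ?thesis using 3 by simp
      next
        case 2
        hence "card {e, f} = 2" by simp
        thus ?thesis using 2 le b0 by (simp add: power2_eq_square)
      qed (use le b0 in auto)
    qed
    have "(\<Sum>f\<in>?E. bexp p ?E (\<lambda>S. I e S * I f S)) \<le>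
       (\<Sum>f\<in>?E. (if f = e then p else 0) + (if f \<inter> e \<noteq> {} \<and> f \<noteq> e then p\<^sup>2 else 0) + b)"
      using all by (rule sum_mono)
    also have "\<dots> = p + (\<Sum>f\<in>{f\<in>?E. f \<inter> e \<noteq> {} \<and> f \<noteq> e}. p\<^sup>2) + real (card V choose 2) * b"
      using e finE by (simp add: sum.distrib card_nsets2[OF V] sum.If_cases Int_def)
    also have "(\<Sum>f\<in>{f\<in>?E. f \<inter> e \<noteq> {} \<and> f \<noteq> e}. p\<^sup>2) = real (card {f\<in>?E. f \<inter> e \<noteq> {} \<and> f \<noteq> e}) * p\<^sup>2"
      by simp
    also have "card {f\<in>?E. f \<inter> e \<noteq> {} \<and> f \<noteq> e} \<le> 2 * card V"
    proof -
      have "{f\<in>?E. f \<inter> e \<noteq> {} \<and> f \<noteq> e} \<subseteq> (\<lambda>(x, y). {x, y}) ` (e \<times> V)"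
      proof
        fix f assume "f \<in> {f\<in>?E. f \<inter> e \<noteq> {} \<and> f \<noteq> e}"
        hence "f \<in> ?E" "f \<inter> e \<noteq> {}" by auto
        then obtain x where x: "x \<in> f" "x \<in> e" by blast
        obtain y where "y \<in> V" "f = {x, y}" using \<open>f \<in> ?E\<close> x(1) by (auto simp: nsets2_iff)
        thus "f \<in> (\<lambda>(x, y). {x, y}) ` (e \<times> V)" using x by auto
      qed
      hence "card {f\<in>?E. f \<inter> e \<noteq> {} \<and> f \<noteq> e} \<le> card ((\<lambda>(x, y). {x, y}) ` (e \<times> V))"
        using V e' by (intro card_mono) auto
      also have "\<dots> \<le> card (e \<times> V)" using V e' by (intro card_image_le) auto
      finally show ?thesis using e' by (simp add: card_cartesian_product)
    qed
    hence "real (card {f\<in>?E. f \<inter> e \<noteq> {} \<and> f \<noteq> e}) * p\<^sup>2 \<le> real (2 * card V) * p\<^sup>2"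
      by (intro mult_right_mono of_nat_mono) auto
    finally show "(\<Sum>f\<in>?E. bexp p ?E (\<lambda>S. I e S * I f S)) \<le> p + real (2 * card V) * p\<^sup>2 + real (card V choose 2) * b"
      by simp
  qed
  also have "\<dots> = real (card V choose 2) * (p + real (2 * card V) * p\<^sup>2 + real (card V choose 2) * b)"
    by (simp add: card_nsets2[OF V])
  finally show ?thesis by (simp add: b_def)
qed

text \<open>Chebyshev's inequality at half the mean. The second moment involves \<open>v\<close>,
  which has two witnesses fewer than \<open>u\<close>; since \<open>v\<^sup>2\<close> exceeds
  \<open>u\<^sup>2\<close> by a factor of at most \<open>1 + 8 * p\<close>, the leading terms still
  cancel in the variance.\<close>

lemma few_uncovered_edges_prob:
  assumes V: "finite V" "card V \<ge> 4" and p: "0 < p" "p \<le> 1 / 8" and u: "u = uncov d p (card V - 2)" "u > 0"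
    and M: "M = real (card V choose 2)"
  shows "bexp p ([V]\<^bsup>2\<^esup>) (\<lambda>S. of_bool (uncovered_edges d V S \<le> M * p * u / 2))
    \<le> 4 / u\<^sup>2 * (1 / (M * p) + 2 * real (card V) / M + (real (d + 2 choose 2) + 8) * p)"
proof -
  let ?E = "[V]\<^bsup>2\<^esup>"
  define X where "X = uncovered_edges d V"
  define v where "v = uncov d p (card V - 4)"
  define a where "a = real (d + 2 choose 2)"
  have p': "0 \<le> p" "p \<le> 1" using p by auto
  have M0: "M > 0" using V by (simp add: M)
  have mean: "bexp p ?E X = M * p * u"
    unfolding X_def M u by (rule uncovered_edges_mean[OF V(1)])
  have mu0: "M * p * u > 0" using M0 p u by simp
  \<comment> \<open>Restoring two witnesses costs \<open>(1 - p)\<^sup>2\<close>, hence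
    \<open>(1 - p) ^ 4\<close> after squaring; \<open>p \<le> 1 / 8\<close> gives
    \<open>(1 + 8 * p) * (1 - 4 * p) \<ge> 1\<close>.\<close>
  have v2: "v\<^sup>2 \<le> u\<^sup>2 * (1 + 8 * p)"
  proof -
    have "(1 - p) * v \<le> uncov d p (Suc (card V - 4))" unfolding v_def by (rule uncov_add_vertex[OF p'])
    hence "(1 - p) * ((1 - p) * v) \<le> (1 - p) * uncov d p (Suc (card V - 4))"
      using p by (intro mult_left_mono) auto
    also have "\<dots> \<le> uncov d p (Suc (Suc (card V - 4)))" by (rule uncov_add_vertex[OF p'])
    also have "Suc (Suc (card V - 4)) = card V - 2" using V(2) by simp
    finally have "(1 - p)\<^sup>2 * v \<le> u" by (simp add: u power2_eq_square)
    moreover have "0 \<le> (1 - p)\<^sup>2 * v" using uncov_nonneg[OF p'] by (simp add: v_def)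
    ultimately have "((1 - p)\<^sup>2 * v)\<^sup>2 \<le> u\<^sup>2" by (intro power_mono)
    hence le: "(1 - p) ^ 4 * v\<^sup>2 \<le> u\<^sup>2" by (simp add: power_mult_distrib)
    have "1 - 4 * p \<le> (1 - p) ^ 4" using Bernoulli_inequality[of "-p" 4] p by simp
    hence "(1 - 4 * p) * v\<^sup>2 \<le> (1 - p) ^ 4 * v\<^sup>2" by (intro mult_right_mono) auto
    hence "(1 + 8 * p) * ((1 - 4 * p) * v\<^sup>2) \<le> (1 + 8 * p) * u\<^sup>2"
      using le p by (intro mult_left_mono) auto
    moreover have "1 \<le> (1 + 8 * p) * (1 - 4 * p)"
    proof -
      have "(1 + 8 * p) * (1 - 4 * p) = 1 + 4 * p * (1 - 8 * p)" by (simp add: algebra_simps)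
      moreover have "0 \<le> 4 * p * (1 - 8 * p)" using p by simp
      ultimately show ?thesis by linarith
    qed
    hence "1 * v\<^sup>2 \<le> (1 + 8 * p) * (1 - 4 * p) * v\<^sup>2" by (intro mult_right_mono) auto
    ultimately show ?thesis by (simp add: mult_ac)
  qed
  have "bexp p ?E (\<lambda>S. of_bool (X S \<le> M * p * u / 2)) 
      \<le> bexp p ?E (\<lambda>S. of_bool (\<bar>X S - bexp p ?E X\<bar> \<ge> M * p * u / 2))"
  proof (rule bexp_mono[OF p'])
    fix S
    have "\<bar>X S - M * p * u\<bar> \<ge> M * p * u / 2" if "X S \<le> M * p * u / 2"
      using that by (simp add: abs_if)
    thus "of_bool (X S \<le> M * p * u / 2) \<le> (of_bool (\<bar>X S - bexp p ?E X\<bar> \<ge> M * p * u / 2) :: real)"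
      unfolding mean by auto
  qed
  also have "\<dots> \<le> (bexp p ?E (\<lambda>S. (X S)\<^sup>2) - (bexp p ?E X)\<^sup>2) / (M * p * u / 2)\<^sup>2"
    using V p' mu0 by (intro bexp_chebyshev) auto
  also have "\<dots> \<le> (M * (p + 2 * real (card V) * p\<^sup>2 + M * (p\<^sup>2 * (u\<^sup>2 * (1 + 8 * p) + a * p))) - (M * p * u)\<^sup>2) / (M * p * u / 2)\<^sup>2"
  proof -
    have "bexp p ?E (\<lambda>S. (X S)\<^sup>2) \<le> M * (p + 2 * real (card V) * p\<^sup>2 + M * (p\<^sup>2 * (v\<^sup>2 + a * p)))"
      using uncovered_edges_second_moment[OF V(1) p', of d] by (simp add: X_def M v_def a_def)
    also have "\<dots> \<le> M * (p + 2 * real (card V) * p\<^sup>2 + M * (p\<^sup>2 * (u\<^sup>2 * (1 + 8 * p) + a * p)))"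
      using v2 M0 p by (intro mult_left_mono add_mono) (auto simp: a_def)
    finally show ?thesis unfolding mean by (intro divide_right_mono diff_mono) auto
  qed
  also have "\<dots> = 4 / u\<^sup>2 * (1 / (M * p) + 2 * real (card V) / M + (8 * u\<^sup>2 + a) * p)"
    using M0 p u by (simp add: field_simps power2_eq_square)
  also have "\<dots> \<le> 4 / u\<^sup>2 * (1 / (M * p) + 2 * real (card V) / M + (a + 8) * p)"
  proof -
    have "u\<^sup>2 \<le> 1" using uncov_le_1[OF p'] u by (simp add: power_le_one)
    hence "(8 * u\<^sup>2 + a) * p \<le> (a + 8) * p" using p by (intro mult_right_mono) auto
    thus ?thesis by (intro mult_left_mono add_left_mono) auto
  qed
  finally show ?thesis by (simp add: X_def a_def)
qed

subsection \<open>Sparse random graphs\<close>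

text \<open>The ratio of consecutive point probabilities, cross-multiplied so that it stays
  meaningful when they vanish.\<close>

lemma binomial_point_prob_step:
  assumes "0 \<le> p" "p < 1"
  shows "real (Suc k) * (1 - p) * (real (M choose Suc k) * p ^ Suc k * (1 - p) ^ (M - Suc k))
    = real (M - k) * p * (real (M choose k) * p ^ k * (1 - p) ^ (M - k))"
proof (cases "k < M")
  case True
  hence "M - k = Suc (M - Suc k)" by simp
  hence 1: "(1 - p) ^ (M - k) = (1 - p) * (1 - p) ^ (M - Suc k)" by simp
  obtain m where m: "M = Suc m" using True by (cases M) auto
  have "Suc k * (M choose Suc k) = (M - k) * (M choose k)"
    using binomial_absorb_comp[of M k] Suc_times_binomial[of k m] unfolding m by simp
  hence 2: "real (Suc k) * real (M choose Suc k) = real (M - k) * real (M choose k)"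
    by (metis of_nat_mult)
  have "real (Suc k) * (1 - p) * (real (M choose Suc k) * p ^ Suc k * (1 - p) ^ (M - Suc k))
    = (real (Suc k) * real (M choose Suc k)) * (p * p ^ k * ((1 - p) * (1 - p) ^ (M - Suc k)))"
    by (simp add: mult_ac)
  also have "\<dots> = real (M - k) * p * (real (M choose k) * p ^ k * (1 - p) ^ (M - k))"
    unfolding 1 2 by (simp add: mult_ac)
  finally show ?thesis .
qed (simp add: binomial_eq_0)

text \<open>Near the mean the point probabilities of a binomial distribution vary slowly, hence none of
  them is large.\<close>

lemma card_eq_prob_small:
  assumes E: "finite E" and p: "0 \<le> p" "p \<le> 1 / 2" and k: "k \<ge> 8 * J\<^sup>2 + J"
  shows "real (Suc J) * bexp p E (\<lambda>S. of_bool (card S = k)) \<le> 2"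
proof -
  define M where "M = card E"
  define b where "b i = bexp p E (\<lambda>S. of_bool (card S = i))" for i
  have beq: "b i = real (M choose i) * p ^ i * (1 - p) ^ (M - i)" for i
    unfolding b_def M_def using bexp_card_eq[OF E] .
  have p': "p \<le> 1" "p < 1" using p by auto
  have b0: "0 \<le> b i" for i unfolding b_def using p by (intro bexp_nonneg) auto
  have step: "real (Suc i) * (1 - p) * b (Suc i) = real (M - i) * p * b i" for i
    unfolding beq by (rule binomial_point_prob_step[OF p(1) p'(2)])
  have total: "(\<Sum>i\<in>K. b i) \<le> 1" if "finite K" for K
  proof -
    have "(\<Sum>i\<in>K. b i) = bexp p E (\<lambda>S. \<Sum>i\<in>K. of_bool (card S = i))" by (simp add: b_def bexp_sum)
    also have "\<dots> \<le> 1" using that by (intro bexp_le_const[OF E p(1) p'(1)]) (simp add: of_bool_def)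
    finally show ?thesis .
  qed
  show ?thesis
  \<comment> \<open>Well below the mean the point probabilities increase, so
    \<open>k, ..., k + J\<close> are all at least as likely as \<open>k\<close>. Otherwise each step
    upward from \<open>k - J\<close> to \<open>k\<close> multiplies the probability by at most
    \<open>1 + \<delta>\<close>, so the \<open>J\<close> values before \<open>k\<close> are nearly
    as likely as \<open>k\<close>.\<close>
  proof (cases "real (k + J) \<le> real (M + 1) * p")
    case True
    have mono: "b (k + i) \<le> b (k + Suc i)" if "i < J" for i
    proof -
      have "real (M + 1) * p \<le> real (M + 1) * (1 / 2)" using p by (intro mult_left_mono) auto
      hence "real (k + J) \<le> real (M + 1) * (1 / 2)" using True by linarith
      hence less: "k + i < M" using that by simp
      have "real (Suc (k + i)) * (1 - p) \<le> real (M - (k + i)) * p"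
      proof -
        have "real (Suc (k + i)) \<le> real (M + 1) * p" using True that by simp
        hence "real (k + i) + 1 \<le> real M * p + p" by (simp add: algebra_simps)
        moreover have "real (M - (k + i)) * p = real M * p - real (k + i) * p"
          using less by (simp add: of_nat_diff algebra_simps)
        moreover have "real (Suc (k + i)) * (1 - p) = real (k + i) + 1 - real (k + i) * p - p"
          by (simp add: algebra_simps)
        ultimately show ?thesis by linarith
      qed
      hence "real (Suc (k + i)) * (1 - p) * b (k + i) \<le> real (M - (k + i)) * p * b (k + i)"
        using b0 by (rule mult_right_mono)
      also have "\<dots> = real (Suc (k + i)) * (1 - p) * b (k + Suc i)" using step[of "k + i"] by simp
      finally show ?thesis using p' by (simp add: mult_le_cancel_left_pos)
    qed
    have le: "b k \<le> b (k + i)" if "i \<le> J" for i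
      using that
    proof (induction i)
      case (Suc i)
      thus ?case using mono[of i] by simp
    qed simp
    have "real (Suc J) * b k = (\<Sum>i\<le>J. b k)" by simp
    also have "\<dots> \<le> (\<Sum>i\<le>J. b (k + i))" using le by (intro sum_mono) auto
    also have "\<dots> = (\<Sum>i\<in>(\<lambda>i. k + i) ` {..J}. b i)" by (simp add: sum.reindex)
    also have "\<dots> \<le> 1" by (rule total) simp
    finally show ?thesis by (simp add: b_def)
  next
    case False
    define \<delta> where "\<delta> = 4 * real J / (real k - real J + 1)"
    have kJ: "J \<le> k" using k by simp
    have \<delta>0: "0 \<le> \<delta>" using kJ by (simp add: \<delta>_def)
    have down: "b (Suc i) \<le> (1 + \<delta>) * b i" if i: "k - J \<le> i" "i < k" for i
    proof -
      have "real (M - i) * p \<le> (1 + \<delta>) * (real (Suc i) * (1 - p))"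
      proof (cases "i \<le> M")
        case True
        have "real (M - i) * p = real (M + 1) * p - real (Suc i) * p"
          using True by (simp add: of_nat_diff algebra_simps)
        also have "\<dots> \<le> real (Suc i) * (1 - p) + 2 * real J"
        proof -
          have "real (M + 1) * p \<le> real (k + J)" using False by simp
          moreover have "real k - real J \<le> real i" using i(1) kJ by linarith
          ultimately show ?thesis by (simp add: algebra_simps)
        qed
        also have "2 * real J \<le> \<delta> * (real (Suc i) * (1 - p))"
        proof -
          have pos: "real k - real J + 1 > 0" using kJ by linarith
          have "real k - real J + 1 \<le> real (Suc i)" using i(1) kJ by linarith
          hence "(real k - real J + 1) * (1 / 2) \<le> real (Suc i) * (1 - p)"
            using p pos by (intro mult_mono) auto
          hence "\<delta> * ((real k - real J + 1) * (1 / 2)) \<le> \<delta> * (real (Suc i) * (1 - p))"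
            using \<delta>0 by (rule mult_left_mono)
          thus ?thesis using pos by (simp add: \<delta>_def)
        qed
        finally show ?thesis by (simp add: algebra_simps)
      qed (use \<delta>0 p' in auto)
      hence "real (M - i) * p * b i \<le> (1 + \<delta>) * (real (Suc i) * (1 - p)) * b i"
        using b0 by (rule mult_right_mono)
      hence "real (Suc i) * (1 - p) * b (Suc i) \<le> real (Suc i) * (1 - p) * ((1 + \<delta>) * b i)"
        unfolding step by (simp add: mult_ac)
      thus ?thesis using p' by (simp add: mult_le_cancel_left_pos)
    qed
    have ge: "b k \<le> (1 + \<delta>) ^ i * b (k - i)" if "i \<le> J" for i
      using that
    proof (induction i)
      case (Suc i)
      have "Suc (k - Suc i) = k - i" using Suc.prems kJ by simp
      hence "b (k - i) \<le> (1 + \<delta>) * b (k - Suc i)" using down[of "k - Suc i"] Suc.prems kJ by simp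
      hence "(1 + \<delta>) ^ i * b (k - i) \<le> (1 + \<delta>) ^ i * ((1 + \<delta>) * b (k - Suc i))"
        using \<delta>0 by (intro mult_left_mono) auto
      thus ?case using Suc by (simp add: mult_ac)
    qed simp
    \<comment> \<open>The assumption on \<open>k\<close> is tuned to give
      \<open>J * \<delta> \<le> 1 / 2\<close>.\<close>
    have "(1 + \<delta>) ^ J \<le> 2"
    proof -
      have "8 * real J ^ 2 \<le> real k - real J + 1"
      proof -
        have "real (8 * J\<^sup>2 + J) \<le> real k" using k by (rule of_nat_mono)
        thus ?thesis by simp
      qed
      moreover have "real k - real J + 1 > 0" using kJ by linarith
      ultimately have "real J * \<delta> \<le> 1 / 2" by (simp add: \<delta>_def field_simps power2_eq_square)
      have "(1 + \<delta>) ^ J \<le> exp \<delta> ^ J" using \<delta>0 by (intro power_mono) auto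
      also have "\<dots> = exp (real J * \<delta>)" by (simp add: exp_of_nat_mult)
      also have "\<dots> \<le> exp (1 / 2)" using \<open>real J * \<delta> \<le> 1 / 2\<close> by simp
      also have "\<dots> \<le> 1 + 1 / 2 + (1 / 2)\<^sup>2" by (rule exp_bound) auto
      finally show ?thesis by (simp add: power2_eq_square)
    qed
    hence ge2: "b k \<le> 2 * b (k - i)" if "i \<le> J" for i
    proof -
      have "(1 + \<delta>) ^ i \<le> (1 + \<delta>) ^ J" using that \<delta>0 by (intro power_increasing) auto
      hence "(1 + \<delta>) ^ i * b (k - i) \<le> 2 * b (k - i)"
        using \<open>(1 + \<delta>) ^ J \<le> 2\<close> b0 by (intro mult_right_mono) auto
      thus ?thesis using ge[OF that] by simp
    qed
    have "real (Suc J) * b k = (\<Sum>i\<le>J. b k)" by simp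
    also have "\<dots> \<le> (\<Sum>i\<le>J. 2 * b (k - i))" using ge2 by (intro sum_mono) auto
    also have "\<dots> = 2 * (\<Sum>i\<in>(\<lambda>i. k - i) ` {..J}. b i)"
      using kJ by (subst sum.reindex) (auto simp: inj_on_def sum_distrib_left)
    also have "\<dots> \<le> 2 * 1" by (intro mult_left_mono total) auto
    finally show ?thesis by (simp add: b_def)
  qed
qed

text \<open>The value of wsat lies between the number of uncovered edges and the number of all
  edges, which differ by the number \<open>Z\<close> of covered edges. As \<open>Z\<close> has
  bounded mean, A_s essentially confines the edge count to \<open>T + 1\<close> values, and each
  single value is unlikely.\<close>

lemma stable_prob_sparse:
  assumes d: "d \<ge> 1" and n: "d \<le> n" and p: "0 \<le> p" "p \<le> 1 / 2" "real n * p \<le> C"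
    and T: "T \<ge> 1" and J: "8 * J\<^sup>2 + J \<le> wsat_target d n"
  shows "stable_prob d n p \<le> C ^ (d + 2) / real T + real (Suc T) * (2 / real (Suc J))"
proof -
  let ?V = "{1..n}" and ?E = "[{1..n}]\<^bsup>2\<^esup>"
  define a where "a = (d + 2 choose 2)"
  define N where "N = wsat_target d n"
  define Z where "Z S = real (card S) - uncovered_edges d ?V S" for S
  have p1: "p \<le> 1" using p by simp
  have cardS: "real (card S) = (\<Sum>e\<in>?E. of_bool (e \<in> S))" if "S \<subseteq> ?E" for S
  proof -
    have "(\<Sum>e\<in>?E. of_bool (e \<in> S)) = (\<Sum>e\<in>S. 1 :: real)"
      using that by (intro sum.mono_neutral_cong_right) auto
    thus ?thesis by simp
  qed
  have Z0: "0 \<le> Z S" if "S \<subseteq> ?E" for S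
    unfolding Z_def cardS[OF that] uncovered_edges_def sum_subtractf[symmetric]
    by (intro sum_nonneg) auto
  have "bexp p ?E Z = bexp p ?E (\<lambda>S. \<Sum>e\<in>?E. of_bool ({e} \<subseteq> S)) - bexp p ?E (uncovered_edges d ?V)"
    unfolding bexp_diff[symmetric] Z_def
    by (intro bexp_cong HOL.refl) (simp only: cardS insert_subset empty_subsetI simp_thms)
  also have "bexp p ?E (\<lambda>S. \<Sum>e\<in>?E. of_bool ({e} \<subseteq> S)) = (\<Sum>e\<in>?E. p)"
    unfolding bexp_sum by (intro sum.cong HOL.refl, subst bexp_all_present) auto
  finally have "bexp p ?E Z = real (n choose 2) * p * (1 - uncov d p (n - 2))"
    by (simp add: uncovered_edges_mean card_nsets2 algebra_simps)
  also have "\<dots> \<le> real n ^ 2 * p * (real n ^ d * p ^ (a - 1))"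
  proof (intro mult_mono)
    have "(n choose 2) \<le> n ^ 2"
      by (cases "2 \<le> n") (auto intro: binomial_le_pow simp: binomial_eq_0)
    thus "real (n choose 2) \<le> real n ^ 2" by (metis of_nat_le_iff of_nat_power)
    have "1 - uncov d p (n - 2) \<le> real (n - 2) ^ d * p ^ (a - 1)"
      unfolding a_def by (rule covered_prob_le[OF p(1) p1 d])
    also have "\<dots> \<le> real n ^ d * p ^ (a - 1)"
      using p by (intro mult_right_mono power_mono) auto
    finally show "1 - uncov d p (n - 2) \<le> real n ^ d * p ^ (a - 1)" .
  qed (use p uncov_le_1[OF p(1) p1] in auto)
  also have "\<dots> = real n ^ (d + 2) * p ^ a"
  proof -
    have "a = Suc (a - 1)" by (simp add: a_def zero_less_binomial)
    hence "p ^ a = p * p ^ (a - 1)" by (metis power_Suc)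
    thus ?thesis by (simp add: power_add power2_eq_square mult_ac)
  qed
  \<comment> \<open>For \<open>d \<ge> 1\<close> the complete graph on \<open>d + 2\<close> vertices
    has at least as many edges as vertices, so \<open>p\<close> of order \<open>1 / n\<close> yields
    a bounded expectation.\<close>
  also have "\<dots> \<le> real n ^ (d + 2) * p ^ (d + 2)"
  proof (intro mult_left_mono power_decreasing)
    have "2 * (d + 2) \<le> (d + 2) * (d + 1)" using d by (subst mult.commute) (intro mult_left_mono; simp)
    thus "d + 2 \<le> a" by (simp add: a_def choose_two)
  qed (use p in auto)
  also have "\<dots> = (real n * p) ^ (d + 2)" by (simp add: power_mult_distrib)
  also have "\<dots> \<le> C ^ (d + 2)" using p by (intro power_mono) auto
  finally have EZ: "bexp p ?E Z \<le> C ^ (d + 2)" .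
  have "stable_prob d n p \<le> bexp p ?E (\<lambda>S. of_bool (Z S \<ge> real T) + (\<Sum>k\<in>{N..N + T}. of_bool (card S = k)))"
    unfolding stable_prob_def
  proof (rule bexp_mono[OF p(1) p1])
    fix S assume S: "S \<subseteq> ?E"
    show "of_bool (wsat (?V, S) (complete_graph (d + 2)) = wsat_target d n)
      \<le> of_bool (Z S \<ge> real T) + (\<Sum>k\<in>{N..N + T}. of_bool (card S = k) :: real)"
    proof (cases "wsat (?V, S) (complete_graph (d + 2)) = wsat_target d n \<and> Z S < real T")
      case True
      have "N \<le> card S" using wsat_le[OF _ S d percolates.base] True by (simp add: N_def)
      moreover have "uncovered_edges d ?V S \<le> real N"
        using uncovered_edges_le_wsat[OF _ S d] True by (simp add: N_def)
      hence "real (card S) < real (N + T)" using True by (simp add: Z_def)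
      hence "card S \<le> N + T" by simp
      ultimately have "card S \<in> {N..N + T}" by simp
      hence "(\<Sum>k\<in>{N..N + T}. of_bool (card S = k) :: real) = 1" by (simp add: of_bool_def)
      thus ?thesis by simp
    qed (auto simp: sum_nonneg add_nonneg_nonneg)
  qed
  also have "\<dots> = bexp p ?E (\<lambda>S. of_bool (Z S \<ge> real T)) + (\<Sum>k\<in>{N..N + T}. bexp p ?E (\<lambda>S. of_bool (card S = k)))"
    unfolding bexp_add bexp_sum ..
  also have "\<dots> \<le> C ^ (d + 2) / real T + (\<Sum>k\<in>{N..N + T}. 2 / real (Suc J))"
  proof (intro add_mono sum_mono)
    have "bexp p ?E (\<lambda>S. of_bool (Z S \<ge> real T)) \<le> bexp p ?E Z / real T"
      using T p1 p Z0 by (intro bexp_markov) auto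
    also have "\<dots> \<le> C ^ (d + 2) / real T" using EZ by (intro divide_right_mono) auto
    finally show "bexp p ?E (\<lambda>S. of_bool (Z S \<ge> real T)) \<le> C ^ (d + 2) / real T" .
    fix k assume "k \<in> {N..N + T}"
    hence "8 * J\<^sup>2 + J \<le> k" using J by (simp add: N_def)
    hence "real (Suc J) * bexp p ?E (\<lambda>S. of_bool (card S = k)) \<le> 2"
      by (intro card_eq_prob_small p) auto
    thus "bexp p ?E (\<lambda>S. of_bool (card S = k)) \<le> 2 / real (Suc J)"
      by (simp add: field_simps)
  qed
  also have "\<dots> = C ^ (d + 2) / real T + real (Suc T) * (2 / real (Suc J))" by simp
  finally show ?thesis .
qed

subsection \<open>Instability when many pairs are uncovered\<close>

text \<open>With this exponent, \<open>p \<ge> n powr (- 3 * \<eta> d)\<close> gives \<open>p ^ (d + 2 choose 2) \<ge> n powr (- 1 / 2)\<close>.\<close>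

definition \<eta> :: "nat \<Rightarrow> real" where
  "\<eta> d = 1 / (6 * real (d + 2 choose 2))"

lemma choose_two_ge: "d \<ge> 1 \<Longrightarrow> (d + 2 choose 2) \<ge> 2 * d + 1"
proof -
  assume "d \<ge> 1"
  then obtain c where c: "d = Suc c" by (cases d) auto
  have "2 * (2 * d + 1) \<le> (d + 2) * (d + 1)" by (simp add: c)
  hence "2 * (2 * d + 1) div 2 \<le> (d + 2) * (d + 1) div 2" by (rule div_le_mono)
  thus ?thesis by (simp add: choose_two)
qed

lemma \<eta>_bounds:
  assumes "d \<ge> 1"
  shows "0 < \<eta> d" "\<eta> d \<le> 1 / 18"
proof -
  have "real (d + 2 choose 2) \<ge> 3" using choose_two_ge[OF assms] assms by linarith
  thus "0 < \<eta> d" "\<eta> d \<le> 1 / 18" by (auto simp: \<eta>_def field_simps)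
qed

lemma eventually_le_of_tendsto_0:
  fixes f :: "nat \<Rightarrow> real"
  assumes "f \<longlonglongrightarrow> 0" "\<epsilon> > 0"
  shows "\<forall>\<^sub>F n in sequentially. f n \<le> \<epsilon>"
  using order_tendstoD(2)[OF assms] by (rule eventually_mono) simp

lemma powr_neg_tendsto_0: "c > 0 \<Longrightarrow> (\<lambda>n. real n powr - c) \<longlonglongrightarrow> 0"
  by (rule tendsto_neg_powr) (auto simp: filterlim_real_sequentially)

lemma eventually_powr_ge: "c > 0 \<Longrightarrow> \<forall>\<^sub>F n in sequentially. K \<le> real n powr c"
  by real_asymp

text \<open>Half the mean number of uncovered edges has to reach the target. For
  \<open>p \<le> n powr - (2 / 3)\<close> a first-moment bound gives \<open>u \<ge> 1 / 2\<close>,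
  and the constant 16 makes \<open>M * p\<close> at least \<open>4 * d * n\<close>; for larger
  \<open>p\<close> the product \<open>M * p * u\<close> is of higher order than \<open>n\<close>. In
  the Chebyshev bound the factor \<open>1 / u\<^sup>2\<close> costs
  \<open>n powr (2 * \<eta> d)\<close>, which is outweighed by
  \<open>p \<le> n powr (- 3 * \<eta> d)\<close>.\<close>

lemma unstable_intermediate:
  assumes d: "d \<ge> 1" and \<epsilon>: "\<epsilon> > 0"
  shows "\<forall>\<^sub>F n in sequentially. \<forall>p. 16 * real d / real n \<le> p \<and> p \<le> real n powr (- 3 * \<eta> d) \<and>
    real n powr (- \<eta> d) \<le> uncov d p (n - 2) \<longrightarrow> stable_prob d n p \<le> \<epsilon>"
proof -
  define h where "h = \<eta> d"
  have h: "0 < h" "h \<le> 1 / 18" using \<eta>_bounds[OF d] by (auto simp: h_def)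
  define a where "a = (d + 2 choose 2)"
  have e1: "\<forall>\<^sub>F n in sequentially. 48 * real n powr - (1 - 2 * h) + 4 * (real a + 8) * real n powr - h \<le> \<epsilon>"
  proof (rule eventually_le_of_tendsto_0[OF _ \<epsilon>])
    have "(\<lambda>n. 48 * real n powr - (1 - 2 * h) + 4 * (real a + 8) * real n powr - h) \<longlonglongrightarrow> 48 * 0 + 4 * (real a + 8) * 0"
      using h by (intro tendsto_intros powr_neg_tendsto_0) auto
    thus "(\<lambda>n. 48 * real n powr - (1 - 2 * h) + 4 * (real a + 8) * real n powr - h) \<longlonglongrightarrow> 0" by simp
  qed
  have e2: "\<forall>\<^sub>F n in sequentially. real n powr - (3 * h) \<le> 1 / 8"
    using h by (intro eventually_le_of_tendsto_0 powr_neg_tendsto_0) auto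
  have e3: "\<forall>\<^sub>F n in sequentially. real n powr - (1 / 3) \<le> 1 / 2"
    by (intro eventually_le_of_tendsto_0 powr_neg_tendsto_0) auto
  have e4: "\<forall>\<^sub>F n in sequentially. 8 * real d \<le> real n powr (1 / 3 - h)"
    using h by (intro eventually_powr_ge) auto
  from e1 e2 e3 e4 eventually_ge_at_top[of "d + 4"]
  show ?thesis
  proof eventually_elim
    case (elim n)
    show ?case
    proof (intro allI impI)
      fix p assume asm: "16 * real d / real n \<le> p \<and> p \<le> real n powr (- 3 * \<eta> d) \<and>
        real n powr (- \<eta> d) \<le> uncov d p (n - 2)"
      define u where "u = uncov d p (n - 2)"
      define M where "M = real (n choose 2)"
      let ?E = "[{1..n}]\<^bsup>2\<^esup>"
      have n: "n \<ge> 4" "d \<le> n" "real n > 0" using elim by auto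
      have pl: "16 * real d / real n \<le> p" and pu: "p \<le> real n powr - (3 * h)" and ul: "real n powr - h \<le> u"
        using asm by (auto simp: h_def u_def)
      have "16 * real d / real n > 0" using d n by simp
      hence p0: "p > 0" using pl by linarith
      have p8: "p \<le> 1 / 8" using pu elim by linarith
      hence p1: "p \<le> 1" by simp
      have "0 < real n powr - h" using n by simp
      hence u0: "u > 0" using ul by linarith
      have Mn: "real n ^ 2 / 4 \<le> M"
      proof -
        have "M = real n * (real n - 1) / 2"
        proof -
          have "2 * (n choose 2) = n * (n - 1)" unfolding choose_two
            by (intro dvd_mult_div_cancel) (cases n; simp)
          hence "2 * M = real (n * (n - 1))" unfolding M_def by (metis of_nat_mult of_nat_numeral)
          thus ?thesis using n by (simp add: of_nat_diff)
        qed
        moreover have "real n * (real n / 2) \<le> real n * (real n - 1)"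
          using n by (intro mult_left_mono) auto
        ultimately show ?thesis by (simp add: power2_eq_square)
      qed
      have M0: "M > 0" using Mn n by (meson less_le_trans divide_pos_pos zero_less_power zero_less_numeral)
      have Mp: "4 * real d * real n \<le> M * p"
      proof -
        have "4 * real d * real n = real n ^ 2 / 4 * (16 * real d / real n)"
          using n by (simp add: power2_eq_square)
        also have "\<dots> \<le> M * p" using Mn pl M0 by (intro mult_mono) auto
        finally show ?thesis .
      qed
      have big: "real (wsat_target d n) \<le> M * p * u / 2"
      proof -
        have "2 * real d * real n \<le> M * p * u"
        proof (cases "p \<le> real n powr - (2 / 3)")
          case True
          have "1 - u \<le> real (n - 2) ^ d * p ^ (a - 1)"
            unfolding u_def a_def using p0 p1 d by (intro covered_prob_le) auto
          also have "\<dots> \<le> real n ^ d * p ^ (2 * d)"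
            using p0 p1 choose_two_ge[OF d] by (intro mult_mono power_mono power_decreasing) (auto simp: a_def)
          also have "\<dots> = (real n * p ^ 2) ^ d" by (simp add: power_mult_distrib power_mult)
          also have "\<dots> \<le> (real n powr - (1 / 3)) ^ d"
          proof (intro power_mono)
            have "real n * p ^ 2 \<le> real n * (real n powr - (2 / 3)) ^ 2"
              using True p0 by (intro mult_left_mono power_mono) auto
            also have "\<dots> = real n powr (1 + (- (2 / 3) + - (2 / 3)))"
              using n by (simp only: powr_add powr_one power2_eq_square less_imp_le)
            also have "\<dots> = real n powr - (1 / 3)" by simp
            finally show "real n * p ^ 2 \<le> real n powr - (1 / 3)" .
          qed (use p0 in auto)
          also have "\<dots> \<le> (1 / 2) ^ d" using elim by (intro power_mono) auto
          also have "\<dots> \<le> (1 / 2) ^ 1" using d by (intro power_decreasing) auto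
          finally have "u \<ge> 1 / 2" by simp
          hence "4 * real d * real n * (1 / 2) \<le> M * p * u" using Mp M0 p0 by (intro mult_mono[of _ "M * p"]) auto
          thus ?thesis by simp
        next
          case False
          have "2 * real d * real n = (real n / 4) * (8 * real d)" by simp
          also have "\<dots> \<le> (real n / 4) * real n powr (1 / 3 - h)"
            using elim by (intro mult_left_mono) auto
          also have "\<dots> = (1 / 4) * real n powr (1 + (1 / 3 - h))"
            using n by (simp only: powr_add powr_one less_imp_le mult_ac times_divide_eq_left times_divide_eq_right mult_1)
          also have "1 + (1 / 3 - h) = 2 + - (2 / 3) + - h" by simp
          also have "(1 / 4) * real n powr (2 + - (2 / 3) + - h) = real n ^ 2 / 4 * real n powr - (2 / 3) * real n powr - h"
            using n by (simp only: powr_add) (simp add: powr_numeral)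
          also have "\<dots> \<le> M * p * u"
            using Mn False ul M0 p0 by (intro mult_mono mult_nonneg_nonneg) auto
          finally show ?thesis .
        qed
        moreover have "real (wsat_target d n) \<le> real d * real n"
          using wsat_target_le[OF n(2)] by (metis of_nat_le_iff of_nat_mult)
        ultimately show ?thesis by simp
      qed
      have "stable_prob d n p \<le> bexp p ?E (\<lambda>S. of_bool (uncovered_edges d {1..n} S \<le> M * p * u / 2))"
        unfolding stable_prob_def
      proof (rule bexp_mono)
        fix S assume S: "S \<subseteq> ?E"
        have "uncovered_edges d {1..n} S \<le> M * p * u / 2"
          if "wsat ({1..n}, S) (complete_graph (d + 2)) = wsat_target d n"
          using uncovered_edges_le_wsat[OF _ S d] big that by simp
        thus "of_bool (wsat ({1..n}, S) (complete_graph (d + 2)) = wsat_target d n)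
          \<le> (of_bool (uncovered_edges d {1..n} S \<le> M * p * u / 2) :: real)" by auto
      qed (use p0 p1 in auto)
      also have "\<dots> \<le> 4 / u\<^sup>2 * (1 / (M * p) + 2 * real n / M + (real a + 8) * p)"
        using few_uncovered_edges_prob[of "{1..n}" p u d M] n p0 p8 u0 by (simp add: u_def M_def a_def)
      also have "\<dots> \<le> 4 * real n powr (2 * h) * (4 / real n + 8 / real n + (real a + 8) * real n powr - (3 * h))"
      proof (intro mult_mono add_mono)
        have "(real n powr - h)\<^sup>2 \<le> u\<^sup>2" using ul by (intro power_mono) auto
        hence "4 / u\<^sup>2 \<le> 4 / (real n powr - h)\<^sup>2" using n u0 by (intro divide_left_mono mult_pos_pos) auto
        also have "(real n powr - h)\<^sup>2 = real n powr - (2 * h)"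
          by (simp add: power2_eq_square powr_add[symmetric])
        also have "4 / real n powr - (2 * h) = 4 * real n powr (2 * h)" by (simp add: powr_minus field_simps)
        finally show "4 / u\<^sup>2 \<le> 4 * real n powr (2 * h)" .
        have "real n / 4 \<le> 4 * real d * real n"
          using d n by (simp add: field_simps)
        hence "real n / 4 \<le> M * p" using Mp by linarith
        hence "1 / (M * p) \<le> 1 / (real n / 4)" using M0 p0 n by (intro divide_left_mono mult_pos_pos) auto
        thus "1 / (M * p) \<le> 4 / real n" by simp
        have "2 * real n / M \<le> 2 * real n / (real n ^ 2 / 4)"
          using Mn M0 n by (intro divide_left_mono mult_pos_pos) auto
        thus "2 * real n / M \<le> 8 / real n" using n by (simp add: power2_eq_square)
      qed (use pu p0 M0 in \<open>auto intro!: add_nonneg_nonneg\<close>)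
      also have "\<dots> = 48 * (real n powr (2 * h) * real n powr - 1) + 4 * (real a + 8) * (real n powr (2 * h) * real n powr - (3 * h))"
        using n by (simp add: powr_minus_divide algebra_simps)
      also have "\<dots> = 48 * real n powr - (1 - 2 * h) + 4 * (real a + 8) * real n powr - h"
        unfolding powr_add[symmetric] by simp
      finally show "stable_prob d n p \<le> \<epsilon>" using elim by linarith
    qed
  qed
qed

text \<open>At least \<open>n / (2 * d)\<close> disjoint blocks succeed independently with
  probability at least \<open>n powr - (1 / 2)\<close> each, so failure is exponentially unlikely in
  the square root of \<open>n\<close>. The exponent 3 suffices for a union bound over all
  pairs.\<close>

lemma uncov_small_if_dense:
  assumes d: "d \<ge> 1"
  shows "\<forall>\<^sub>F n in sequentially. \<forall>p. real n powr (- 3 * \<eta> d) \<le> p \<and> p \<le> 1 \<longrightarrow>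
    uncov d p (n - 2) \<le> real n powr - 3"
proof -
  define a where "a = (d + 2 choose 2)"
  define c where "c = 1 / (2 * real d)"
  have c0: "c > 0" using d by (simp add: c_def)
  have a0: "real a > 0" using choose_two_ge[OF d] by (simp add: a_def)
  have "\<forall>\<^sub>F n in sequentially. exp (- (c * real n powr (1 / 2))) \<le> real n powr - 3"
    using c0 by real_asymp
  with eventually_ge_at_top[of "2 * d + 4"]
  show ?thesis
  proof eventually_elim
    case (elim n)
    show ?case
    proof (intro allI impI)
      fix p assume p: "real n powr (- 3 * \<eta> d) \<le> p \<and> p \<le> 1"
      have n: "real n > 0" using elim by simp
      have p0: "0 \<le> p" using p by (meson order_trans powr_ge_zero)
      define k where "k = (n - 2) div d"
      have "uncov d p (n - 2) \<le> uncov d p (k * d)"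
        using p p0 by (intro uncov_antimono) (auto simp: k_def)
      also have "\<dots> \<le> (1 - p ^ a) ^ k" unfolding a_def using p p0 by (intro uncov_blocks_le) auto
      also have "\<dots> \<le> exp (- (p ^ a)) ^ k"
      proof (intro power_mono)
        show "1 - p ^ a \<le> exp (- (p ^ a))" using exp_ge_add_one_self[of "- (p ^ a)"] by simp
        show "0 \<le> 1 - p ^ a" using p p0 by (simp add: power_le_one)
      qed
      also have "\<dots> = exp (- (real k * p ^ a))" by (simp add: exp_of_nat_mult[symmetric])
      also have "\<dots> \<le> exp (- (c * real n powr (1 / 2)))"
      proof -
        have "c * real n \<le> real k"
        proof -
          have "n - 2 < (k + 1) * d" using d by (simp add: k_def dividend_less_div_times add.commute)
          hence "n - 2 < k * d + d" by simp
          hence "n \<le> 2 * (k * d)" using elim by linarith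
          hence "real n \<le> 2 * real k * real d" by (metis mult.assoc of_nat_le_iff of_nat_mult of_nat_numeral)
          thus ?thesis using d by (simp add: c_def field_simps)
        qed
        moreover have "real n powr - (1 / 2) \<le> p ^ a"
        proof -
          have "real n powr - (1 / 2) = real n powr (- 3 * \<eta> d * real a)"
            using a0 by (simp add: \<eta>_def a_def)
          also have "\<dots> = (real n powr (- 3 * \<eta> d)) ^ a"
            using n by (simp add: powr_realpow[symmetric] powr_powr)
          also have "\<dots> \<le> p ^ a" using p by (intro power_mono) auto
          finally show ?thesis .
        qed
        ultimately have "(c * real n) * real n powr - (1 / 2) \<le> real k * p ^ a"
          by (intro mult_mono) auto
        moreover have "(c * real n) * real n powr - (1 / 2) = c * real n powr (1 / 2)"
        proof -
          have "real n * real n powr - (1 / 2) = real n powr (1 + - (1 / 2))"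
            using n by (simp only: powr_add powr_one)
          thus ?thesis by simp
        qed
        ultimately show ?thesis by simp
      qed
      finally show "uncov d p (n - 2) \<le> real n powr - 3" using elim by linarith
    qed
  qed
qed

text \<open>\<open>T\<close> is chosen from \<epsilon> and the bound on the mean, then
  \<open>J\<close> from \<open>T\<close>; only then is \<open>n\<close> taken so large that the
  target reaches \<open>8 * J\<^sup>2 + J\<close>.\<close>

lemma unstable_sparse:
  assumes d: "d \<ge> 1" and \<epsilon>: "\<epsilon> > 0"
  shows "\<forall>\<^sub>F n in sequentially. \<forall>p. 0 \<le> p \<and> p \<le> 16 * real d / real n \<longrightarrow> stable_prob d n p \<le> \<epsilon>"
proof -
  define C where "C = 16 * real d"
  obtain T :: nat where T: "T \<ge> 1" "C ^ (d + 2) / (\<epsilon> / 2) \<le> real T"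
    using real_arch_simple[of "max 1 (C ^ (d + 2) / (\<epsilon> / 2))"] by auto
  obtain J :: nat where J: "real (Suc T) * 2 / (\<epsilon> / 2) \<le> real J"
    using real_arch_simple by blast
  from eventually_ge_at_top[of "8 * J\<^sup>2 + J + d + 32 * d"]
  show ?thesis
  proof eventually_elim
    case (elim n)
    show ?case
    proof (intro allI impI)
      fix p assume p: "0 \<le> p \<and> p \<le> 16 * real d / real n"
      have n: "real n > 0" using elim d by simp
      have dn: "d \<le> n" using elim by simp
      have "real (32 * d) \<le> real n" using elim by (intro of_nat_mono) simp
      hence "16 * real d / real n \<le> 1 / 2" using n by (simp add: field_simps)
      hence p2: "p \<le> 1 / 2" using p by linarith
      have "1 * (n - d) \<le> d * (n - d)" using d by (intro mult_right_mono) auto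
      hence "8 * J\<^sup>2 + J \<le> wsat_target d n" using elim unfolding wsat_target_def by linarith
      hence "stable_prob d n p \<le> C ^ (d + 2) / real T + real (Suc T) * (2 / real (Suc J))"
        using p p2 n T(1) by (intro stable_prob_sparse[OF d dn]) (auto simp: C_def field_simps)
      also have "\<dots> \<le> \<epsilon> / 2 + \<epsilon> / 2"
      proof (rule add_mono)
        show "C ^ (d + 2) / real T \<le> \<epsilon> / 2" using T \<epsilon> by (simp add: field_simps)
        have "real (Suc T) * 2 \<le> \<epsilon> / 2 * real (Suc J)" using J \<epsilon> by (simp add: field_simps)
        thus "real (Suc T) * (2 / real (Suc J)) \<le> \<epsilon> / 2" by (simp add: field_simps)
      qed
      finally show "stable_prob d n p \<le> \<epsilon>" by simp
    qed
  qed
qed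

lemma unstable_if_uncov_large:
  assumes d: "d \<ge> 1" and \<epsilon>: "\<epsilon> > 0"
  shows "\<forall>\<^sub>F n in sequentially. \<forall>p. 0 \<le> p \<and> p \<le> 1 \<and> real n powr (- \<eta> d) \<le> uncov d p (n - 2)
    \<longrightarrow> stable_prob d n p \<le> \<epsilon>"
  using unstable_intermediate[OF assms] unstable_sparse[OF assms] uncov_small_if_dense[OF d]
    eventually_ge_at_top[of 2]
proof eventually_elim
  case (elim n)
  show ?case
  proof (intro allI impI)
    fix p assume p: "0 \<le> p \<and> p \<le> 1 \<and> real n powr (- \<eta> d) \<le> uncov d p (n - 2)"
    consider "p \<le> 16 * real d / real n" | "16 * real d / real n \<le> p" "p \<le> real n powr (- 3 * \<eta> d)"
      | "real n powr (- 3 * \<eta> d) \<le> p" by linarith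
    thus "stable_prob d n p \<le> \<epsilon>"
    proof cases
      \<comment> \<open>This range is contradictory: such a \<open>p\<close> leaves a pair uncovered
        with probability at most \<open>n powr - 3\<close>.\<close>
      case 3
      hence "uncov d p (n - 2) \<le> real n powr - 3" using elim p by blast
      moreover have "real n powr - 3 < real n powr (- \<eta> d)"
        using elim \<eta>_bounds[OF d] by (intro powr_less_mono) auto
      ultimately show ?thesis using p by linarith
    qed (use elim p in auto)
  qed
qed

subsection \<open>Covering by edges that are themselves covered\<close>

lemma pair_not_subset:
  assumes "x \<in> [D \<union> q]\<^bsup>2\<^esup>" "card q = 2" "x \<noteq> q"
  shows "x \<inter> D \<noteq> {}"
proof
  assume "x \<inter> D = {}"
  hence "x \<subseteq> q" "card x = 2" using assms(1) by (auto simp: nsets_def)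
  thus False using assms(2,3) finite_card2[OF assms(2)] card_subset_eq by metis
qed

text \<open>Fix the pairs inside \<open>D \<union> e\<close>. Distinct \<open>q i\<close> meet only
  inside \<open>e\<close>, so the remaining relevant pairs are disjoint and the events become
  conditionally independent. Each conditional probability has mean at most \<open>t\<close> and
  variance of order \<open>p\<close>, hence exceeds \<open>2 * t\<close> with probability of order
  \<open>p / t\<^sup>2\<close>; apart from these exceptions the product is at most
  \<open>(2 * t) ^ card I\<close>.\<close>

lemma many_uncovered_one_block:
  fixes d :: nat
  assumes E: "finite E" and p: "0 \<le> p" "p \<le> 1" and I: "finite I"
    and D: "finite D" "D \<inter> e = {}" "card e = 2"
    and W: "\<And>i. i \<in> I \<Longrightarrow> W i \<inter> (D \<union> e) = {}" "disjoint_family_on W I"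
    and q: "\<And>i. i \<in> I \<Longrightarrow> q i \<in> [W i \<union> e]\<^bsup>2\<^esup> - {e}"
    and t: "uncov d p (card D) \<le> t" "t > 0"
    and sub: "[D \<union> e]\<^bsup>2\<^esup> - {e} \<subseteq> E" "\<And>i. i \<in> I \<Longrightarrow> [D \<union> q i]\<^bsup>2\<^esup> - {q i} \<subseteq> E"
  shows "bexp p E (\<lambda>S. \<Prod>i\<in>I. of_bool (\<not> covered d S D (q i)))
    \<le> (2 * t) ^ card I + real (card I) * (real (d + 2 choose 2) * p / t\<^sup>2)"
proof -
  define a where "a = real (d + 2 choose 2)"
  define A where "A = [D \<union> e]\<^bsup>2\<^esup> - {e}"
  define B where "B i = [D \<union> q i]\<^bsup>2\<^esup> - {q i} - A" for i
  define F where "F i S = (of_bool (\<not> covered d S D (q i)) :: real)" for i S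
  define g where "g i Q = bexp p (B i) (\<lambda>T. F i (Q \<union> T))" for i Q
  have qi: "q i \<subseteq> W i \<union> e" "card (q i) = 2" "q i \<noteq> e" "finite (q i)" if "i \<in> I" for i
    using q[OF that] by (auto simp: nsets_def)
  have finA: "finite A" using finite_subset[OF sub(1) E] by (simp add: A_def)
  have finB: "finite (B i)" if "i \<in> I" for i
    using finite_subset[OF sub(2)[OF that] E] by (simp add: B_def)
  have AB: "[D \<union> q i]\<^bsup>2\<^esup> - {q i} \<subseteq> A \<union> B i" for i by (auto simp: B_def)
  have Dq: "D \<inter> q i = {}" if "i \<in> I" for i using qi(1)[OF that] W(1)[OF that] D(2) by blast
  have FAB: "F i S = F i (S \<inter> (A \<union> B i))" for i S
    using covered_restrict[OF AB] by (simp add: F_def)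
  have disB: "disjoint_family_on B I"
    unfolding disjoint_family_on_def
  proof (intro ballI impI)
    fix i j assume ij: "i \<in> I" "j \<in> I" "i \<noteq> j"
    have "x \<in> A" if x: "x \<in> [D \<union> q i]\<^bsup>2\<^esup> - {q i}" "x \<in> [D \<union> q j]\<^bsup>2\<^esup> - {q j}" for x
    proof -
      have xi: "x \<subseteq> D \<union> q i" "x \<subseteq> D \<union> q j" "card x = 2" "finite x" using x by (auto simp: nsets_def)
      have "W i \<inter> W j = {}" using W(2) ij by (auto simp: disjoint_family_on_def)
      hence "q i \<inter> q j \<subseteq> e" using qi(1)[OF ij(1)] qi(1)[OF ij(2)] by blast
      hence "x \<subseteq> D \<union> e" using xi(1,2) by blast
      moreover have "x \<inter> D \<noteq> {}" using pair_not_subset[of x D "q i"] x(1) qi(2)[OF ij(1)] by simp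
      hence "x \<noteq> e" using D(2) by blast
      ultimately show ?thesis using xi by (simp add: A_def nsets_def)
    qed
    thus "B i \<inter> B j = {}" unfolding B_def by blast
  qed
  have g01: "0 \<le> g i Q" "g i Q \<le> 1" if "i \<in> I" for i Q
    unfolding g_def F_def using p finB[OF that] by (auto intro!: bexp_nonneg bexp_le_const)
  have var: "bexp p A (\<lambda>Q. of_bool (\<bar>g i Q - bexp p A (g i)\<bar> \<ge> t)) \<le> a * p / t\<^sup>2" "bexp p A (g i) \<le> t"
    if i: "i \<in> I" for i
  proof -
    \<comment> \<open>The variance bound averages over the pairs at a vertex \<open>w\<close> that
      no pair of \<open>A\<close> contains; an end of \<open>q i\<close> in \<open>W i\<close>
      serves as \<open>w\<close>.\<close>
    have "\<not> q i \<subseteq> e"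
      using qi[OF i] finite_card2[OF D(3)] D(3) card_subset_eq by metis
    then obtain w where w: "w \<in> q i" "w \<notin> e" by blast
    hence "w \<in> W i" using qi(1)[OF i] by blast
    hence "w \<notin> D \<union> e" using W(1)[OF i] by blast
    hence wA: "w \<notin> \<Union>A" by (auto simp: A_def nsets_def)
    have cA: "card x = 2" if "x \<in> A" for x using that by (simp add: A_def nsets_def)
    have dAB: "A \<inter> B i = {}" by (auto simp: B_def)
    note v = variance_cond_uncovered[OF finA finB[OF i] dAB p D(1) Dq[OF i] qi(2)[OF i] w(1) wA cA AB, of d,
        folded F_def, folded g_def]
    show "bexp p A (g i) \<le> t" using v(2) t(1) by simp
    have "bexp p A (\<lambda>Q. of_bool (\<bar>g i Q - bexp p A (g i)\<bar> \<ge> t)) 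
        \<le> (bexp p A (\<lambda>Q. (g i Q)\<^sup>2) - (bexp p A (g i))\<^sup>2) / t\<^sup>2"
      by (intro bexp_chebyshev finA p t)
    also have "\<dots> \<le> a * p / t\<^sup>2" using v(1) by (intro divide_right_mono) (auto simp: a_def)
    finally show "bexp p A (\<lambda>Q. of_bool (\<bar>g i Q - bexp p A (g i)\<bar> \<ge> t)) \<le> a * p / t\<^sup>2" .
  qed
  have "bexp p E (\<lambda>S. \<Prod>i\<in>I. F i S) = bexp p (A \<union> (\<Union>i\<in>I. B i)) (\<lambda>S. \<Prod>i\<in>I. F i S)"
  proof (rule bexp_restrict[OF E])
    show "A \<union> (\<Union>i\<in>I. B i) \<subseteq> E" using sub by (auto simp: A_def B_def)
    fix S
    have "F i (S \<inter> (A \<union> (\<Union>i\<in>I. B i))) = F i S" if "i \<in> I" for i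
    proof -
      have "[D \<union> q i]\<^bsup>2\<^esup> - {q i} \<subseteq> A \<union> (\<Union>i\<in>I. B i)" using AB[of i] that by blast
      thus ?thesis using covered_restrict[of D "q i"] by (simp add: F_def)
    qed
    thus "(\<Prod>i\<in>I. F i S) = (\<Prod>i\<in>I. F i (S \<inter> (A \<union> (\<Union>i\<in>I. B i))))" by simp
  qed
  also have "\<dots> = bexp p A (\<lambda>Q. \<Prod>i\<in>I. g i Q)"
    unfolding g_def
  proof (rule bexp_prod_common[OF I finA finB])
    show "A \<inter> B i = {}" for i by (auto simp: B_def)
  qed (use disB FAB in auto)
  also have "\<dots> \<le> bexp p A (\<lambda>Q. (2 * t) ^ card I + (\<Sum>i\<in>I. of_bool (\<bar>g i Q - bexp p A (g i)\<bar> \<ge> t)))"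
  proof (rule bexp_mono[OF p])
    fix Q
    show "(\<Prod>i\<in>I. g i Q) \<le> (2 * t) ^ card I + (\<Sum>i\<in>I. of_bool (\<bar>g i Q - bexp p A (g i)\<bar> \<ge> t))"
    proof (cases "\<exists>i\<in>I. \<bar>g i Q - bexp p A (g i)\<bar> \<ge> t")
      case True
      then obtain i where i: "i \<in> I" "\<bar>g i Q - bexp p A (g i)\<bar> \<ge> t" by blast
      have "(\<Prod>i\<in>I. g i Q) \<le> 1" using g01 by (intro prod_le_1) auto
      also have "1 = (of_bool (\<bar>g i Q - bexp p A (g i)\<bar> \<ge> t) :: real)" using i by simp
      also have "\<dots> \<le> (\<Sum>i\<in>I. of_bool (\<bar>g i Q - bexp p A (g i)\<bar> \<ge> t))"
        using i(1) I by (intro member_le_sum) auto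
      also have "\<dots> \<le> (2 * t) ^ card I + \<dots>" using t(2) by simp
      finally show ?thesis .
    next
      case False
      have "(\<Prod>i\<in>I. g i Q) \<le> (\<Prod>i\<in>I. 2 * t)"
      proof (intro prod_mono conjI g01)
        fix i assume i: "i \<in> I"
        hence "\<bar>g i Q - bexp p A (g i)\<bar> < t" using False by force
        thus "g i Q \<le> 2 * t" using var(2)[OF i] by linarith
      qed
      also have "\<dots> \<le> (2 * t) ^ card I + (\<Sum>i\<in>I. of_bool (\<bar>g i Q - bexp p A (g i)\<bar> \<ge> t))"
        by (simp add: sum_nonneg)
      finally show ?thesis .
    qed
  qed
  also have "\<dots> = (2 * t) ^ card I + (\<Sum>i\<in>I. bexp p A (\<lambda>Q. of_bool (\<bar>g i Q - bexp p A (g i)\<bar> \<ge> t)))"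
    unfolding bexp_add bexp_sum using finA by simp
  also have "\<dots> \<le> (2 * t) ^ card I + (\<Sum>i\<in>I. a * p / t\<^sup>2)"
    using var(1) by (intro add_left_mono sum_mono) auto
  finally show ?thesis by (simp add: F_def a_def)
qed

text \<open>Every pair relevant for \<open>D j\<close> meets \<open>D j\<close>, whereas the pairs
  relevant for another block avoid it. The blocks are therefore independent, and the bound for one
  block is raised to the power \<open>card J\<close>.\<close>

lemma many_uncovered_blocks:
  fixes d :: nat
  assumes V: "finite V" "e \<in> [V]\<^bsup>2\<^esup>" and p: "0 \<le> p" "p \<le> 1" and I: "finite I" and J: "finite J"
    and D: "\<And>j. j \<in> J \<Longrightarrow> D j \<subseteq> V - e" "\<And>j. j \<in> J \<Longrightarrow> card (D j) = m" "disjoint_family_on D J"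
    and W: "\<And>i. i \<in> I \<Longrightarrow> W i \<subseteq> V - e" "disjoint_family_on W I" "\<And>i j. i \<in> I \<Longrightarrow> j \<in> J \<Longrightarrow> W i \<inter> D j = {}"
    and q: "\<And>i. i \<in> I \<Longrightarrow> q i \<in> [W i \<union> e]\<^bsup>2\<^esup> - {e}"
    and t: "uncov d p m \<le> t" "t > 0"
  shows "bexp p ([V]\<^bsup>2\<^esup>) (\<lambda>S. \<Prod>j\<in>J. \<Prod>i\<in>I. of_bool (\<not> covered d S (D j) (q i)))
    \<le> ((2 * t) ^ card I + real (card I) * (real (d + 2 choose 2) * p / t\<^sup>2)) ^ card J"
proof -
  let ?E = "[V]\<^bsup>2\<^esup>"
  define H where "H j S = (\<Prod>i\<in>I. of_bool (\<not> covered d S (D j) (q i)) :: real)" for j S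
  define G where "G j = (\<Union>i\<in>I. [D j \<union> q i]\<^bsup>2\<^esup> - {q i})" for j
  have e: "card e = 2" "e \<subseteq> V" using V(2) by (auto simp: nsets_def)
  have finE: "finite ?E" using V by simp
  have qi: "q i \<subseteq> W i \<union> e" "card (q i) = 2" if "i \<in> I" for i
    using q[OF that] by (auto simp: nsets_def)
  have qV: "q i \<subseteq> V" if "i \<in> I" for i using qi(1)[OF that] W(1)[OF that] e(2) by blast
  have DV: "D j \<subseteq> V" if "j \<in> J" for j using D(1)[OF that] by blast
  have Dq: "D j \<inter> q i = {}" if "i \<in> I" "j \<in> J" for i j
    using qi(1)[OF that(1)] W(3)[OF that] D(1)[OF that(2)] by blast
  have sub: "[D j \<union> q i]\<^bsup>2\<^esup> - {q i} \<subseteq> ?E" if "i \<in> I" "j \<in> J" for i j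
    using nsets2_mono[of "D j \<union> q i" V] DV qV that by blast
  have GE: "G j \<subseteq> ?E" if "j \<in> J" for j using sub[OF _ that] by (auto simp: G_def)
  have HG: "H j (S \<inter> X) = H j S" if "j \<in> J" "G j \<subseteq> X" for j S X
  proof -
    have "covered d (S \<inter> X) (D j) (q i) \<longleftrightarrow> covered d S (D j) (q i)" if "i \<in> I" for i
    proof (rule covered_restrict)
      show "[D j \<union> q i]\<^bsup>2\<^esup> - {q i} \<subseteq> X" using \<open>G j \<subseteq> X\<close> that by (auto simp: G_def)
    qed
    thus ?thesis by (simp add: H_def)
  qed
  have disG: "disjoint_family_on G J"
    unfolding disjoint_family_on_def
  proof (intro ballI impI)
    fix j j' assume j: "j \<in> J" "j' \<in> J" "j \<noteq> j'"
    have False if x: "x \<in> [D j \<union> q i]\<^bsup>2\<^esup> - {q i}" "x \<in> [D j' \<union> q i']\<^bsup>2\<^esup> - {q i'}" and i: "i \<in> I" "i' \<in> I" for x i i'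
    proof -
      have "x \<inter> D j \<noteq> {}" using pair_not_subset[of x "D j" "q i"] x(1) qi(2)[OF i(1)] by simp
      moreover have "x \<subseteq> D j' \<union> q i'" using x(2) by (simp add: nsets_def)
      moreover have "D j \<inter> D j' = {}" using D(3) j by (auto simp: disjoint_family_on_def)
      moreover have "D j \<inter> q i' = {}" using Dq[OF i(2) j(1)] .
      ultimately show False by blast
    qed
    thus "G j \<inter> G j' = {}" unfolding G_def by blast
  qed
  have "bexp p ?E (\<lambda>S. \<Prod>j\<in>J. H j S) = bexp p (\<Union>j\<in>J. G j) (\<lambda>S. \<Prod>j\<in>J. H j S)"
  proof (rule bexp_restrict[OF finE])
    show "(\<Union>j\<in>J. G j) \<subseteq> ?E" using GE by blast
    fix S
    have "H j (S \<inter> (\<Union>j\<in>J. G j)) = H j S" if "j \<in> J" for j using that by (intro HG) auto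
    thus "(\<Prod>j\<in>J. H j S) = (\<Prod>j\<in>J. H j (S \<inter> (\<Union>j\<in>J. G j)))" by simp
  qed
  also have "\<dots> = (\<Prod>j\<in>J. bexp p (G j) (H j))"
    using HG disG finite_subset[OF GE finE] by (intro bexp_prod J) auto
  also have "\<dots> \<le> (\<Prod>j\<in>J. (2 * t) ^ card I + real (card I) * (real (d + 2 choose 2) * p / t\<^sup>2))"
  proof (rule prod_mono, rule conjI)
    fix j assume j: "j \<in> J"
    show "0 \<le> bexp p (G j) (H j)" using p by (intro bexp_nonneg) (auto simp: H_def prod_nonneg)
    have "bexp p (G j) (H j) = bexp p ?E (H j)"
      using HG[OF j, of "G j"] GE[OF j] finE by (intro bexp_restrict[symmetric]) auto
    also have "\<dots> \<le> (2 * t) ^ card I + real (card I) * (real (d + 2 choose 2) * p / t\<^sup>2)"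
      unfolding H_def
    proof (rule many_uncovered_one_block[OF finE p I])
      show "finite (D j)" using DV[OF j] V(1) finite_subset by blast
      show "D j \<inter> e = {}" using D(1)[OF j] by blast
      show "W i \<inter> (D j \<union> e) = {}" if "i \<in> I" for i using W(1)[OF that] W(3)[OF that j] by blast
      show "uncov d p (card (D j)) \<le> t" using t D(2)[OF j] by simp
      show "[D j \<union> e]\<^bsup>2\<^esup> - {e} \<subseteq> ?E" using nsets2_mono[of "D j \<union> e" V] DV[OF j] e(2) by blast
    qed (use e W q t sub[OF _ j] in auto)
    finally show "bexp p (G j) (H j) \<le> (2 * t) ^ card I + real (card I) * (real (d + 2 choose 2) * p / t\<^sup>2)" .
  qed
  finally show ?thesis by (simp add: H_def)
qed

text \<open>\<open>S\<close> plays the role of the fresh random graph and \<open>S'\<close> that of the old one. With high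
  probability \<open>S\<close> covers \<open>e\<close> through a set \<open>W i \<subseteq> C i\<close> for every \<open>i\<close>; if none of these coverings
  survives, each contains an edge \<open>q i\<close> that \<open>S'\<close> does not cover through any of the \<open>D j\<close>.\<close>

lemma not_doubly_covered_prob:
  fixes d :: nat
  assumes V: "finite V" "e \<in> [V]\<^bsup>2\<^esup>" and p: "0 \<le> p" "p \<le> 1" and r: "0 \<le> r" "r \<le> 1"
    and I: "finite I" and J: "finite J"
    and D: "\<And>j. j \<in> J \<Longrightarrow> D j \<subseteq> V - e" "\<And>j. j \<in> J \<Longrightarrow> card (D j) = m" "disjoint_family_on D J"
    and C: "\<And>i. i \<in> I \<Longrightarrow> C i \<subseteq> V - e" "\<And>i. i \<in> I \<Longrightarrow> card (C i) = m'" "disjoint_family_on C I"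
      "\<And>i j. i \<in> I \<Longrightarrow> j \<in> J \<Longrightarrow> C i \<inter> D j = {}"
    and t: "uncov d p m \<le> t" "t > 0"
  shows "bexp r ([V]\<^bsup>2\<^esup>) (\<lambda>S. bexp p ([V]\<^bsup>2\<^esup>) (\<lambda>S'. of_bool (\<not> covered d {x \<in> S. covered d S' UNIV x} UNIV e)))
    \<le> real (card I) * uncov d r m' + real ((d + 2 choose 2) ^ card I) *
      ((2 * t) ^ card I + real (card I) * (real (d + 2 choose 2) * p / t\<^sup>2)) ^ card J"
proof -
  let ?E = "[V]\<^bsup>2\<^esup>"
  define a where "a = (d + 2 choose 2)"
  define b where "b = ((2 * t) ^ card I + real (card I) * (real a * p / t\<^sup>2)) ^ card J"
  have b0: "0 \<le> b" using t p by (auto simp: b_def intro!: zero_le_power add_nonneg_nonneg mult_nonneg_nonneg divide_nonneg_nonneg)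
  have e: "card e = 2" "e \<subseteq> V" "finite e" using V(2) by (auto simp: nsets_def)
  have finE: "finite ?E" using V by simp
  have inner: "bexp p ?E (\<lambda>S'. of_bool (\<not> covered d {x \<in> S. covered d S' UNIV x} UNIV e))
     \<le> (\<Sum>i\<in>I. of_bool (\<not> covered d S (C i) e)) + real (a ^ card I) * b" for S
  \<comment> \<open>If \<open>S\<close> fails to cover \<open>e\<close> through some
    \<open>C i\<close>, the trivial bound 1 is absorbed by the first sum.\<close>
  proof (cases "\<exists>i\<in>I. \<not> covered d S (C i) e")
    case True
    then obtain i where i: "i \<in> I" "\<not> covered d S (C i) e" by blast
    have "bexp p ?E (\<lambda>S'. of_bool (\<not> covered d {x \<in> S. covered d S' UNIV x} UNIV e)) \<le> 1"
      using p finE by (intro bexp_le_const) auto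
    also have "1 = (of_bool (\<not> covered d S (C i) e) :: real)" using i by simp
    also have "\<dots> \<le> (\<Sum>i\<in>I. of_bool (\<not> covered d S (C i) e))" using i(1) I by (intro member_le_sum) auto
    also have "\<dots> \<le> \<dots> + real (a ^ card I) * b" using b0 by simp
    finally show ?thesis .
  next
    case False
    hence "\<forall>i\<in>I. covered d S (C i) e" by blast
    hence "\<forall>i\<in>I. \<exists>W\<subseteq>C i. finite W \<and> card W = d \<and> W \<inter> e = {} \<and> [W \<union> e]\<^bsup>2\<^esup> - {e} \<subseteq> S"
      unfolding covered_def .
    then obtain W where W: "\<And>i. i \<in> I \<Longrightarrow> W i \<subseteq> C i \<and> finite (W i) \<and> card (W i) = d \<and> W i \<inter> e = {} \<and> [W i \<union> e]\<^bsup>2\<^esup> - {e} \<subseteq> S"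
      by metis
    define P where "P i = [W i \<union> e]\<^bsup>2\<^esup> - {e}" for i
    \<comment> \<open>A member of \<open>Q\<close> selects one failing edge from each covering
      clique. There are at most \<open>a ^ card I\<close> selections, over which a union bound is
      taken.\<close>
    define Q where "Q = PiE I P"
    have P: "finite (P i)" "card (P i) \<le> a" if "i \<in> I" for i
    proof -
      have fin: "finite (W i \<union> e)" using W[OF that] e by simp
      thus "finite (P i)" by (simp add: P_def)
      have "card (P i) \<le> card ([W i \<union> e]\<^bsup>2\<^esup>)" using fin by (intro card_mono) (auto simp: P_def)
      also have "\<dots> = a" unfolding a_def card_nsets2[OF fin]
        using W[OF that] e by (simp add: card_Un_disjoint)
      finally show "card (P i) \<le> a" .
    qed
    have finQ: "finite Q" unfolding Q_def using I P by (intro finite_PiE) auto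
    have "card Q \<le> a ^ card I"
    proof -
      have "card Q = (\<Prod>i\<in>I. card (P i))" unfolding Q_def using I by (rule card_PiE)
      also have "\<dots> \<le> (\<Prod>i\<in>I. a)" using P by (intro prod_mono) auto
      finally show ?thesis by simp
    qed
    have "bexp p ?E (\<lambda>S'. of_bool (\<not> covered d {x \<in> S. covered d S' UNIV x} UNIV e)) 
        \<le> bexp p ?E (\<lambda>S'. \<Sum>q\<in>Q. \<Prod>j\<in>J. \<Prod>i\<in>I. of_bool (\<not> covered d S' (D j) (q i)))"
    proof (rule bexp_mono[OF p])
      fix S'
      show "of_bool (\<not> covered d {x \<in> S. covered d S' UNIV x} UNIV e)
        \<le> (\<Sum>q\<in>Q. \<Prod>j\<in>J. \<Prod>i\<in>I. of_bool (\<not> covered d S' (D j) (q i)) :: real)"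
      proof (cases "covered d {x \<in> S. covered d S' UNIV x} UNIV e")
        case False
        have "\<exists>x\<in>P i. \<not> covered d S' UNIV x" if "i \<in> I" for i
        proof (rule ccontr)
          assume "\<not> (\<exists>x\<in>P i. \<not> covered d S' UNIV x)"
          hence "[W i \<union> e]\<^bsup>2\<^esup> - {e} \<subseteq> {x \<in> S. covered d S' UNIV x}" using W[OF that] by (auto simp: P_def)
          hence "covered d {x \<in> S. covered d S' UNIV x} UNIV e"
            unfolding covered_def[of d "{x \<in> S. covered d S' UNIV x}"]
            using W[OF that] by (intro exI[of _ "W i"] conjI) auto
          thus False using False by simp
        qed
        then obtain f where f: "\<And>i. i \<in> I \<Longrightarrow> f i \<in> P i" "\<And>i. i \<in> I \<Longrightarrow> \<not> covered d S' UNIV (f i)"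
          by metis
        define q where "q = restrict f I"
        have qQ: "q \<in> Q" using f(1) by (auto simp: Q_def q_def)
        have "\<not> covered d S' (D j) (q i)" if "i \<in> I" for i j
        proof
          assume "covered d S' (D j) (q i)"
          hence "covered d S' UNIV (q i)" by (rule covered_mono) auto
          thus False using f(2) that by (simp add: q_def)
        qed
        hence "(1::real) = (\<Prod>j\<in>J. \<Prod>i\<in>I. of_bool (\<not> covered d S' (D j) (q i)))" by simp
        also have "\<dots> \<le> (\<Sum>q\<in>Q. \<Prod>j\<in>J. \<Prod>i\<in>I. of_bool (\<not> covered d S' (D j) (q i)))"
          using qQ finQ by (intro member_le_sum) (auto intro!: prod_nonneg)
        finally show ?thesis by simp
      qed (simp add: sum_nonneg prod_nonneg)
    qed
    also have "\<dots> \<le> (\<Sum>q\<in>Q. b)"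
      unfolding bexp_sum
    proof (rule sum_mono)
      fix q assume "q \<in> Q"
      hence qP: "q i \<in> [W i \<union> e]\<^bsup>2\<^esup> - {e}" if "i \<in> I" for i using that by (auto simp: Q_def P_def)
      have WC: "W i \<subseteq> C i" if "i \<in> I" for i using W[OF that] by blast
      show "bexp p ?E (\<lambda>S'. \<Prod>j\<in>J. \<Prod>i\<in>I. of_bool (\<not> covered d S' (D j) (q i))) \<le> b"
        unfolding b_def a_def
      proof (rule many_uncovered_blocks[OF V p I J D])
        show "W i \<subseteq> V - e" if "i \<in> I" for i using WC[OF that] C(1)[OF that] by blast
        show "disjoint_family_on W I"
          using C(3) WC unfolding disjoint_family_on_def by blast
        show "W i \<inter> D j = {}" if "i \<in> I" "j \<in> J" for i j using WC[OF that(1)] C(4)[OF that] by blast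
      qed (use qP t in auto)
    qed
    also have "\<dots> \<le> real (a ^ card I) * b"
      using \<open>card Q \<le> a ^ card I\<close> b0 by (simp add: mult_right_mono del: of_nat_power)
    also have "\<dots> \<le> (\<Sum>i\<in>I. of_bool (\<not> covered d S (C i) e)) + real (a ^ card I) * b"
      by (simp add: sum_nonneg)
    finally show ?thesis .
  qed
  have "bexp r ?E (\<lambda>S. bexp p ?E (\<lambda>S'. of_bool (\<not> covered d {x \<in> S. covered d S' UNIV x} UNIV e)))
    \<le> bexp r ?E (\<lambda>S. (\<Sum>i\<in>I. of_bool (\<not> covered d S (C i) e)) + real (a ^ card I) * b)"
    by (intro bexp_mono r inner)
  also have "\<dots> = (\<Sum>i\<in>I. bexp r ?E (\<lambda>S. of_bool (\<not> covered d S (C i) e))) + real (a ^ card I) * b"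
    unfolding bexp_add bexp_sum using finE by simp
  also have "(\<Sum>i\<in>I. bexp r ?E (\<lambda>S. of_bool (\<not> covered d S (C i) e))) = (\<Sum>i\<in>I. uncov d r m')"
  proof (rule sum.cong[OF HOL.refl])
    fix i assume i: "i \<in> I"
    have "[C i \<union> e]\<^bsup>2\<^esup> - {e} \<subseteq> ?E" using nsets2_mono[of "C i \<union> e" V] C(1)[OF i] e(2) by blast
    hence "bexp r ?E (\<lambda>S. of_bool (\<not> covered d S (C i) e)) = uncov d r (card (C i))"
      using C(1)[OF i] V(1) finite_subset[of "C i" V] e by (intro bexp_uncovered_eq finE) auto
    thus "bexp r ?E (\<lambda>S. of_bool (\<not> covered d S (C i) e)) = uncov d r m'" using C(2)[OF i] by simp
  qed
  finally show ?thesis by (simp add: a_def b_def)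
qed

section \<open>Disjoint vertex blocks\<close>

lemma disjoint_blocks:
  assumes "finite X" "k * m \<le> card X"
  shows "\<exists>B. (\<forall>j<k. B j \<subseteq> X \<and> card (B j) = m) \<and> disjoint_family_on B {..<k}"
  using assms
proof (induction k arbitrary: X)
  case 0
  show ?case by (intro exI[of _ "\<lambda>_. {}"]) (simp add: disjoint_family_on_def)
next
  case (Suc k)
  obtain Y where Y: "Y \<subseteq> X" "card Y = m"
    using obtain_subset_with_card_n[of m X] Suc.prems by (auto simp: algebra_simps)
  have finY: "finite Y" using Y(1) Suc.prems(1) finite_subset by blast
  have "k * m \<le> card (X - Y)" using Y finY Suc.prems by (simp add: card_Diff_subset)
  then obtain B where B: "\<And>j. j < k \<Longrightarrow> B j \<subseteq> X - Y" "\<And>j. j < k \<Longrightarrow> card (B j) = m" "disjoint_family_on B {..<k}"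
    using Suc.IH[of "X - Y"] Suc.prems(1) finite_Diff[of X Y] by metis
  have "disjoint_family_on (B(k := Y)) {..<Suc k}"
    unfolding disjoint_family_on_def
  proof (intro ballI impI)
    fix i j assume "i \<in> {..<Suc k}" "j \<in> {..<Suc k}" "i \<noteq> j"
    moreover have "B i \<inter> B j = {}" if "i < k" "j < k" "i \<noteq> j" for i j
      using B(3) that by (auto simp: disjoint_family_on_def)
    moreover have "B i \<inter> Y = {}" if "i < k" for i using B(1)[OF that] by blast
    ultimately show "(B(k := Y)) i \<inter> (B(k := Y)) j = {}"
      by (cases "i = k"; cases "j = k") (auto simp: less_Suc_eq)
  qed
  moreover have "(B(k := Y)) j \<subseteq> X \<and> card ((B(k := Y)) j) = m" if "j < Suc k" for j
    using B(1,2)[of j] Y that by (cases "j = k") auto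
  ultimately show ?case by blast
qed

text \<open>The families are placed in disjoint halves of \<open>X\<close>, which keeps the
  witnesses for the fresh graph apart from those for the old one.\<close>

lemma two_disjoint_block_families:
  assumes "finite X" "c \<ge> 1" "k \<ge> 1"
  shows "\<exists>C D. (\<forall>i<c. C i \<subseteq> X \<and> card (C i) = card X div 2 div c) \<and> disjoint_family_on C {..<c} \<and>
    (\<forall>j<k. D j \<subseteq> X \<and> card (D j) = card X div 2 div k) \<and> disjoint_family_on D {..<k} \<and>
    (\<forall>i<c. \<forall>j<k. C i \<inter> D j = {})"
proof -
  have "2 * (card X div 2) \<le> card X" by simp
  then obtain H where H: "\<And>j. j < 2 \<Longrightarrow> H j \<subseteq> X" "\<And>j. j < 2 \<Longrightarrow> card (H j) = card X div 2" 
    "disjoint_family_on H {..<2::nat}"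
    using disjoint_blocks[OF assms(1), of 2 "card X div 2"] by blast
  have dis: "H 0 \<inter> H 1 = {}" using H(3) unfolding disjoint_family_on_def by force
  have fin: "finite (H 0)" "finite (H 1)" using H(1)[of 0] H(1)[of 1] assms(1) finite_subset by auto
  obtain C where C: "\<And>i. i < c \<Longrightarrow> C i \<subseteq> H 0 \<and> card (C i) = card X div 2 div c" "disjoint_family_on C {..<c}"
    using disjoint_blocks[OF fin(1), of c "card X div 2 div c"] H(2)[of 0] by auto
  obtain D where D: "\<And>i. i < k \<Longrightarrow> D i \<subseteq> H 1 \<and> card (D i) = card X div 2 div k" "disjoint_family_on D {..<k}"
    using disjoint_blocks[OF fin(2), of k "card X div 2 div k"] H(2)[of 1] by auto
  have CD: "C i \<inter> D j = {}" if "i < c" "j < k" for i j using C(1)[OF that(1)] D(1)[OF that(2)] dis by blast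
  have CX: "C i \<subseteq> X" if "i < c" for i using C(1)[OF that] H(1)[of 0] by auto
  have DX: "D i \<subseteq> X" if "i < k" for i using D(1)[OF that] H(1)[of 1] by auto
  show ?thesis by (rule exI[of _ C], rule exI[of _ D]) (use C D CX DX CD in auto)
qed

subsection \<open>Robust weak saturation and sprinkling\<close>

text \<open>The event B. Covering absent pairs as well is what prevents later additions from
  requiring new generators.\<close>

definition robust :: "nat \<Rightarrow> nat \<Rightarrow> nat set set \<Rightarrow> bool" where
  "robust d n S \<longleftrightarrow> wsat ({1..n}, S) (complete_graph (d + 2)) = wsat_target d n \<and>
     (\<forall>e\<in>[{1..n}]\<^bsup>2\<^esup>. covered d S UNIV e)"

definition robust_prob :: "nat \<Rightarrow> nat \<Rightarrow> real \<Rightarrow> real" where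
  "robust_prob d n p = bexp p ([{1..n}]\<^bsup>2\<^esup>) (\<lambda>S. of_bool (robust d n S))"

text \<open>A smallest generating set of \<open>S\<close> also generates \<open>T\<close>, and the
  lower bound for complete graphs excludes a smaller one because \<open>T\<close> covers every
  pair.\<close>

lemma robust_extend:
  assumes d: "d \<ge> 1" and n: "d \<le> n" and S: "S \<subseteq> T" "T \<subseteq> [{1..n}]\<^bsup>2\<^esup>"
    and wsat: "wsat ({1..n}, S) (complete_graph (d + 2)) = wsat_target d n"
    and perc: "percolates d S T" and cov: "\<And>e. e \<in> [{1..n}]\<^bsup>2\<^esup> \<Longrightarrow> covered d T UNIV e"
  shows "robust d n T"
proof -
  have "S \<subseteq> [{1..n}]\<^bsup>2\<^esup>" using S by blast
  then obtain H where "percolates d H S" "card H = wsat_target d n"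
    using wsat_attained[OF _ _ d, of "{1..n}" S] wsat by auto
  thus ?thesis
    using wsat_eq_if_all_covered[OF d n S(2), of H] percolates_trans[OF perc] cov
    by (simp add: robust_def wsat_target_def)
qed

lemma robust_mono:
  assumes d: "d \<ge> 1" and n: "d \<le> n" and S: "S \<subseteq> T" "T \<subseteq> [{1..n}]\<^bsup>2\<^esup>" and r: "robust d n S"
  shows "robust d n T"
proof (rule robust_extend[OF d n S])
  have cov: "covered d S UNIV e" if "e \<in> [{1..n}]\<^bsup>2\<^esup>" for e using r that by (simp add: robust_def)
  have "finite T" using S(2) finite_subset finite_nsets2[of "{1..n}"] by blast
  thus "percolates d S T" using S cov by (intro percolates_fill) auto
  show "covered d T UNIV e" if "e \<in> [{1..n}]\<^bsup>2\<^esup>" for e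
    using cov[OF that] by (rule covered_mono) (use S in auto)
qed (use r in \<open>simp add: robust_def\<close>)

text \<open>\<open>S'\<close> activates the part \<open>C\<close> of \<open>S\<close> that it
  covers; \<open>C\<close> in turn covers every pair, so the rest of \<open>S\<close>
  follows.\<close>

lemma robust_union:
  assumes d: "d \<ge> 1" and n: "d \<le> n" and S: "S \<subseteq> [{1..n}]\<^bsup>2\<^esup>" "S' \<subseteq> [{1..n}]\<^bsup>2\<^esup>"
    and wsat: "wsat ({1..n}, S') (complete_graph (d + 2)) = wsat_target d n"
    and cov: "\<And>e. e \<in> [{1..n}]\<^bsup>2\<^esup> \<Longrightarrow> covered d {x \<in> S. covered d S' UNIV x} UNIV e"
  shows "robust d n (S \<union> S')"
proof (rule robust_extend[OF d n _ _ wsat])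
  define C where "C = {x \<in> S. covered d S' UNIV x}"
  have fin: "finite S" "finite S'" using S finite_subset finite_nsets2[of "{1..n}"] by blast+
  have "percolates d S' (S' \<union> C)" using fin by (intro percolates_fill) (auto simp: C_def)
  moreover have "percolates d (S' \<union> C) (S \<union> S')"
  proof (rule percolates_fill)
    fix e assume "e \<in> S \<union> S' - (S' \<union> C)"
    hence "covered d C UNIV e" using cov[of e] S by (auto simp: C_def)
    thus "covered d (S' \<union> C) UNIV e" by (rule covered_mono) auto
  qed (use fin in \<open>auto simp: C_def\<close>)
  ultimately show "percolates d S' (S \<union> S')" using percolates_trans by blast
  show "covered d (S \<union> S') UNIV e" if "e \<in> [{1..n}]\<^bsup>2\<^esup>" for e
    using cov[OF that] by (rule covered_mono) auto
qed (use S in auto)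

lemma robust_prob_mono:
  assumes "d \<ge> 1" "d \<le> n" "0 \<le> p" "p \<le> q" "q \<le> 1"
  shows "robust_prob d n p \<le> robust_prob d n q"
  unfolding robust_prob_def
proof (rule bexp_mono_prob)
  fix S T :: "nat set set" assume "S \<subseteq> T" "T \<subseteq> [{1..n}]\<^bsup>2\<^esup>"
  hence "robust d n S \<Longrightarrow> robust d n T" using robust_mono assms by blast
  thus "of_bool (robust d n S) \<le> (of_bool (robust d n T) :: real)" by auto
qed (use assms in auto)

lemma robust_prob_le_stable_prob:
  assumes "0 \<le> p" "p \<le> 1"
  shows "robust_prob d n p \<le> stable_prob d n p"
  unfolding robust_prob_def stable_prob_def using assms by (intro bexp_mono) (auto simp: robust_def)

lemma robust_prob_copies:
  assumes "d \<ge> 1" "d \<le> n" "0 \<le> p" "p \<le> 1"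
  shows "1 - robust_prob d n (1 - (1 - p) ^ k) \<le> (1 - robust_prob d n p) ^ k"
proof -
  let ?E = "[{1..n}]\<^bsup>2\<^esup>"
  have eq: "bexp q ?E (\<lambda>S. of_bool (\<not> robust d n S)) = 1 - robust_prob d n q" for q
  proof -
    have "bexp q ?E (\<lambda>S. of_bool (\<not> robust d n S)) = bexp q ?E (\<lambda>S. 1 - of_bool (robust d n S))"
      by (intro bexp_cong HOL.refl) auto
    thus ?thesis by (simp add: bexp_diff robust_prob_def)
  qed
  have "bexp (1 - (1 - p) ^ k) ?E (\<lambda>S. of_bool (\<not> robust d n S)) \<le> bexp p ?E (\<lambda>S. of_bool (\<not> robust d n S)) ^ k"
  proof (rule bexp_decreasing_copies)
    fix S T assume "S \<subseteq> T" "T \<subseteq> ?E" "\<not> robust d n T"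
    thus "\<not> robust d n S" using robust_mono[OF assms(1,2)] by blast
  qed (use assms in auto)
  thus ?thesis unfolding eq .
qed

section \<open>Constantly many fresh copies\<close>

lemma union_level_le:
  assumes "0 \<le> p" "p \<le> 1"
  shows "1 - (1 - p) ^ k \<le> real k * p" "0 \<le> 1 - (1 - p) ^ k" "1 - (1 - p) ^ k \<le> 1"
  using Bernoulli_inequality[of "-p" k] assms by (auto simp: power_le_one)

text \<open>Passing from \<open>N\<close> witnesses to \<open>m = N div 2 div k\<close> costs only a
  constant power: \<open>4 * k * d\<close> blocks of size \<open>m div d\<close> are enough for the
  \<open>N\<close> vertices, so the Harris comparison applies. The halving makes room for two
  families of blocks.\<close>

lemma uncov_reduce:
  assumes d: "d \<ge> 1" and k: "k \<ge> 1" and n: "2 * k * d \<le> N" and p: "0 \<le> p" "p \<le> 1"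
  shows "uncov d p (N div 2 div k) ^ (2 ^ (4 * k * d)) \<le> uncov d p N"
proof -
  define m where "m = N div 2 div k"
  define h where "h = m div d"
  have "k * d \<le> N div 2" using n by simp
  hence "d \<le> m" using k by (simp add: m_def less_eq_div_iff_mult_less_eq mult.commute)
  hence h: "h \<ge> 1" using d by (simp add: h_def div_greater_zero_iff Suc_le_eq)
  have "N div 2 < k * (m + 1)" using k by (simp add: m_def dividend_less_times_div)
  hence "N < 2 * (k * (m + 1))" by linarith
  moreover have "m < d * (h + 1)" using d by (simp add: h_def dividend_less_times_div)
  hence "m + 1 \<le> d * (h + 1)" by simp
  hence "2 * (k * (m + 1)) \<le> 2 * (k * (d * (h + 1)))" by (intro mult_left_mono) auto
  moreover have "2 * (k * (d * (h + 1))) \<le> 2 * (k * (d * (h + h)))"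
    using h by (intro mult_left_mono add_left_mono) auto
  moreover have "2 * (k * (d * (h + h))) = 4 * k * d * h" by simp
  ultimately have "N \<le> 4 * k * d * h" by linarith
  thus ?thesis using h p unfolding m_def[symmetric]
    by (intro uncov_power_le[where h = h]) (auto simp: h_def)
qed

lemma powr_power_root_le:
  fixes x z :: real
  assumes "x ^ P \<le> N powr - c" "0 \<le> x" "P > 0" "N > 0"
  shows "x \<le> N powr - (c / real P)"
proof (rule ccontr)
  assume "\<not> x \<le> N powr - (c / real P)"
  hence "(N powr - (c / real P)) ^ P < x ^ P" using assms by (intro power_strict_mono) auto
  moreover have "(N powr - (c / real P)) ^ P = N powr - c"
    using assms by (simp add: powr_realpow[symmetric] powr_powr)
  ultimately show False using assms(1) by simp
qed

text \<open>The failure probability per pair is brought to order \<open>n powr - 3\<close>, because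
  up to \<open>n\<^sup>2\<close> pairs enter a union bound. All constants depend on \<open>d\<close>
  only, so \<open>L\<close> is fixed before \<epsilon>.\<close>

lemma robust_after_sprinkling:
  assumes d: "d \<ge> 1"
  shows "\<exists>L\<ge>1. \<forall>\<epsilon>>0. \<forall>\<^sub>F n in sequentially. \<forall>p. 0 \<le> p \<and> p \<le> 1 \<and> uncov d p (n - 2) < real n powr (- \<eta> d)
    \<longrightarrow> stable_prob d n p - \<epsilon> \<le> robust_prob d n (1 - (1 - p) ^ L)"
proof -
  define h where "h = \<eta> d"
  have h: "0 < h" "h \<le> 1 / 18" using \<eta>_bounds[OF d] by (auto simp: h_def)
  define a where "a = (d + 2 choose 2)"
  \<comment> \<open>\<open>k\<close> is the number of blocks \<open>D j\<close> of the old graph: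
    each contributes a factor of order \<open>n powr - h\<close>, hence all together
    \<open>n powr - 3\<close>.\<close>
  obtain k :: nat where "3 / h \<le> real k" using real_arch_simple by blast
  hence kh: "3 \<le> real k * h" using h by (simp add: field_simps)
  hence k1: "k \<ge> 1" using h by (cases k) auto
  \<comment> \<open>\<open>c\<close> is both the power lost in passing to a block \<open>D j\<close>
    and the number of sets \<open>C i\<close>. With \<open>t = n powr - h1\<close> bounding the
    uncovered probability of a block, \<open>(2 * t) ^ c\<close> is again of order
    \<open>n powr - h\<close>.\<close>
  define c :: nat where "c = 2 ^ (4 * k * d)"
  define h1 where "h1 = h / real c"
  define h2 where "h2 = h / real ((2::nat) ^ (4 * c * d))"
  have c1: "c \<ge> 1" by (simp add: c_def)
  have h1: "h1 > 0" "h1 \<le> h" "h1 * real c = h" using h c1 by (auto simp: h1_def field_simps)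
  have h2: "h2 > 0" using h by (simp add: h2_def)
  \<comment> \<open>\<open>l\<close> fresh copies lower the uncovered probability through a set
    \<open>C i\<close> from \<open>n powr - h2\<close> to \<open>n powr - 3\<close>.\<close>
  obtain l :: nat where "3 / h2 \<le> real l" using real_arch_simple by blast
  hence lh: "3 \<le> real l * h2" using h2 by (simp add: field_simps)
  define K where "K = real c + real (a ^ c) * (2 ^ c + real c * real a) ^ k"
  have K0: "K \<ge> 0" by (simp add: K_def)
  show ?thesis
  \<comment> \<open>The \<open>l\<close> fresh copies together with the original graph.\<close>
  proof (intro exI[of _ "Suc l"] conjI allI impI)
    fix \<epsilon> :: real assume \<epsilon>: "\<epsilon> > 0"
    have e1: "\<forall>\<^sub>F n in sequentially. (K + 1) * real n powr - 1 \<le> \<epsilon>"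
    proof (rule eventually_le_of_tendsto_0[OF _ \<epsilon>])
      have "(\<lambda>n. (K + 1) * real n powr - 1) \<longlonglongrightarrow> (K + 1) * 0"
        by (intro tendsto_intros powr_neg_tendsto_0) auto
      thus "(\<lambda>n. (K + 1) * real n powr - 1) \<longlonglongrightarrow> 0" by simp
    qed
    from e1 uncov_small_if_dense[OF d] eventually_ge_at_top[of "2 * k * d + 2 * c * d + 2 + d"]
    show "\<forall>\<^sub>F n in sequentially. \<forall>p. 0 \<le> p \<and> p \<le> 1 \<and> uncov d p (n - 2) < real n powr (- \<eta> d)
      \<longrightarrow> stable_prob d n p - \<epsilon> \<le> robust_prob d n (1 - (1 - p) ^ Suc l)"
    proof eventually_elim
      case (elim n)
      show ?case
      proof (intro allI impI)
        fix p assume asm: "0 \<le> p \<and> p \<le> 1 \<and> uncov d p (n - 2) < real n powr (- \<eta> d)"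
        let ?V = "{1..n}" and ?E = "[{1..n}]\<^bsup>2\<^esup>"
        have p: "0 \<le> p" "p \<le> 1" using asm by auto
        have u: "uncov d p (n - 2) \<le> real n powr - h" using asm by (simp add: h_def)
        have n: "real n > 0" "n \<ge> 1" "d \<le> n" using elim by auto
        have finE: "finite ?E" by simp
        have cardE: "real (card ?E) * (x * real n powr - 3) \<le> x * real n powr - 1" if "x \<ge> 0" for x
        proof -
          have "(n choose 2) \<le> n ^ 2"
            by (cases "2 \<le> n") (auto intro: binomial_le_pow simp: binomial_eq_0)
          hence "real (card ?E) \<le> real n ^ 2" 
            unfolding card_nsets2[OF finite_atLeastAtMost] by (simp del: of_nat_power add: of_nat_power[symmetric])
          also have "\<dots> = real n powr 2" using n by (simp add: powr_numeral)
          finally have "real (card ?E) * (x * real n powr - 3) \<le> real n powr 2 * (x * real n powr - 3)"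
            using that by (intro mult_right_mono) auto
          also have "\<dots> = x * real n powr (2 + - 3)" by (simp only: powr_add mult_ac)
          finally show ?thesis by simp
        qed
        have cov_iff: "bexp q ?E (\<lambda>S. of_bool (\<not> covered d S UNIV e)) = uncov d q (n - 2)" if e: "e \<in> ?E" for e q
        proof -
          have e': "e \<subseteq> ?V" "card e = 2" "finite e" using e by (auto simp: nsets_def)
          have "bexp q ?E (\<lambda>S. of_bool (\<not> covered d S UNIV e)) = bexp q ?E (\<lambda>S. of_bool (\<not> covered d S (?V - e) e))"
            by (intro bexp_cong HOL.refl) (simp add: covered_UNIV e')
          also have "\<dots> = uncov d q (card (?V - e))"
            using e' by (intro bexp_uncovered_eq) (auto simp: Un_absorb2)
          finally show ?thesis using e' by (simp add: card_Diff_subset)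
        qed
        show "stable_prob d n p - \<epsilon> \<le> robust_prob d n (1 - (1 - p) ^ Suc l)"
        \<comment> \<open>For large \<open>p\<close> the graph itself covers all pairs with high
          probability, so A_s already gives robustness. The smallness of \<open>p\<close> in the
          other case keeps the variance term under control.\<close>
        proof (cases "real n powr (- 3 * \<eta> d) \<le> p")
          case True
          hence small: "uncov d p (n - 2) \<le> real n powr - 3" using elim p by blast
          have "stable_prob d n p - robust_prob d n p \<le> bexp p ?E (\<lambda>S. \<Sum>e\<in>?E. of_bool (\<not> covered d S UNIV e))"
            unfolding stable_prob_def robust_prob_def bexp_diff[symmetric]
          proof (rule bexp_mono[OF p])
            fix S
            show "of_bool (wsat (?V, S) (complete_graph (d + 2)) = wsat_target d n) - of_bool (robust d n S)
              \<le> (\<Sum>e\<in>?E. of_bool (\<not> covered d S UNIV e) :: real)"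
            proof (cases "\<forall>e\<in>?E. covered d S UNIV e")
              case True
              thus ?thesis by (simp add: robust_def)
            next
              case False
              then obtain e where e: "e \<in> ?E" "\<not> covered d S UNIV e" by blast
              hence "(1::real) = of_bool (\<not> covered d S UNIV e)" by simp
              also have "\<dots> \<le> (\<Sum>e\<in>?E. of_bool (\<not> covered d S UNIV e))"
                using e(1) finE by (intro member_le_sum) auto
              finally show ?thesis by (simp add: of_bool_def split: if_splits)
            qed
          qed
          also have "\<dots> = real (card ?E) * uncov d p (n - 2)"
            unfolding bexp_sum using cov_iff by simp
          also have "\<dots> \<le> real (card ?E) * (1 * real n powr - 3)" using small by (intro mult_left_mono) auto
          also have "\<dots> \<le> 1 * real n powr - 1" by (rule cardE) simp
          also have "\<dots> \<le> (K + 1) * real n powr - 1" using K0 by (intro mult_right_mono) auto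
          finally have "stable_prob d n p - \<epsilon> \<le> robust_prob d n p" using elim by linarith
          also have "\<dots> \<le> robust_prob d n (1 - (1 - p) ^ Suc l)"
          proof (rule robust_prob_mono[OF d n(3) p(1)])
            have "(1 - p) ^ Suc l \<le> (1 - p) ^ 1" using p by (intro power_decreasing) auto
            thus "p \<le> 1 - (1 - p) ^ Suc l" by simp
          qed (rule union_level_le[OF p])
          finally show ?thesis .
        next
          case False
          hence psmall: "p \<le> real n powr - (3 * h)" by (simp add: h_def)
          define q where "q = 1 - (1 - p) ^ l"
          have q: "0 \<le> q" "q \<le> 1" using union_level_le[OF p] by (auto simp: q_def)
          define t where "t = real n powr - h1"
          have t0: "t > 0" using n by (simp add: t_def)
          define N where "N = n - 2"
          have nN: "2 * k * d \<le> N" "2 * c * d \<le> N" using elim by (auto simp: N_def)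
          have t: "uncov d p (N div 2 div k) \<le> t"
          proof -
            have "uncov d p (N div 2 div k) ^ c \<le> real n powr - h"
              using uncov_reduce[OF d k1 nN(1) p] u by (simp add: c_def N_def)
            thus ?thesis unfolding t_def h1_def
              using n c1 uncov_nonneg[OF p] by (intro powr_power_root_le) auto
          qed
          have uq: "uncov d q (N div 2 div c) \<le> real n powr - 3"
          proof -
            define x where "x = uncov d p (N div 2 div c)"
            have x0: "0 \<le> x" using uncov_nonneg[OF p] by (simp add: x_def)
            have "x ^ (2 ^ (4 * c * d)) \<le> real n powr - h"
              using uncov_reduce[OF d c1 nN(2) p] u by (simp add: x_def N_def)
            hence "x \<le> real n powr - h2" unfolding h2_def
              using n x0 by (intro powr_power_root_le) auto
            hence "x ^ l \<le> (real n powr - h2) ^ l" using x0 by (intro power_mono) auto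
            also have "\<dots> = real n powr - (real l * h2)"
              using n by (simp add: powr_realpow[symmetric] powr_powr mult.commute)
            also have "\<dots> \<le> real n powr - 3" using n lh by (intro powr_mono) auto
            finally show ?thesis using uncov_copies_le[OF p, of d l "N div 2 div c"] by (simp add: q_def x_def)
          qed
          \<comment> \<open>The bounds \<open>p \<le> n powr - (3 * h)\<close> and
            \<open>h1 \<le> h\<close> make \<open>p / t\<^sup>2\<close> at most
            \<open>n powr - h\<close>, the same order as \<open>(2 * t) ^ c\<close>.\<close>
          have block: "((2 * t) ^ c + real c * (real a * p / t\<^sup>2)) ^ k \<le> (2 ^ c + real c * real a) ^ k * real n powr - 3"
          proof -
            have "(2 * t) ^ c = 2 ^ c * real n powr - h"
              using n h1(3) by (simp add: power_mult_distrib t_def powr_realpow[symmetric] powr_powr)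
            moreover have "real a * p / t\<^sup>2 \<le> real a * real n powr - h"
            proof -
              have "p / t\<^sup>2 \<le> real n powr - (3 * h) / t\<^sup>2" using psmall by (intro divide_right_mono) auto
              also have "\<dots> = real n powr (- (3 * h) + (h1 + h1))"
              proof -
                have "t\<^sup>2 * real n powr (h1 + h1) = 1"
                  unfolding t_def power2_eq_square powr_add[symmetric] using n by simp
                hence "real n powr (h1 + h1) = 1 / t\<^sup>2" using t0 by (simp add: field_simps)
                thus ?thesis unfolding powr_add[of _ "- (3 * h)"] by simp
              qed
              also have "\<dots> \<le> real n powr - h" using n h1 by (intro powr_mono) auto
              finally have "real a * (p / t\<^sup>2) \<le> real a * real n powr - h" by (intro mult_left_mono) auto
              thus ?thesis by simp
            qed
            hence "real c * (real a * p / t\<^sup>2) \<le> real c * (real a * real n powr - h)" by (intro mult_left_mono) auto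
            ultimately have "(2 * t) ^ c + real c * (real a * p / t\<^sup>2) \<le> (2 ^ c + real c * real a) * real n powr - h"
              by (simp add: algebra_simps)
            hence "((2 * t) ^ c + real c * (real a * p / t\<^sup>2)) ^ k \<le> ((2 ^ c + real c * real a) * real n powr - h) ^ k"
              using t0 p by (intro power_mono) (auto intro!: add_nonneg_nonneg)
            also have "\<dots> = (2 ^ c + real c * real a) ^ k * real n powr - (real k * h)"
              using n by (simp add: power_mult_distrib powr_realpow[symmetric] powr_powr mult.commute)
            also have "\<dots> \<le> (2 ^ c + real c * real a) ^ k * real n powr - 3"
              using n kh by (intro mult_left_mono powr_mono) auto
            finally show ?thesis .
          qed
          define fail where "fail e S S' = (of_bool (\<not> covered d {x \<in> S. covered d S' UNIV x} UNIV e) :: real)" 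
            for e :: "nat set" and S S'
          have fail: "bexp q ?E (\<lambda>S. bexp p ?E (fail e S)) \<le> K * real n powr - 3" if e: "e \<in> ?E" for e
          proof -
            have cardV: "card (?V - e) = N" using e by (auto simp: nsets_def N_def card_Diff_subset)
            obtain C D where CD: "\<forall>i<c. C i \<subseteq> ?V - e \<and> card (C i) = N div 2 div c" "disjoint_family_on C {..<c}"
              "\<forall>j<k. D j \<subseteq> ?V - e \<and> card (D j) = N div 2 div k" "disjoint_family_on D {..<k}"
              "\<forall>i<c. \<forall>j<k. C i \<inter> D j = {}"
              using two_disjoint_block_families[of "?V - e" c k] c1 k1 unfolding cardV by auto
            have "bexp q ?E (\<lambda>S. bexp p ?E (fail e S)) \<le> real (card {..<c}) * uncov d q (N div 2 div c)
              + real ((d + 2 choose 2) ^ card {..<c}) *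
                ((2 * t) ^ card {..<c} + real (card {..<c}) * (real (d + 2 choose 2) * p / t\<^sup>2)) ^ card {..<k}"
              unfolding fail_def
              by (rule not_doubly_covered_prob[OF _ e p q, where C = C and D = D and m = "N div 2 div k"])
                (use CD t t0 in auto)
            also have "\<dots> \<le> real c * real n powr - 3 + real (a ^ c) * ((2 ^ c + real c * real a) ^ k * real n powr - 3)"
              unfolding card_lessThan a_def[symmetric] using uq block by (intro add_mono mult_left_mono) auto
            also have "\<dots> = K * real n powr - 3" by (simp add: K_def algebra_simps)
            finally show ?thesis .
          qed
          have lvl: "1 - (1 - p) ^ Suc l = q + p - q * p" by (simp add: q_def algebra_simps)
          \<comment> \<open>Coupling: \<open>S\<close> is the union of the fresh copies, at level
            \<open>q\<close>, and \<open>S'\<close> the original graph at level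
            \<open>p\<close>.\<close>
          have "stable_prob d n p - robust_prob d n (1 - (1 - p) ^ Suc l)
             = bexp q ?E (\<lambda>S. bexp p ?E (\<lambda>S'. of_bool (wsat (?V, S') (complete_graph (d + 2)) = wsat_target d n)
                 - of_bool (robust d n (S \<union> S'))))"
            unfolding lvl robust_prob_def bexp_union_copies[OF finE, symmetric] bexp_diff
            by (simp add: stable_prob_def)
          also have "\<dots> \<le> bexp q ?E (\<lambda>S. bexp p ?E (\<lambda>S'. \<Sum>e\<in>?E. fail e S S'))"
          proof (intro bexp_mono p q)
            fix S S' assume S: "S \<subseteq> ?E" "S' \<subseteq> ?E"
            show "of_bool (wsat (?V, S') (complete_graph (d + 2)) = wsat_target d n) - of_bool (robust d n (S \<union> S'))
              \<le> (\<Sum>e\<in>?E. fail e S S')"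
            proof (cases "\<forall>e\<in>?E. covered d {x \<in> S. covered d S' UNIV x} UNIV e")
              case True
              hence "wsat (?V, S') (complete_graph (d + 2)) = wsat_target d n \<Longrightarrow> robust d n (S \<union> S')"
                using robust_union[OF d n(3) S] by blast
              hence "of_bool (wsat (?V, S') (complete_graph (d + 2)) = wsat_target d n) - of_bool (robust d n (S \<union> S'))
                \<le> (0 :: real)" by auto
              also have "0 \<le> (\<Sum>e\<in>?E. fail e S S')" by (simp add: sum_nonneg fail_def)
              finally show ?thesis .
            next
              case False
              then obtain e where e: "e \<in> ?E" "fail e S S' = 1" by (auto simp: fail_def)
              have "fail e S S' \<le> (\<Sum>e\<in>?E. fail e S S')"
                using e(1) finE by (intro member_le_sum) (auto simp: fail_def)
              thus ?thesis using e(2) by (simp add: of_bool_def split: if_splits)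
            qed
          qed
          also have "\<dots> = (\<Sum>e\<in>?E. bexp q ?E (\<lambda>S. bexp p ?E (fail e S)))"
            unfolding bexp_sum ..
          also have "\<dots> \<le> (\<Sum>e\<in>?E. K * real n powr - 3)" using fail by (rule sum_mono)
          also have "\<dots> = real (card ?E) * (K * real n powr - 3)" by simp
          also have "\<dots> \<le> K * real n powr - 1" using K0 by (rule cardE)
          also have "\<dots> \<le> (K + 1) * real n powr - 1" by (intro mult_right_mono) auto
          finally show ?thesis using elim by linarith
        qed
      qed
    qed
  qed simp
qed

subsection \<open>The threshold\<close>

text \<open>The functions that are False outside \<open>?E\<close> are exactly the indicators of
  subsets of \<open>?E\<close>; under this bijection the product measure becomes the weights of
  \<open>bexp\<close>.\<close>

lemma prob_erdos_renyi:
  assumes p: "0 \<le> p" "p \<le> 1"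
  shows "measure_pmf.prob (erdos_renyi n p) A = bexp p ([{1..n}]\<^bsup>2\<^esup>) (\<lambda>S. of_bool (({1..n}, S) \<in> A))"
proof -
  let ?E = "[{1..n}]\<^bsup>2\<^esup>"
  let ?M = "Pi_pmf ?E False (\<lambda>_. bernoulli_pmf p)"
  define \<Omega> where "\<Omega> = PiE_dflt ?E False (\<lambda>_. UNIV :: bool set)"
  define ind where "ind S x = (x \<in> S)" for S and x :: "nat set"
  define X where "X = {f. ({1..n}, {e \<in> ?E. f e}) \<in> A}"
  have finE: "finite ?E" by simp
  have \<Omega>: "\<Omega> = ind ` Pow ?E"
  proof (intro equalityI subsetI)
    fix f assume f: "f \<in> \<Omega>"
    have "f x = ind {x \<in> ?E. f x} x" for x using f by (auto simp: \<Omega>_def PiE_dflt_def ind_def)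
    hence "f = ind {x \<in> ?E. f x}" by (rule ext)
    thus "f \<in> ind ` Pow ?E" by blast
  qed (auto simp: \<Omega>_def PiE_dflt_def ind_def)
  have inj: "inj_on ind (Pow ?E)" by (auto simp: inj_on_def ind_def fun_eq_iff)
  have fin\<Omega>: "finite \<Omega>" unfolding \<Omega> using finE by simp
  have sub: "set_pmf ?M \<subseteq> \<Omega>"
    using set_Pi_pmf_subset[OF finE, of False "\<lambda>_. bernoulli_pmf p"] by (auto simp: \<Omega>_def PiE_dflt_def)
  have "measure_pmf.prob (erdos_renyi n p) A = measure_pmf.prob ?M X"
    unfolding erdos_renyi_def measure_map_pmf X_def by (simp add: vimage_def)
  also have "\<dots> = measure_pmf.prob ?M (X \<inter> \<Omega>)"
    using sub by (intro measure_prob_cong_0) (auto simp: set_pmf_eq)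
  also have "\<dots> = (\<Sum>f\<in>X \<inter> \<Omega>. pmf ?M f)"
    using fin\<Omega> by (intro measure_measure_pmf_finite) auto
  also have "\<dots> = (\<Sum>f\<in>\<Omega>. pmf ?M f * of_bool (f \<in> X))"
    using fin\<Omega> by (intro sum.mono_neutral_cong_left) auto
  also have "\<dots> = (\<Sum>S\<in>Pow ?E. pmf ?M (ind S) * of_bool (ind S \<in> X))"
    unfolding \<Omega> sum.reindex[OF inj] comp_def ..
  also have "\<dots> = bexp p ?E (\<lambda>S. of_bool (({1..n}, S) \<in> A))"
    unfolding bexp_def
  proof (rule sum.cong[OF HOL.refl])
    fix S assume "S \<in> Pow ?E"
    hence S: "S \<subseteq> ?E" by simp
    have "pmf ?M (ind S) = (\<Prod>x\<in>?E. pmf (bernoulli_pmf p) (ind S x))"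
      using S by (intro pmf_Pi' finE) (auto simp: ind_def)
    also have "\<dots> = (\<Prod>x\<in>?E. if x \<in> S then p else 1 - p)"
      using p by (intro prod.cong) (auto simp: ind_def)
    also have "\<dots> = p ^ card S * (1 - p) ^ card (?E - S)"
      using S finE by (simp add: prod.If_cases Int_absorb1 Diff_eq[symmetric])
    finally have "pmf ?M (ind S) = p ^ card S * (1 - p) ^ card (?E - S)" .
    moreover have "{e \<in> ?E. ind S e} = S" using S by (auto simp: ind_def)
    hence "ind S \<in> X \<longleftrightarrow> ({1..n}, S) \<in> A" by (simp add: X_def)
    ultimately show "pmf ?M (ind S) * of_bool (ind S \<in> X)
      = p ^ card S * (1 - p) ^ card (?E - S) * of_bool (({1..n}, S) \<in> A)" by simp
  qed
  finally show ?thesis .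
qed

lemma prob_wsat_prop:
  assumes "0 \<le> p" "p \<le> 1" "d \<le> n"
  shows "measure_pmf.prob (erdos_renyi n p) (wsat_prop (d + 2)) = stable_prob d n p"
proof -
  have "({1..n}, S) \<in> wsat_prop (d + 2) \<longleftrightarrow> wsat ({1..n}, S) (complete_graph (d + 2)) = wsat_target d n" for S
  proof -
    have "int ((d + 2 - 2) choose 2) + (int (d + 2) - 2) * (int n - int (d + 2) + 2) = int (wsat_target d n)"
      using assms(3) by (simp add: wsat_target_def of_nat_diff)
    thus ?thesis unfolding wsat_prop_def by (simp del: of_nat_add)
  qed
  thus ?thesis unfolding prob_erdos_renyi[OF assms(1,2)] stable_prob_def by simp
qed

text \<open>Intermediate value theorem for a polynomial in \<open>p\<close> with value 0 at 0 and 1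
  at 1. The bound \<open>d + 2 \<le> n\<close> leaves \<open>d\<close> witnesses for each pair of
  the complete graph.\<close>

lemma robust_prob_half:
  assumes d: "d \<ge> 1" and n: "d + 2 \<le> n"
  shows "\<exists>r. 0 < r \<and> r < 1 \<and> robust_prob d n r = 1 / 2"
proof -
  let ?E = "[{1..n}]\<^bsup>2\<^esup>"
  have "\<not> robust d n {}"
  proof
    assume "robust d n {}"
    moreover have e: "{1, 2} \<in> ?E" using n d by (auto simp: nsets_def)
    ultimately have "covered d {} UNIV {1, 2::nat}" by (simp add: robust_def)
    then obtain W where W: "card W = d" "W \<inter> {1, 2} = {}" "[W \<union> {1, 2}]\<^bsup>2\<^esup> - {{1, 2::nat}} \<subseteq> {}"
      by (auto simp: covered_def)
    obtain x where "x \<in> W" using W(1) d by (metis card.empty ex_in_conv not_one_le_zero)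
    moreover have "x \<noteq> 1" using calculation W(2) by auto
    ultimately have "{x, 1} \<in> [W \<union> {1, 2}]\<^bsup>2\<^esup>" "{x, 1} \<noteq> {1, 2}" using W(2) by (auto simp: nsets_def doubleton_eq_iff)
    hence "{x, 1} \<in> [W \<union> {1, 2}]\<^bsup>2\<^esup> - {{1, 2::nat}}"
      by (simp only: Diff_iff singleton_iff simp_thms)
    from subsetD[OF W(3) this] show False by simp
  qed
  hence 0: "robust_prob d n 0 = 0" by (simp add: robust_prob_def bexp_zero)
  have "robust d n ?E"
  proof -
    obtain H where H: "percolates d H ?E" "card H = (d choose 2) + d * (n - d)"
      using percolates_complete_generators[of d n] n by auto
    have cov: "covered d ?E UNIV e" if e: "e \<in> ?E" for e
    proof -
      have e': "e \<subseteq> {1..n}" "card e = 2" "finite e" using e by (auto simp: nsets_def)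
      hence le: "d \<le> card ({1..n} - e)" using n by (simp add: card_Diff_subset)
      obtain W where W: "W \<subseteq> {1..n} - e" "card W = d" "finite W"
        by (rule obtain_subset_with_card_n[OF le])
      have "[W \<union> e]\<^bsup>2\<^esup> \<subseteq> ?E" using W(1) e'(1) by (intro nsets2_mono) auto
      thus ?thesis unfolding covered_def using W by (intro exI[of _ W] conjI) auto
    qed
    thus ?thesis
      using wsat_eq_if_all_covered[OF d _ order.refl H cov] n by (simp add: robust_def wsat_target_def)
  qed
  hence 1: "robust_prob d n 1 = 1" by (simp add: robust_prob_def bexp_one)
  have "\<exists>r\<ge>0. r \<le> 1 \<and> robust_prob d n r = 1 / 2"
  proof (rule IVT'[of "robust_prob d n"])
    show "continuous_on {0..1} (robust_prob d n)"
      unfolding robust_prob_def[abs_def] by (rule bexp_continuous_on)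
  qed (simp_all add: 0 1)
  then obtain r where r: "0 \<le> r" "r \<le> 1" "robust_prob d n r = 1 / 2" by blast
  have "r \<noteq> 0" "r \<noteq> 1" using r(3) 0 1 by auto
  thus ?thesis using r by (intro exI[of _ r]) auto
qed

text \<open>The union of \<open>k\<close> copies has level at most \<open>k * p\<close>, so
  monotonicity turns amplification by independent copies into a bound at a constant multiple of
  \<open>p\<close>.\<close>

lemma robust_prob_multiple:
  assumes "d \<ge> 1" "d \<le> n" "0 \<le> p" "p \<le> 1" "real k * p \<le> q" "q \<le> 1"
  shows "1 - (1 - robust_prob d n p) ^ k \<le> robust_prob d n q"
proof -
  have "1 - (1 - robust_prob d n p) ^ k \<le> robust_prob d n (1 - (1 - p) ^ k)"
    using robust_prob_copies[OF assms(1-4), of k] by linarith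
  also have "\<dots> \<le> robust_prob d n q"
    using union_level_le[OF assms(3,4), of k] assms by (intro robust_prob_mono) auto
  finally show ?thesis .
qed

text \<open>If A_s had probability above \<open>2 * \<delta>\<close>, pairs would rarely be
  uncovered, and sprinkling would give robustness with probability at least \<open>\<delta>\<close>
  after \<open>L\<close> copies. Then \<open>k * L\<close> copies push it above one half at a level
  not exceeding \<open>r\<close>, against the choice of \<open>r\<close>.\<close>

lemma stable_prob_tendsto_0:
  assumes d: "d \<ge> 1" and r: "\<And>n. 0 < r n" "\<And>n. r n < 1" "\<And>n. d + 2 \<le> n \<Longrightarrow> robust_prob d n (r n) = 1 / 2"
    and p: "\<And>n. 0 \<le> p n" "\<And>n. p n \<le> 1" and lim: "(\<lambda>n. p n / r n) \<longlonglongrightarrow> 0"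
  shows "(\<lambda>n. stable_prob d n (p n)) \<longlonglongrightarrow> 0"
proof (rule tendstoI)
  fix \<epsilon> :: real assume \<epsilon>: "\<epsilon> > 0"
  define \<delta> where "\<delta> = min \<epsilon> 1 / 3"
  have \<delta>: "0 < \<delta>" "\<delta> < 1" "2 * \<delta> < \<epsilon>" using \<epsilon> by (auto simp: \<delta>_def min_def)
  obtain L where L: "L \<ge> 1" "\<forall>\<epsilon>>0. \<forall>\<^sub>F n in sequentially. \<forall>p. 0 \<le> p \<and> p \<le> 1 \<and> uncov d p (n - 2) < real n powr (- \<eta> d)
    \<longrightarrow> stable_prob d n p - \<epsilon> \<le> robust_prob d n (1 - (1 - p) ^ L)"
    using robust_after_sprinkling[OF d] by blast
  obtain k where k: "(1 - \<delta>) ^ k < 1 / 2"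
    using real_arch_pow_inv[of "1 / 2" "1 - \<delta>"] \<delta> by auto
  \<comment> \<open>Chosen so that \<open>p n \<le> c * r n\<close> forces
    \<open>k * L * p n \<le> r n\<close>; the added 1 keeps the denominator positive.\<close>
  define c where "c = 1 / (real (k * L) + 1)"
  have c: "c > 0" by (simp add: c_def add_nonneg_pos)
  have L': "\<forall>\<^sub>F n in sequentially. \<forall>p. 0 \<le> p \<and> p \<le> 1 \<and> uncov d p (n - 2) < real n powr (- \<eta> d)
    \<longrightarrow> stable_prob d n p - \<delta> \<le> robust_prob d n (1 - (1 - p) ^ L)"
    using L(2) \<delta> by blast
  from L' unstable_if_uncov_large[OF d \<delta>(1)]
    order_tendstoD(2)[OF lim c] eventually_ge_at_top[of "d + 2"]
  show "\<forall>\<^sub>F n in sequentially. dist (stable_prob d n (p n)) 0 < \<epsilon>"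
  proof eventually_elim
    case (elim n)
    have n: "d \<le> n" using elim by simp
    have "0 \<le> stable_prob d n (p n)"
      unfolding stable_prob_def using p by (intro bexp_nonneg) auto
    moreover have "stable_prob d n (p n) \<le> 2 * \<delta>"
    proof (rule ccontr)
      assume big: "\<not> stable_prob d n (p n) \<le> 2 * \<delta>"
      have "uncov d (p n) (n - 2) < real n powr (- \<eta> d)"
      proof (rule ccontr)
        assume "\<not> uncov d (p n) (n - 2) < real n powr (- \<eta> d)"
        hence "stable_prob d n (p n) \<le> \<delta>" using elim(2) p by auto
        thus False using big \<delta> by linarith
      qed
      hence "stable_prob d n (p n) - \<delta> \<le> robust_prob d n (1 - (1 - p n) ^ L)"
        using elim(1) p by blast
      hence rb: "\<delta> \<le> robust_prob d n (1 - (1 - p n) ^ L)" using big by linarith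
      define q where "q = 1 - (1 - p n) ^ L"
      have q: "0 \<le> q" "q \<le> 1" "q \<le> real L * p n" using union_level_le[OF p(1)[of n] p(2)[of n], of L] by (auto simp: q_def)
      have "p n \<le> c * r n" using elim(3) r(1)[of n] by (simp add: pos_divide_less_eq)
      hence "p n * (real (k * L) + 1) \<le> c * r n * (real (k * L) + 1)" by (intro mult_right_mono) auto
      also have "\<dots> = c * (real (k * L) + 1) * r n" by (simp only: mult_ac)
      also have "c * (real (k * L) + 1) = 1" by (simp add: c_def add_nonneg_eq_0_iff)
      finally have "p n * (real (k * L) + 1) \<le> r n" by simp
      hence "real (k * L) * p n \<le> r n" using p(1)[of n] by (simp add: algebra_simps)
      moreover have "real k * q \<le> real k * (real L * p n)" using q(3) by (rule mult_left_mono) simp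
      ultimately have "real k * q \<le> r n" by (simp add: mult_ac)
      hence "1 - (1 - robust_prob d n q) ^ k \<le> robust_prob d n (r n)"
        using r(2)[of n] q by (intro robust_prob_multiple d n) auto
      also have "\<dots> = 1 / 2" using elim by (intro r(3))
      finally have "1 / 2 \<le> (1 - robust_prob d n q) ^ k" by linarith
      also have "\<dots> \<le> (1 - \<delta>) ^ k"
      proof (rule power_mono)
        show "1 - robust_prob d n q \<le> 1 - \<delta>" using rb by (simp add: q_def)
        show "0 \<le> 1 - robust_prob d n q"
          unfolding robust_prob_def using bexp_le_const[OF _ q(1,2), of "[{1..n}]\<^bsup>2\<^esup>" "\<lambda>S. of_bool (robust d n S)" 1] by simp
      qed
      finally show False using k by linarith
    qed
    ultimately show ?case using \<delta>(3) by simp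
  qed
qed

text \<open>After \<open>k\<close> copies of level \<open>r\<close> robustness fails with
  probability at most \<open>(1 / 2) ^ k\<close>, and robustness implies A_s.\<close>

lemma stable_prob_tendsto_1:
  assumes d: "d \<ge> 1" and r: "\<And>n. 0 < r n" "\<And>n. r n < 1" "\<And>n. d + 2 \<le> n \<Longrightarrow> robust_prob d n (r n) = 1 / 2"
    and p: "\<And>n. 0 \<le> p n" "\<And>n. p n \<le> 1" and lim: "filterlim (\<lambda>n. p n / r n) at_top sequentially"
  shows "(\<lambda>n. stable_prob d n (p n)) \<longlonglongrightarrow> 1"
proof (rule tendstoI)
  fix \<epsilon> :: real assume \<epsilon>: "\<epsilon> > 0"
  obtain k where k: "(1 / 2) ^ k < \<epsilon>" using real_arch_pow_inv[of \<epsilon> "1 / 2"] \<epsilon> by auto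
  from lim have "\<forall>\<^sub>F n in sequentially. real k \<le> p n / r n" by (simp add: filterlim_at_top)
  with eventually_ge_at_top[of "d + 2"]
  show "\<forall>\<^sub>F n in sequentially. dist (stable_prob d n (p n)) 1 < \<epsilon>"
  proof eventually_elim
    case (elim n)
    have n: "d \<le> n" using elim by simp
    have "real k * r n \<le> p n" using elim(2) r(1)[of n] by (simp add: field_simps)
    hence "1 - (1 - robust_prob d n (r n)) ^ k \<le> robust_prob d n (p n)"
      using r(1)[of n] r(2)[of n] p(2)[of n] by (intro robust_prob_multiple d n) auto
    hence "1 - (1 / 2) ^ k \<le> robust_prob d n (p n)" using r(3)[OF elim(1)] by simp
    also have "\<dots> \<le> stable_prob d n (p n)" by (rule robust_prob_le_stable_prob[OF p])
    finally have "1 - \<epsilon> < stable_prob d n (p n)" using k by linarith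
    moreover have "stable_prob d n (p n) \<le> 1"
      unfolding stable_prob_def using p by (intro bexp_le_const) auto
    ultimately show ?case by (simp add: dist_real_def)
  qed
qed

theorem theorem3p3:
  fixes s :: nat
  assumes "s \<ge> 3"
  shows "\<exists>r :: nat \<Rightarrow> real. (\<forall>n. 0 < r n \<and> r n < 1) \<and>
    (\<forall>p :: nat \<Rightarrow> real. (\<forall>n. 0 \<le> p n \<and> p n \<le> 1) \<longrightarrow>
      ((\<lambda>n. p n / r n) \<longlonglongrightarrow> 0 \<longrightarrow>
        (\<lambda>n. measure_pmf.prob (erdos_renyi n (p n)) (wsat_prop s)) \<longlonglongrightarrow> 0) \<and>
      (filterlim (\<lambda>n. p n / r n) at_top sequentially \<longrightarrow>
        (\<lambda>n. measure_pmf.prob (erdos_renyi n (p n)) (wsat_prop s)) \<longlonglongrightarrow> 1))"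
proof -
  define d where "d = s - 2"
  have d: "d \<ge> 1" and s: "s = d + 2" using assms by (auto simp: d_def)
  \<comment> \<open>For \<open>n < d + 2\<close> any value strictly between 0 and 1 serves, since
    the claim concerns limits only; it is set to \<open>1 / 2\<close>.\<close>
  have "\<forall>n. \<exists>r. 0 < r \<and> r < 1 \<and> (d + 2 \<le> n \<longrightarrow> robust_prob d n r = 1 / 2)"
  proof
    fix n
    show "\<exists>r. 0 < r \<and> r < 1 \<and> (d + 2 \<le> n \<longrightarrow> robust_prob d n r = 1 / 2)"
      using robust_prob_half[OF d, of n] by (cases "d + 2 \<le> n") (auto intro: exI[of _ "1 / 2"])
  qed
  then obtain r where r: "\<And>n. 0 < r n" "\<And>n. r n < 1" "\<And>n. d + 2 \<le> n \<Longrightarrow> robust_prob d n (r n) = 1 / 2"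
    by metis
  have eq: "\<forall>\<^sub>F n in sequentially. stable_prob d n (p n) = measure_pmf.prob (erdos_renyi n (p n)) (wsat_prop s)"
    if "\<forall>n. 0 \<le> p n \<and> p n \<le> 1" for p :: "nat \<Rightarrow> real"
    using eventually_ge_at_top[of d]
  proof eventually_elim
    case (elim n)
    thus ?case using prob_wsat_prop[of "p n" d n] that by (simp add: s)
  qed
  show ?thesis
  proof (intro exI[of _ r] conjI allI impI r(1,2))
    fix p :: "nat \<Rightarrow> real" assume p: "\<forall>n. 0 \<le> p n \<and> p n \<le> 1"
    assume "(\<lambda>n. p n / r n) \<longlonglongrightarrow> 0"
    hence "(\<lambda>n. stable_prob d n (p n)) \<longlonglongrightarrow> 0" using p by (intro stable_prob_tendsto_0[OF d r]) auto
    thus "(\<lambda>n. measure_pmf.prob (erdos_renyi n (p n)) (wsat_prop s)) \<longlonglongrightarrow> 0"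
      using tendsto_cong[OF eq[OF p]] by simp
  next
    fix p :: "nat \<Rightarrow> real" assume p: "\<forall>n. 0 \<le> p n \<and> p n \<le> 1"
    assume "filterlim (\<lambda>n. p n / r n) at_top sequentially"
    hence "(\<lambda>n. stable_prob d n (p n)) \<longlonglongrightarrow> 1" using p by (intro stable_prob_tendsto_1[OF d r]) auto
    thus "(\<lambda>n. measure_pmf.prob (erdos_renyi n (p n)) (wsat_prop s)) \<longlonglongrightarrow> 1"
      using tendsto_cong[OF eq[OF p]] by simp
  qed
qed

end
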